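(* Suppose that either (i) $\Gamma_D\ne\emptyset$, or (ii) $\Gamma_D=\emptyset$ and the discrete compatibility condition $$\sum_{S\in\mathcal S_h^C}|S|\,\alpha_h|_S\le\sum_{T\in\mathcal T_h}|T|\,f_h|_T\le\sum_{S\in\mathcal S_h^C}|S|\,\beta_h|_S$$ holds. Then there exists a unique $\mathbf u_h^{rt}\in K_h^\star$ such that $D_h^{rt}(\mathbf u_h^{rt})=\sup_{\mathbf v_h\in K_h^\star}D_h^{rt}(\mathbf v_h)$.
   Context: Setting. $\Omega\subset\mathbb R^d$, $d\in\{2,3\}$, is an open, bounded, polyhedral Lipschitz domain with outward unit normal $\mathbf n$; $\partial\Omega=\overline{\Gamma_D}\cup\overline{\Gamma_C}$ with $\Gamma_D,\Gamma_C$ relatively open and disjoint. Data: $f\in L^2(\Omega)$; $p_D\in H^{1/2}(\Gamma_D)$ (restrictions to $\Gamma_D$ of traces of $H^1(\Omega)$ functions); $\mathbf K:\Omega\to\mathbb R^{d\times d}$ measurable, symmetric, with $k_0|\xi|^2\le\xi^T\mathbf K(x)\xi\le k_1|\xi|^2$ for all $x,\xi$ and some $0<k_0<k_1$; $\alpha,\beta\in L^2(\Gamma_C)$ with $\alpha\le\beta$ a.e. $(\cdot,\cdot)_\Omega$ and $\langle\cdot,\cdot\rangle_\omega$ denote $L^2$ inner products. Mesh. $\mathcal T_h$ is a conforming simplicial triangulation of $\Omega$ with facets $\mathcal S_h$; every boundary facet is contained in exactly one of $\overline{\Gamma_D},\overline{\Gamma_C}$, and $\mathcal S_h^D,\mathcal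 S_h^C$ are the corresponding sets of boundary facets. $x_S$ is the barycenter of $S$. $\mathcal L^0(\mathcal T_h)$, $\mathcal L^0(\mathcal S_h^C)$ are the elementwise/facetwise constant functions; $\Pi_h$ and $\pi_h$ are the elementwise and facetwise $L^2$-projections onto constants (componentwise for vectors and matrices). Spaces. $\mathcal{RT}^0(\mathcal T_h)$ is the lowest-order Raviart–Thomas space $\{\mathbf v_h\in H(\mathrm{div};\Omega):\mathbf v_h|_T\in\mathbb P^0(T)^d\oplus\mathbf x\,\mathbb P^0(T)\ \forall T\in\mathcal T_h\}$. $\mathcal S^{1,cr}(\mathcal T_h)$ is the Crouzeix–Raviart space of elementwise affine functions continuous at barycenters of interior facets, with basis $\varphi_S$, $\varphi_S(x_{S'})=\delta_{S,S'}$. $\Pi_h^{cr}q=\sum_{S\in\mathcal S_h}\big(\tfrac1{|S|}\int_Sq\,ds\big)\varphi_S$ for $q\in H^1(\Omega)$. Discrete data. $\mathbf K_h=\Pi_h\mathbf K$, $f_h=\Pi_hf$, $\alpha_h=\pi_h\alpha$, $\beta_h=\pi_h\beta$, $p_D^h=\Pi_h^{cr}\widehat p_D$ with $\widehat p_D\in H^1(\Omega)$ any fixed function whose trace on $\Gamma_D$ is $p_D$. Discrete dual problem. $$K_h^\star=\{\mathbf v_h\in\mathcal{RT}^0(\mathcal T_h):\mathrm{div}\,\mathbf v_h=f_h\text{ in }\Omega,\ \alpha_h\le\mathbf v_h\cdot\mathbf n\le\beta_h\text{ on every }S\in\mathcal S_h^C\},$$ $$D_h^{rt}(\mathbf v_h)=-\tfrac12\|\mathbf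 K_h^{-1/2}\Pi_h\mathbf v_h\|_{L^2(\Omega)}^2-\langle p_D^h,\mathbf v_h\cdot\mathbf n\rangle_{\Gamma_D},\qquad\mathbf v_h\in K_h^\star.$$ *)

theory Defs
  imports "HOL-Analysis.Analysis"
begin

section \<open>Domains\<close>

text \<open>Locally, \<open>\<Omega>\<close> is the strict epigraph of a Lipschitz function defined on a hyperplane
  through the origin with unit normal \<open>e\<close>.\<close>

definition lipschitz_boundary :: "(real^'n) set \<Rightarrow> bool" where
  "lipschitz_boundary \<Omega> \<longleftrightarrow>
    (\<forall>x\<in>frontier \<Omega>. \<exists>U e \<gamma> L. open U \<and> x \<in> U \<and> norm e = 1 \<and>
       L-lipschitz_on {z. z \<bullet> e = 0} \<gamma> \<and>
       \<Omega> \<inter> U = {y \<in> U. y \<bullet> e > \<gamma> (y - (y \<bullet> e) *\<^sub>R e)})"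

definition polyhedral_lipschitz_domain :: "(real^'n) set \<Rightarrow> bool" where
  "polyhedral_lipschitz_domain \<Omega> \<longleftrightarrow>
    open \<Omega> \<and> connected \<Omega> \<and> \<Omega> \<noteq> {} \<and> bounded \<Omega> \<and> lipschitz_boundary \<Omega> \<and>
    (\<exists>\<P>. finite \<P> \<and> (\<forall>P\<in>\<P>. polytope P) \<and> closure \<Omega> = \<Union>\<P>)"

text \<open>Meaningful at the boundary points near which the boundary is flat, hence at almost every
  boundary point of a polyhedral domain.\<close>

definition outward_normal :: "(real^'n) set \<Rightarrow> real^'n \<Rightarrow> real^'n" where
  "outward_normal \<Omega> x =
    (THE n. norm n = 1 \<and> (\<exists>\<epsilon>>0. \<Omega> \<inter> ball x \<epsilon> = {y \<in> ball x \<epsilon>. (y - x) \<bullet> n < 0}))"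


section \<open>Surface measure\<close>

definition hyperplanes :: "(real^'n) set set" where
  "hyperplanes = {H. \<exists>\<nu> c. norm \<nu> = 1 \<and> H = {x. \<nu> \<bullet> x = c}}"

definition unit_normal :: "(real^'n) set \<Rightarrow> real^'n" where
  "unit_normal H = (SOME \<nu>. norm \<nu> = 1 \<and> (\<exists>c. H = {x. \<nu> \<bullet> x = c}))"

text \<open>The \<open>(d-1)\<close>-dimensional Lebesgue measure of \<open>A \<inter> H\<close>, computed as the volume of the right
  prism of height one over \<open>A \<inter> H\<close>.\<close>

definition hyperplane_area :: "(real^'n) set \<Rightarrow> (real^'n) set \<Rightarrow> ennreal" where
  "hyperplane_area H A =
    emeasure lborel {x + t *\<^sub>R unit_normal H | x t. x \<in> A \<inter> H \<and> t \<in> {0..1}}"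

text \<open>Two distinct hyperplanes meet in a set of area zero. So on a finite union of hyperplanes,
  in particular on the boundary of a polyhedron and on the facets of a mesh, the following measure
  is the usual \<open>(d-1)\<close>-dimensional surface measure.\<close>

definition borel_surface_measure :: "(real^'n) measure" where
  "borel_surface_measure =
    measure_of UNIV (sets borel) (\<lambda>A. \<integral>\<^sup>+ H. hyperplane_area H A \<partial>count_space hyperplanes)"

abbreviation surface_measure :: "(real^'n) measure" where
  "surface_measure \<equiv> completion borel_surface_measure"

abbreviation surface_on :: "(real^'n) set \<Rightarrow> (real^'n) measure" where
  "surface_on \<Gamma> \<equiv> restrict_space surface_measure \<Gamma>"

lemma unit_normal:
  assumes "H \<in> hyperplanes"
  obtains c where "norm (unit_normal H) = 1" "H = {x. unit_normal H \<bullet> x = c}"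
proof -
  have "\<exists>\<nu>. norm \<nu> = 1 \<and> (\<exists>c. H = {x. \<nu> \<bullet> x = c})"
    using assms by (auto simp: hyperplanes_def)
  from someI_ex[OF this] show thesis
    using that unfolding unit_normal_def by blast
qed

lemma hyperplane_area_eq_distr:
  assumes "norm (unit_normal H) = 1" "H = {x. unit_normal H \<bullet> x = c}" "A \<in> sets borel"
  defines "\<nu> \<equiv> unit_normal H"
  shows "hyperplane_area H A =
    emeasure (distr (restrict_space lborel {y. \<nu> \<bullet> y \<in> {c..c+1}}) borel
                    (\<lambda>y. y - (\<nu> \<bullet> y - c) *\<^sub>R \<nu>)) A"
proof -
  let ?p = "\<lambda>y. y - (\<nu> \<bullet> y - c) *\<^sub>R \<nu>"
  let ?S = "{y. \<nu> \<bullet> y \<in> {c..c+1}}"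
  have 1: "\<nu> \<bullet> \<nu> = 1" using assms(1) by (simp add: \<nu>_def dot_square_norm)
  have H: "x \<in> H \<longleftrightarrow> \<nu> \<bullet> x = c" for x using assms(2) unfolding \<nu>_def by auto
  have S: "?S \<in> sets lborel" by measurable
  have p: "?p \<in> measurable (restrict_space lborel ?S) borel"
    by (intro measurable_restrict_space1) measurable
  have "{x + t *\<^sub>R \<nu> | x t. x \<in> A \<inter> H \<and> t \<in> {0..1}} = ?p -` A \<inter> ?S"
  proof (intro equalityI subsetI)
    fix y assume "y \<in> {x + t *\<^sub>R \<nu> | x t. x \<in> A \<inter> H \<and> t \<in> {0..1}}"
    then obtain x t where "y = x + t *\<^sub>R \<nu>" "x \<in> A" "\<nu> \<bullet> x = c" "0 \<le> t" "t \<le> 1"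
      using H by auto
    then show "y \<in> ?p -` A \<inter> ?S" by (simp add: inner_add_right 1)
  next
    fix y assume y: "y \<in> ?p -` A \<inter> ?S"
    then have "?p y \<in> A \<inter> H" "\<nu> \<bullet> y - c \<in> {0..1}"
      by (auto simp: H inner_diff_right 1)
    moreover have "y = ?p y + (\<nu> \<bullet> y - c) *\<^sub>R \<nu>" by simp
    ultimately show "y \<in> {x + t *\<^sub>R \<nu> | x t. x \<in> A \<inter> H \<and> t \<in> {0..1}}" by blast
  qed
  then have "hyperplane_area H A = emeasure lborel (?p -` A \<inter> ?S)"
    by (simp add: hyperplane_area_def \<nu>_def)
  also have "\<dots> = emeasure (distr (restrict_space lborel ?S) borel ?p) A"
    using S by (subst emeasure_distr[OF p assms(3)], subst emeasure_restrict_space)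
      (auto simp: space_restrict_space)
  finally show ?thesis .
qed

lemma space_borel_surface_measure [simp]: "space borel_surface_measure = UNIV"
  and sets_borel_surface_measure [simp, measurable_cong]: "sets borel_surface_measure = sets borel"
  by (simp_all add: borel_surface_measure_def sets.sigma_sets_eq[of borel, simplified])

lemma emeasure_borel_surface_measure:
  assumes "A \<in> sets borel"
  shows "emeasure borel_surface_measure A = (\<integral>\<^sup>+ H. hyperplane_area H A \<partial>count_space hyperplanes)"
proof (rule emeasure_measure_of[OF borel_surface_measure_def])
  let ?\<mu> = "\<lambda>A. \<integral>\<^sup>+ H. hyperplane_area H A \<partial>count_space hyperplanes"
  show "countably_additive (sets borel_surface_measure) ?\<mu>"
  proof (rule countably_additiveI)
    fix B :: "nat \<Rightarrow> (real^'n) set"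
    assume B: "range B \<subseteq> sets borel_surface_measure" "disjoint_family B"
    have "(\<Sum>i. hyperplane_area H (B i)) = hyperplane_area H (\<Union>i. B i)"
      if H: "H \<in> hyperplanes" for H
    proof -
      obtain c where c: "norm (unit_normal H) = 1" "H = {x. unit_normal H \<bullet> x = c}"
        using unit_normal[OF H] .
      have "B i \<in> sets borel" for i using B(1) by auto
      then show ?thesis
        using B by (simp add: hyperplane_area_eq_distr[OF c] suminf_emeasure image_subset_iff)
    qed
    then have "?\<mu> (\<Union>i. B i) = (\<integral>\<^sup>+ H. (\<Sum>i. hyperplane_area H (B i)) \<partial>count_space hyperplanes)"
      by (intro nn_integral_cong) simp
    also have "\<dots> = (\<Sum>i. ?\<mu> (B i))"
      by (intro nn_integral_suminf) simp
    finally show "(\<Sum>i. ?\<mu> (B i)) = ?\<mu> (\<Union>i. B i)" by simp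
  qed
qed (use assms in \<open>auto simp: positive_def hyperplane_area_def\<close>)


section \<open>Function spaces\<close>

text \<open>Elements of \<open>L\<^sup>2\<close> are represented by functions; identities between them hold almost
  everywhere.\<close>

definition L2 :: "'a measure \<Rightarrow> ('a \<Rightarrow> 'b::euclidean_space) set" where
  "L2 M = {g. g \<in> borel_measurable M \<and> integrable M (\<lambda>x. (norm (g x))\<^sup>2)}"

text \<open>The \<open>L\<^sup>2(M)\<close>-orthogonal projection of \<open>g\<close> onto the constants.\<close>

definition const_proj :: "'a measure \<Rightarrow> ('a \<Rightarrow> 'b::euclidean_space) \<Rightarrow> 'b" where
  "const_proj M g = (THE c. \<forall>k. (LINT x|M. (g x - c) \<bullet> k) = 0)"

definition grad :: "(real^'n \<Rightarrow> real) \<Rightarrow> real^'n \<Rightarrow> real^'n" where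
  "grad \<phi> x = (\<chi> i. frechet_derivative \<phi> (at x) (axis i 1))"

primrec times_cont_diff :: "nat \<Rightarrow> (real^'n \<Rightarrow> real) \<Rightarrow> bool" where
  "times_cont_diff 0 \<phi> \<longleftrightarrow> continuous_on UNIV \<phi>"
| "times_cont_diff (Suc k) \<phi> \<longleftrightarrow>
    (\<forall>x. \<phi> differentiable at x) \<and> (\<forall>i. times_cont_diff k (\<lambda>x. grad \<phi> x $ i))"

definition smooth :: "(real^'n \<Rightarrow> real) \<Rightarrow> bool" where
  "smooth \<phi> \<longleftrightarrow> (\<forall>k. times_cont_diff k \<phi>)"

definition test_functions :: "(real^'n) set \<Rightarrow> (real^'n \<Rightarrow> real) set" where
  "test_functions \<Omega> = {\<phi>. smooth \<phi> \<and> (\<exists>C. compact C \<and> C \<subseteq> \<Omega> \<and> (\<forall>x. x \<notin> C \<longrightarrow> \<phi> x = 0))}"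

definition has_weak_grad ::
    "(real^'n) set \<Rightarrow> (real^'n \<Rightarrow> real) \<Rightarrow> (real^'n \<Rightarrow> real^'n) \<Rightarrow> bool" where
  "has_weak_grad \<Omega> q G \<longleftrightarrow> q \<in> L2 (lebesgue_on \<Omega>) \<and> G \<in> L2 (lebesgue_on \<Omega>) \<and>
    (\<forall>\<phi>\<in>test_functions \<Omega>.
       (LINT x|lebesgue_on \<Omega>. q x *\<^sub>R grad \<phi> x) = - (LINT x|lebesgue_on \<Omega>. \<phi> x *\<^sub>R G x))"

definition H1 :: "(real^'n) set \<Rightarrow> (real^'n \<Rightarrow> real) set" where
  "H1 \<Omega> = {q. \<exists>G. has_weak_grad \<Omega> q G}"

definition has_weak_div ::
    "(real^'n) set \<Rightarrow> (real^'n \<Rightarrow> real^'n) \<Rightarrow> (real^'n \<Rightarrow> real) \<Rightarrow> bool" where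
  "has_weak_div \<Omega> v w \<longleftrightarrow> v \<in> L2 (lebesgue_on \<Omega>) \<and> w \<in> L2 (lebesgue_on \<Omega>) \<and>
    (\<forall>\<phi>\<in>test_functions \<Omega>.
       (LINT x|lebesgue_on \<Omega>. v x \<bullet> grad \<phi> x) = - (LINT x|lebesgue_on \<Omega>. w x * \<phi> x))"

definition Hdiv :: "(real^'n) set \<Rightarrow> (real^'n \<Rightarrow> real^'n) set" where
  "Hdiv \<Omega> = {v. \<exists>w. has_weak_div \<Omega> v w}"

text \<open>The trace operator is the continuous extension of the restriction of smooth functions: \<open>g\<close> is
  the trace on \<open>\<Gamma> \<subseteq> closure \<Omega>\<close> of \<open>q \<in> H1 \<Omega>\<close> if it is the \<open>L\<^sup>2(\<Gamma>)\<close>-limit of the restrictions of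
  smooth functions converging to \<open>q\<close> in \<open>H1 \<Omega>\<close>.\<close>

definition has_trace ::
    "(real^'n) set \<Rightarrow> (real^'n \<Rightarrow> real) \<Rightarrow> (real^'n) set \<Rightarrow> (real^'n \<Rightarrow> real) \<Rightarrow> bool" where
  "has_trace \<Omega> q \<Gamma> g \<longleftrightarrow> g \<in> L2 (surface_on \<Gamma>) \<and>
    (\<exists>G \<phi>. has_weak_grad \<Omega> q G \<and> (\<forall>k::nat. smooth (\<phi> k)) \<and>
       (\<lambda>k. LINT x|lebesgue_on \<Omega>. (\<phi> k x - q x)\<^sup>2) \<longlonglongrightarrow> 0 \<and>
       (\<lambda>k. LINT x|lebesgue_on \<Omega>. (norm (grad (\<phi> k) x - G x))\<^sup>2) \<longlonglongrightarrow> 0 \<and>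
       (\<lambda>k. LINT x|surface_on \<Gamma>. (\<phi> k x - g x)\<^sup>2) \<longlonglongrightarrow> 0)"

definition H_half :: "(real^'n) set \<Rightarrow> (real^'n) set \<Rightarrow> (real^'n \<Rightarrow> real) set" where
  "H_half \<Omega> \<Gamma> = {g \<in> L2 (surface_on \<Gamma>).
     \<exists>q\<in>H1 \<Omega>. \<exists>g'. has_trace \<Omega> q (frontier \<Omega>) g' \<and> (AE x in surface_on \<Gamma>. g x = g' x)}"


section \<open>Meshes\<close>

definition conforming_triangulation :: "(real^'n) set \<Rightarrow> (real^'n) set set \<Rightarrow> bool" where
  "conforming_triangulation \<Omega> \<T> \<longleftrightarrow>
    triangulation \<T> \<and> (\<forall>T\<in>\<T>. int CARD('n) simplex T) \<and> \<Union>\<T> = closure \<Omega>"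

definition facets :: "(real^'n) set set \<Rightarrow> (real^'n) set set" where
  "facets \<T> = {S. \<exists>T\<in>\<T>. S facet_of T}"

definition boundary_facets :: "(real^'n) set \<Rightarrow> (real^'n) set set \<Rightarrow> (real^'n) set set" where
  "boundary_facets \<Omega> \<T> = {S \<in> facets \<T>. S \<subseteq> frontier \<Omega>}"

definition facets_on ::
    "(real^'n) set \<Rightarrow> (real^'n) set set \<Rightarrow> (real^'n) set \<Rightarrow> (real^'n) set set" where
  "facets_on \<Omega> \<T> \<Gamma> = {S \<in> boundary_facets \<Omega> \<T>. S \<subseteq> closure \<Gamma>}"

definition barycenter :: "(real^'n) set \<Rightarrow> real^'n" where
  "barycenter S = (\<Sum>v | v extreme_point_of S. v) /\<^sub>R real (card {v. v extreme_point_of S})"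

abbreviation vol :: "(real^'n) set \<Rightarrow> real" where
  "vol T \<equiv> measure lebesgue T"

abbreviation area :: "(real^'n) set \<Rightarrow> real" where
  "area S \<equiv> measure surface_measure S"

text \<open>Almost every point of \<open>\<Omega>\<close>, and almost every point of its boundary, lies in exactly one
  (closed) element.\<close>

definition elem_at :: "(real^'n) set set \<Rightarrow> real^'n \<Rightarrow> (real^'n) set" where
  "elem_at \<T> x = (THE T. T \<in> \<T> \<and> x \<in> T)"

definition Pi_h :: "(real^'n) set set \<Rightarrow> (real^'n \<Rightarrow> 'b::euclidean_space) \<Rightarrow> real^'n \<Rightarrow> 'b" where
  "Pi_h \<T> g x = const_proj (lebesgue_on (elem_at \<T> x)) g"

text \<open>Facetwise projection of a function given on \<open>\<Gamma>\<close>; its values off \<open>\<Gamma>\<close> are irrelevant, and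
  \<open>S - \<Gamma>\<close> is a null set for the facets \<open>S \<subseteq> closure \<Gamma>\<close> in question unless \<open>\<Gamma>\<close> has a relative
  boundary of positive area.\<close>

definition pi_h :: "(real^'n) set \<Rightarrow> (real^'n \<Rightarrow> real) \<Rightarrow> (real^'n) set \<Rightarrow> real" where
  "pi_h \<Gamma> g S = const_proj (surface_on S) (\<lambda>x. indicator \<Gamma> x * g x)"


section \<open>Finite element spaces\<close>

definition P1 :: "(real^'n \<Rightarrow> real) set" where
  "P1 = {w. \<exists>a b. w = (\<lambda>x. a \<bullet> x + b)}"

definition RT_local :: "(real^'n \<Rightarrow> real^'n) set" where
  "RT_local = {w. \<exists>a b. w = (\<lambda>x. a + b *\<^sub>R x)}"

text \<open>Finite element functions are, like all elements of \<open>L\<^sup>2\<close>, determined almost everywhere only.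
  If \<open>v\<close> restricted to the element \<open>T\<close> belongs to the polynomial space \<open>P\<close>, then \<open>local_poly P v T\<close>
  is that polynomial, and is used to evaluate \<open>v\<close> on the boundary of \<open>T\<close>.\<close>

definition local_poly ::
    "(real^'n \<Rightarrow> 'b) set \<Rightarrow> (real^'n \<Rightarrow> 'b) \<Rightarrow> (real^'n) set \<Rightarrow> real^'n \<Rightarrow> 'b" where
  "local_poly P v T = (THE w. w \<in> P \<and> (AE x in lebesgue_on T. v x = w x))"

definition boundary_value ::
    "(real^'n) set set \<Rightarrow> (real^'n \<Rightarrow> 'b) set \<Rightarrow> (real^'n \<Rightarrow> 'b) \<Rightarrow> real^'n \<Rightarrow> 'b" where
  "boundary_value \<T> P v x = local_poly P v (elem_at \<T> x) x"

definition RT0 :: "(real^'n) set \<Rightarrow> (real^'n) set set \<Rightarrow> (real^'n \<Rightarrow> real^'n) set" where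
  "RT0 \<Omega> \<T> = {v \<in> Hdiv \<Omega>. \<forall>T\<in>\<T>. \<exists>w\<in>RT_local. AE x in lebesgue_on T. v x = w x}"

definition normal_flux ::
    "(real^'n) set \<Rightarrow> (real^'n) set set \<Rightarrow> (real^'n \<Rightarrow> real^'n) \<Rightarrow> real^'n \<Rightarrow> real" where
  "normal_flux \<Omega> \<T> v x = boundary_value \<T> RT_local v x \<bullet> outward_normal \<Omega> x"

definition CR :: "(real^'n) set \<Rightarrow> (real^'n) set set \<Rightarrow> (real^'n \<Rightarrow> real) set" where
  "CR \<Omega> \<T> = {q. (\<forall>T\<in>\<T>. \<exists>w\<in>P1. AE x in lebesgue_on T. q x = w x) \<and>
     (\<forall>S \<in> facets \<T> - boundary_facets \<Omega> \<T>. \<forall>T\<in>\<T>. \<forall>T'\<in>\<T>. S facet_of T \<and> S facet_of T' \<longrightarrow>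
        local_poly P1 q T (barycenter S) = local_poly P1 q T' (barycenter S))}"

definition cr_basis :: "(real^'n) set \<Rightarrow> (real^'n) set set \<Rightarrow> (real^'n) set \<Rightarrow> real^'n \<Rightarrow> real" where
  "cr_basis \<Omega> \<T> S = (SOME \<phi>. \<phi> \<in> CR \<Omega> \<T> \<and>
     (\<forall>S'\<in>facets \<T>. \<forall>T\<in>\<T>. S' facet_of T \<longrightarrow>
        local_poly P1 \<phi> T (barycenter S') = (if S' = S then 1 else 0)))"

text \<open>The integral of \<open>q \<in> H1 \<Omega>\<close> over a facet is that of its trace, which is unique almost
  everywhere.\<close>

definition facet_mean ::
    "(real^'n) set \<Rightarrow> (real^'n \<Rightarrow> real) \<Rightarrow> (real^'n) set \<Rightarrow> real" where
  "facet_mean \<Omega> q S = (LINT x|surface_on S. (SOME g. has_trace \<Omega> q S g) x) / area S"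

definition Pi_cr ::
    "(real^'n) set \<Rightarrow> (real^'n) set set \<Rightarrow> (real^'n \<Rightarrow> real) \<Rightarrow> real^'n \<Rightarrow> real" where
  "Pi_cr \<Omega> \<T> q x = (\<Sum>S\<in>facets \<T>. facet_mean \<Omega> q S * cr_basis \<Omega> \<T> S x)"


section \<open>The discrete dual problem\<close>

text \<open>\<open>A\<^sup>-\<^sup>1\<^sup>/\<^sup>2\<close> for symmetric positive definite \<open>A\<close>.\<close>

definition inv_sqrt :: "real^'n^'n \<Rightarrow> real^'n^'n" where
  "inv_sqrt A = (THE B. transpose B = B \<and> (\<forall>\<xi>. 0 \<le> \<xi> \<bullet> (B *v \<xi>)) \<and> B ** B = matrix_inv A)"

definition K_star ::
    "(real^'n) set \<Rightarrow> (real^'n) set \<Rightarrow> (real^'n) set set \<Rightarrow> (real^'n \<Rightarrow> real) \<Rightarrow>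
     (real^'n \<Rightarrow> real) \<Rightarrow> (real^'n \<Rightarrow> real) \<Rightarrow> (real^'n \<Rightarrow> real^'n) set" where
  "K_star \<Omega> \<Gamma>C \<T> f \<alpha> \<beta> = {v \<in> RT0 \<Omega> \<T>. has_weak_div \<Omega> v (Pi_h \<T> f) \<and>
     (\<forall>S \<in> facets_on \<Omega> \<T> \<Gamma>C. AE x in surface_on S.
        pi_h \<Gamma>C \<alpha> S \<le> normal_flux \<Omega> \<T> v x \<and> normal_flux \<Omega> \<T> v x \<le> pi_h \<Gamma>C \<beta> S)}"

definition D_rt ::
    "(real^'n) set \<Rightarrow> (real^'n) set \<Rightarrow> (real^'n) set set \<Rightarrow> (real^'n \<Rightarrow> real^'n^'n) \<Rightarrow>
     (real^'n \<Rightarrow> real) \<Rightarrow> (real^'n \<Rightarrow> real^'n) \<Rightarrow> real" where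
  "D_rt \<Omega> \<Gamma>D \<T> K pDh v =
     - (1/2) * (LINT x|lebesgue_on \<Omega>. (norm (inv_sqrt (Pi_h \<T> K x) *v Pi_h \<T> v x))\<^sup>2)
     - (LINT x|surface_on \<Gamma>D. boundary_value \<T> P1 pDh x * normal_flux \<Omega> \<T> v x)"

end

theory Submission
  imports Defs
begin

text \<open>
  A field in the lowest-order Raviart--Thomas space is \<open>a T + b T *\<^sub>R x\<close> almost everywhere on each element
  \<open>T\<close>. Bump functions in the interior of \<open>T\<close> detect that its divergence there is \<open>d * b T\<close>
  (\<open>weak_div_coefficient\<close>), so the constraint on the divergence fixes \<open>b\<close>. The remaining unknowns are the
  finitely many vectors \<open>a T\<close>, on which admissibility imposes linear equations, one for each test function,
  and affine inequalities, two for each boundary facet that carries an obstacle (\<open>K_star_rep\<close>). So the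
  admissible coefficients form a closed convex set.

  The functional is minus the sum of two terms (\<open>energy\<close>). The first is a quadratic form in the element means
  \<open>a T + b T *\<^sub>R centroid T\<close>. It is positive definite because the mean of the coefficient matrix over an element
  is positive definite (\<open>const_proj_matrix\<close>) and hence has an injective inverse square root
  (\<open>inv_sqrt_injective\<close>). The second term is a combination of the fluxes through the boundary facets
  (\<open>boundary_functional_rep\<close>) and affine in \<open>a\<close>. A strongly convex functional has exactly one minimiser on a
  nonempty closed convex set of finite dimension (\<open>strongly_convex_minimiser\<close>, \<open>unique_minimiser\<close>).

  The remaining point is to construct an admissible field (\<open>K_star_nonempty\<close>). Boundary fluxes within the
  bounds are chosen such that they add up to the total source: if \<open>\<Gamma>D\<close> is nonempty, then there is a boundary
  facet without constraint that absorbs the difference, and otherwise the compatibility condition allows an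
  interpolation between the bounds. Any two elements are joined by a chain of elements with common facets
  (\<open>mesh_facet_connected\<close>). This holds since the domain is connected and paths in general position avoid
  all sets of codimension two. So the surplus of each element can be routed through the mesh
  (\<open>flow_with_boundary_data\<close>). On each element, a suitable combination of the fields \<open>x - p\<close>, \<open>p\<close> a vertex,
  has the resulting facet fluxes. Its divergence is correct in the weak sense because of the divergence
  theorem for \<open>\<phi> x *\<^sub>R (x - p)\<close>: this field is tangential to all facets but the one opposite \<open>p\<close>, and its
  contribution is a multiple of the mean of \<open>\<phi>\<close> over that facet. This mean is the same from both sides
  (\<open>fmean_shared_facet\<close>), so that the contributions of the two elements cancel (\<open>flow_weak_div\<close>). The
  divergence theorem needed is the special case of a function that vanishes on the facet
  (\<open>divergence_theorem_zero_facet\<close>), which follows by scaling the simplex towards the vertex. Areas enter only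
  through the formula for the volume of a simplex by base and height (\<open>volume_height_area\<close>).
\<close>

section \<open>Barycentric coordinates\<close>

definition verts :: "(real^'n) set \<Rightarrow> (real^'n) set" where
  "verts T = {v. v extreme_point_of T}"

abbreviation full_simplex :: "(real^'n) set \<Rightarrow> bool" where
  "full_simplex T \<equiv> int CARD('n) simplex T"

lemma full_simplex_verts:
  fixes T :: "(real^'n) set"
  assumes "full_simplex T"
  shows "finite (verts T)" "card (verts T) = CARD('n) + 1" "\<not> affine_dependent (verts T)"
    "convex hull verts T = T"
proof -
  obtain C where C: "\<not> affine_dependent C" "int (card C) = int CARD('n) + 1" "T = convex hull C"
    using assms unfolding simplex_def by blast
  have "verts T = C"
    using extreme_point_of_convex_hull_affine_independent[OF C(1)] C(3) by (auto simp: verts_def)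
  then show "finite (verts T)" "card (verts T) = CARD('n) + 1" "\<not> affine_dependent (verts T)"
    "convex hull verts T = T"
    using C aff_independent_finite by auto
qed

lemma affine_interpolation:
  fixes C :: "(real^'n) set" and w :: "real^'n \<Rightarrow> real"
  assumes "\<not> affine_dependent C"
  shows "\<exists>g c. \<forall>q\<in>C. g \<bullet> q + c = w q"
proof (cases "C = {}")
  case False
  then obtain a where a: "a \<in> C" by auto
  let ?B = "(\<lambda>x. - a + x) ` (C - {a})"
  have "independent ?B" using affine_dependent_iff_dependent2[OF a] assms by blast
  from linear_independent_extend[OF this, of "\<lambda>b. w (a + b) - w a"]
  obtain h where h: "linear h" "\<forall>b\<in>?B. h b = w (a + b) - w a" by auto
  have hx: "h x = adjoint h 1 \<bullet> x" for x
    using adjoint_works[OF h(1), of x 1] by (simp add: inner_commute)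
  have "adjoint h 1 \<bullet> q + (w a - adjoint h 1 \<bullet> a) = w q" if "q \<in> C" for q
  proof (cases "q = a")
    case False
    then have "h (- a + q) = w q - w a" using h(2) that by auto
    then show ?thesis by (simp add: hx inner_add_right inner_diff_right)
  qed simp
  then show ?thesis by blast
qed simp

text \<open>The barycentric coordinate \<open>lam T p\<close> is the affine function with value one at the vertex \<open>p\<close>
  and zero at the other vertices; \<open>bgrad T p\<close> is its gradient, an inner normal of the facet
  opposite \<open>p\<close>.\<close>

definition bcoeff :: "(real^'n) set \<Rightarrow> real^'n \<Rightarrow> (real^'n) \<times> real" where
  "bcoeff T p = (SOME gc. \<forall>q\<in>verts T. fst gc \<bullet> q + snd gc = (if q = p then 1 else 0))"

definition bgrad :: "(real^'n) set \<Rightarrow> real^'n \<Rightarrow> real^'n" where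
  "bgrad T p = fst (bcoeff T p)"

definition lam :: "(real^'n) set \<Rightarrow> real^'n \<Rightarrow> real^'n \<Rightarrow> real" where
  "lam T p x = bgrad T p \<bullet> x + snd (bcoeff T p)"

text \<open>The facet opposite \<open>p\<close> and its relative interior.\<close>

definition fac :: "(real^'n) set \<Rightarrow> real^'n \<Rightarrow> (real^'n) set" where
  "fac T p = convex hull (verts T - {p})"

definition ofac :: "(real^'n) set \<Rightarrow> real^'n \<Rightarrow> (real^'n) set" where
  "ofac T p = {x. lam T p x = 0 \<and> (\<forall>q\<in>verts T - {p}. 0 < lam T q x)}"

lemma lam_add: "lam T p (x + y) = lam T p x + bgrad T p \<bullet> y"
  and lam_diff: "lam T p x - lam T p y = bgrad T p \<bullet> (x - y)"
  by (simp_all add: lam_def inner_add_right inner_diff_right)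

lemma continuous_on_lam [continuous_intros]: "continuous_on A (lam T p)"
  unfolding lam_def[abs_def] by (intro continuous_intros)

lemma borel_measurable_lam [measurable]: "lam T p \<in> borel_measurable borel"
  by (intro borel_measurable_continuous_onI continuous_on_lam)

lemma lam_affine_comb:
  assumes "sum u I = 1"
  shows "lam T p (\<Sum>i\<in>I. u i *\<^sub>R y i) = (\<Sum>i\<in>I. u i * lam T p (y i))"
  using assms by (simp add: lam_def inner_sum_right sum.distrib distrib_left
      flip: sum_distrib_right)

lemma lam_segment: "lam T p ((1 - t) *\<^sub>R x + t *\<^sub>R y) = (1 - t) * lam T p x + t * lam T p y"
  by (simp add: lam_def inner_add_right algebra_simps)

context
  fixes T :: "(real^'n) set"
  assumes T: "full_simplex T"
begin

lemma lam_vertex: "q \<in> verts T \<Longrightarrow> lam T p q = (if q = p then 1 else 0)"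
proof -
  obtain g c where "\<forall>q\<in>verts T. g \<bullet> q + c = (if q = p then 1 else 0)"
    using affine_interpolation[OF full_simplex_verts(3)[OF T], of "\<lambda>q. if q = p then 1 else 0"] by blast
  then have "\<exists>gc. \<forall>q\<in>verts T. fst gc \<bullet> q + snd gc = (if q = p then 1 else 0)"
    by (intro exI[of _ "(g, c)"]) simp
  from someI_ex[OF this] show "q \<in> verts T \<Longrightarrow> lam T p q = (if q = p then 1 else 0)"
    unfolding lam_def bgrad_def bcoeff_def by blast
qed

lemma lam_vertex_comb:
  assumes "sum u (verts T) = 1" "p \<in> verts T"
  shows "lam T p (\<Sum>q\<in>verts T. u q *\<^sub>R q) = u p"
proof -
  have "lam T p (\<Sum>q\<in>verts T. u q *\<^sub>R q) = (\<Sum>q\<in>verts T. u q * (if q = p then 1 else 0))"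
    by (simp add: lam_affine_comb[OF assms(1)] lam_vertex)
  also have "\<dots> = u p" using full_simplex_verts(1)[OF T] assms(2) by (simp add: if_distrib cong: if_cong)
  finally show ?thesis .
qed

lemma lam_sum: "(\<Sum>p\<in>verts T. lam T p x) = 1"
  and lam_repr: "(\<Sum>p\<in>verts T. lam T p x *\<^sub>R p) = x"
proof -
  have "affine hull (verts T) = UNIV"
    using full_simplex_verts(2,3)[OF T] affine_independent_span_eq by force
  then have "x \<in> affine hull (verts T)" by simp
  then obtain u where u: "sum u (verts T) = 1" "(\<Sum>q\<in>verts T. u q *\<^sub>R q) = x"
    unfolding affine_hull_finite[OF full_simplex_verts(1)[OF T]] by auto
  have "lam T p x = u p" if "p \<in> verts T" for p
    using lam_vertex_comb[OF u(1) that] u(2) by simp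
  then show "(\<Sum>p\<in>verts T. lam T p x) = 1" "(\<Sum>p\<in>verts T. lam T p x *\<^sub>R p) = x"
    using u by simp_all
qed

lemma affine_lam_repr: "g \<bullet> x + c = (\<Sum>p\<in>verts T. lam T p x * (g \<bullet> p + c))" for c :: real
proof -
  have "g \<bullet> x = (\<Sum>p\<in>verts T. lam T p x * (g \<bullet> p))"
    by (subst lam_repr[symmetric]) (simp add: inner_sum_right)
  moreover have "c = (\<Sum>p\<in>verts T. lam T p x) * c" by (simp add: lam_sum)
  ultimately show ?thesis by (simp add: distrib_left sum.distrib sum_distrib_right)
qed

lemma hull_subset_verts:
  assumes "c \<subseteq> verts T"
  shows "convex hull c = {x. (\<forall>p\<in>verts T. 0 \<le> lam T p x) \<and> (\<forall>p\<in>verts T - c. lam T p x = 0)}"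
proof (intro equalityI subsetI)
  note fin = full_simplex_verts(1)[OF T]
  fix x assume "x \<in> convex hull c"
  then obtain u where u: "\<forall>q\<in>c. 0 \<le> u q" "sum u c = 1" "(\<Sum>q\<in>c. u q *\<^sub>R q) = x"
    using convex_hull_finite[of c] finite_subset[OF assms fin] by auto
  have "lam T p x = (if p \<in> c then u p else 0)" if "p \<in> verts T" for p
  proof -
    have "(\<Sum>q\<in>verts T. (if q \<in> c then u q else 0)) = 1"
      using u(2) assms fin by (simp add: sum.If_cases Int_absorb1)
    from lam_vertex_comb[OF this that] show ?thesis
      using u(3) assms fin by (simp add: if_distrib[where f="\<lambda>a. a *\<^sub>R _"] sum.If_cases Int_absorb1 cong: if_cong)
  qed
  then show "x \<in> {x. (\<forall>p\<in>verts T. 0 \<le> lam T p x) \<and> (\<forall>p\<in>verts T - c. lam T p x = 0)}"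
    using u(1) by auto
next
  note fin = full_simplex_verts(1)[OF T]
  fix x assume x: "x \<in> {x. (\<forall>p\<in>verts T. 0 \<le> lam T p x) \<and> (\<forall>p\<in>verts T - c. lam T p x = 0)}"
  then have "(\<Sum>p\<in>c. lam T p x) = 1"
    using sum.mono_neutral_right[OF fin assms, of "\<lambda>p. lam T p x"] lam_sum by auto
  moreover have "(\<Sum>p\<in>c. lam T p x *\<^sub>R p) = x"
    using sum.mono_neutral_right[OF fin assms, of "\<lambda>p. lam T p x *\<^sub>R p"] x lam_repr by auto
  ultimately show "x \<in> convex hull c"
    using x assms finite_subset[OF assms fin]
    by (subst convex_hull_finite) (auto intro!: exI[of _ "\<lambda>p. lam T p x"])
qed

lemma simplex_eq_lam: "T = {x. \<forall>p\<in>verts T. 0 \<le> lam T p x}"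
  using hull_subset_verts[of "verts T"] full_simplex_verts(4)[OF T] by simp

lemma mem_simplex: "x \<in> T \<longleftrightarrow> (\<forall>p\<in>verts T. 0 \<le> lam T p x)"
  using simplex_eq_lam by blast

lemma verts_subset: "verts T \<subseteq> T"
  by (auto simp: verts_def extreme_point_of_def)

lemma bgrad_vertex_diff:
  "p \<in> verts T \<Longrightarrow> q \<in> verts T \<Longrightarrow> p \<noteq> q \<Longrightarrow> bgrad T p \<bullet> (p - q) = 1"
  using lam_diff[of T p p q] by (simp add: lam_vertex)

lemma ex_other_vertex: "\<exists>q\<in>verts T. q \<noteq> p"
proof (rule ccontr)
  assume "\<not> ?thesis"
  then have "verts T \<subseteq> {p}" by blast
  then have "card (verts T) \<le> card {p}" by (intro card_mono) auto
  then show False using full_simplex_verts(2)[OF T] by simp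
qed

lemma bgrad_nonzero:
  assumes "p \<in> verts T"
  shows "bgrad T p \<noteq> 0"
proof -
  obtain q where "q \<in> verts T" "q \<noteq> p" using ex_other_vertex by blast
  then have "bgrad T p \<bullet> (p - q) = 1" using bgrad_vertex_diff assms by blast
  then show ?thesis by auto
qed

lemma interior_simplex: "interior T = {x. \<forall>p\<in>verts T. 0 < lam T p x}"
proof
  have "{x. \<forall>p\<in>verts T. 0 < lam T p x} = (\<Inter>p\<in>verts T. {x. 0 < lam T p x})" by auto
  also have "open \<dots>"
    using full_simplex_verts(1)[OF T]
    by (intro open_INT ballI open_Collect_less continuous_intros)
  finally show "{x. \<forall>p\<in>verts T. 0 < lam T p x} \<subseteq> interior T"
    by (intro interior_maximal) (auto simp: mem_simplex less_imp_le)
next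
  show "interior T \<subseteq> {x. \<forall>p\<in>verts T. 0 < lam T p x}"
  proof
    fix x assume x: "x \<in> interior T"
    then obtain e where e: "e > 0" "ball x e \<subseteq> T" by (meson mem_interior)
    have "0 < lam T p x" if p: "p \<in> verts T" for p
    proof -
      define g where "g = bgrad T p"
      have g: "g \<noteq> 0" using bgrad_nonzero p by (simp add: g_def)
      define y where "y = x + (- (e / (2 * norm g))) *\<^sub>R g"
      have "dist x y = e / 2" using g e by (simp add: y_def dist_norm)
      then have "y \<in> T" using e by (auto simp: ball_def)
      then have "0 \<le> lam T p y" using p mem_simplex by auto
      also have "lam T p y = lam T p x - (e / (2 * norm g)) * (g \<bullet> g)"
        by (simp add: y_def lam_def inner_diff_right inner_add_right g_def)
      finally have "(e / (2 * norm g)) * (g \<bullet> g) \<le> lam T p x" by simp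
      moreover have "0 < (e / (2 * norm g)) * (g \<bullet> g)" using g e(1) by simp
      ultimately show ?thesis by linarith
    qed
    then show "x \<in> {x. \<forall>p\<in>verts T. 0 < lam T p x}" by simp
  qed
qed

lemma fac_eq: "p \<in> verts T \<Longrightarrow> fac T p = {x\<in>T. lam T p x = 0}"
  using hull_subset_verts[of "verts T - {p}"] by (auto simp: fac_def mem_simplex)

lemma facet_of_simplex: "S facet_of T \<longleftrightarrow> (\<exists>p\<in>verts T. S = fac T p)"
proof -
  have "fac T p \<noteq> {}" for p using ex_other_vertex[of p] by (auto simp: fac_def)
  then show ?thesis
    using facet_of_convex_hull_affine_independent[OF full_simplex_verts(3)[OF T], of S]
    unfolding full_simplex_verts(4)[OF T] fac_def[symmetric] by blast
qed

lemma verts_fac: "verts (fac T p) = verts T - {p}"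
proof -
  have "\<not> affine_dependent (verts T - {p})"
    using affine_dependent_subset[of "verts T - {p}" "verts T"] full_simplex_verts(3)[OF T] by blast
  from extreme_point_of_convex_hull_affine_independent[OF this] show ?thesis
    unfolding fac_def verts_def[of "convex hull _"] by blast
qed

lemma fac_inj: "p \<in> verts T \<Longrightarrow> q \<in> verts T \<Longrightarrow> fac T p = fac T q \<Longrightarrow> p = q"
  using verts_fac[of p] verts_fac[of q] by auto

lemma ofac_subset_fac:
  assumes "p \<in> verts T"
  shows "ofac T p \<subseteq> fac T p"
proof
  note p = assms
  fix x assume x: "x \<in> ofac T p"
  have "0 \<le> lam T q x" if "q \<in> verts T" for q
    using x that by (cases "q = p") (auto simp: ofac_def less_imp_le)
  then show "x \<in> fac T p" using p x by (simp add: fac_eq ofac_def mem_simplex)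
qed

lemma compact_full_simplex: "compact T" and convex_full_simplex: "convex T"
  using T compact_simplex convex_simplex by auto

lemma compact_fac: "compact (fac T p)"
  unfolding fac_def using full_simplex_verts(1)[OF T] by (intro finite_imp_compact_convex_hull) auto

lemma barycenter_pos: "\<exists>x. \<forall>p\<in>verts T. 0 < lam T p x"
proof
  let ?n = "real (card (verts T))"
  have n: "?n > 0" using full_simplex_verts(2)[OF T] by simp
  have "lam T p (\<Sum>q\<in>verts T. (1 / ?n) *\<^sub>R q) = 1 / ?n" if "p \<in> verts T" for p
    by (rule lam_vertex_comb[OF _ that]) (use n in simp)
  then show "\<forall>p\<in>verts T. 0 < lam T p (\<Sum>q\<in>verts T. (1 / ?n) *\<^sub>R q)" using n by simp
qed

lemma interior_full_simplex_nonempty: "interior T \<noteq> {}"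
  using barycenter_pos by (auto simp: interior_simplex)

text \<open>The gradients of two barycentric coordinates are linearly independent, by evaluation at a
  third vertex.\<close>

lemma bgrad_independent:
  assumes d: "2 \<le> CARD('n)" and pq: "p \<in> verts T" "q \<in> verts T" "p \<noteq> q"
    and 0: "\<mu> *\<^sub>R bgrad T p + \<kappa> *\<^sub>R bgrad T q = 0"
  shows "\<mu> = 0 \<and> \<kappa> = 0"
proof -
  have "card (verts T - {p, q}) = CARD('n) + 1 - 2"
    using pq full_simplex_verts(1,2)[OF T] by (subst card_Diff_subset) auto
  then have "card (verts T - {p, q}) > 0" using d by simp
  then have "verts T - {p, q} \<noteq> {}" by (metis card.empty less_irrefl)
  then obtain r where r: "r \<in> verts T" "r \<noteq> p" "r \<noteq> q" by auto
  have *: "\<mu> * (bgrad T p \<bullet> z) + \<kappa> * (bgrad T q \<bullet> z) = 0" for z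
    using arg_cong[OF 0, of "\<lambda>v. v \<bullet> z"] by (simp add: inner_add_left)
  have "bgrad T p \<bullet> (p - r) = 1" "bgrad T q \<bullet> (p - r) = 0" "bgrad T q \<bullet> (q - r) = 1" "bgrad T p \<bullet> (q - r) = 0"
    using pq r by (simp_all add: lam_diff[symmetric] lam_vertex)
  then show ?thesis using *[of "p - r"] *[of "q - r"] by simp
qed

end


section \<open>Volume and linear maps\<close>

lemma emeasure_lborel_translate:
  fixes a :: "'a::euclidean_space"
  assumes [measurable]: "B \<in> sets borel"
  shows "emeasure lborel {y. x + y \<in> B} = emeasure lborel B"
    and "emeasure lborel {y. x - y \<in> B} = emeasure lborel B"
proof -
  have "emeasure lborel {y. x + c *\<^sub>R y \<in> B} = emeasure lborel B" if c: "\<bar>c\<bar> = 1" for c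
  proof -
    have "c \<noteq> 0" using c by auto
    from arg_cong[OF lborel_affine[OF this, of x], of "\<lambda>M. emeasure M B"]
    have "emeasure lborel B = emeasure (density (distr lborel borel (\<lambda>y. x + c *\<^sub>R y)) (\<lambda>_. ennreal (\<bar>c\<bar>^DIM('a)))) B"
      using c by simp
    also have "\<dots> = emeasure lborel {y. x + c *\<^sub>R y \<in> B}"
      using c by (simp add: emeasure_density emeasure_distr vimage_def)
    finally show ?thesis by simp
  qed
  from this[of 1] this[of "-1"] show "emeasure lborel {y. x + y \<in> B} = emeasure lborel B"
    "emeasure lborel {y. x - y \<in> B} = emeasure lborel B" by auto
qed

text \<open>A translation-invariant measure is a multiple of Lebesgue measure: for Borel sets \<open>A\<close> and \<open>B\<close>,
  exchanging the order of integration in \<open>\<integral>\<integral> 1\<^sub>A(x) 1\<^sub>B(x + y) dy d\<mu>(x)\<close> gives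
  \<open>\<mu>(A) vol(B) = \<mu>(B) vol(A)\<close>.\<close>

lemma translation_invariant_measure:
  fixes M :: "'a::euclidean_space measure"
  assumes sets [measurable_cong]: "sets M = sets borel" and sf: "sigma_finite_measure M"
    and trans: "\<And>x B. B \<in> sets borel \<Longrightarrow> emeasure M {y. y + x \<in> B} = emeasure M B"
    and A [measurable]: "A \<in> sets borel" and B [measurable]: "B \<in> sets borel"
  shows "emeasure M A * emeasure lborel B = emeasure M B * emeasure lborel A"
proof -
  interpret M: sigma_finite_measure M by fact
  interpret pair_sigma_finite M "lborel :: 'a measure" by unfold_locales
  have "emeasure M A * emeasure lborel B
      = (\<integral>\<^sup>+x. indicator A x * emeasure lborel {y. x + y \<in> B} \<partial>M)"
    by (simp add: emeasure_lborel_translate nn_integral_multc mult.commute sets)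
  also have "\<dots> = (\<integral>\<^sup>+x. (\<integral>\<^sup>+y. indicator A x * indicator B (x + y) \<partial>lborel) \<partial>M)"
  proof (rule nn_integral_cong)
    fix x
    have "(\<integral>\<^sup>+y. indicator A x * indicator B (x + y) \<partial>lborel)
        = indicator A x * (\<integral>\<^sup>+y. indicator {y. x + y \<in> B} y \<partial>lborel)"
      by (subst nn_integral_cmult[symmetric]) (auto simp: indicator_def)
    then show "indicator A x * emeasure lborel {y. x + y \<in> B} = (\<integral>\<^sup>+y. indicator A x * indicator B (x + y) \<partial>lborel)"
      by simp
  qed
  also have "\<dots> = (\<integral>\<^sup>+y. (\<integral>\<^sup>+x. indicator A x * indicator B (x + y) \<partial>M) \<partial>lborel)"
    by (rule Fubini'[symmetric]) measurable
  also have "\<dots> = (\<integral>\<^sup>+y. (\<integral>\<^sup>+x. indicator A (x - y) * indicator B x \<partial>M) \<partial>lborel)"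
  proof (rule nn_integral_cong)
    fix y
    have 1: "(\<integral>\<^sup>+x. indicator A x * indicator B (x + y) \<partial>M) = emeasure M {x. x + y \<in> {x. x - y \<in> A \<and> x \<in> B}}"
    proof -
      have "{x. x + y \<in> {x. x - y \<in> A \<and> x \<in> B}} \<in> sets M" unfolding sets by measurable
      from nn_integral_indicator[OF this] show ?thesis
        by (simp add: indicator_def of_bool_conj)
    qed
    have m: "{x. x - y \<in> A \<and> x \<in> B} \<in> sets borel" by measurable
    have 2: "(\<integral>\<^sup>+x. indicator A (x - y) * indicator B x \<partial>M) = emeasure M {x. x - y \<in> A \<and> x \<in> B}"
      using nn_integral_indicator[OF m[folded sets]] by (simp add: indicator_def of_bool_conj)
    show "(\<integral>\<^sup>+x. indicator A x * indicator B (x + y) \<partial>M) = (\<integral>\<^sup>+x. indicator A (x - y) * indicator B x \<partial>M)"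
      unfolding 1 2 by (rule trans[OF m])
  qed
  also have "\<dots> = (\<integral>\<^sup>+x. (\<integral>\<^sup>+y. indicator A (x - y) * indicator B x \<partial>lborel) \<partial>M)"
    by (rule Fubini') measurable
  also have "\<dots> = (\<integral>\<^sup>+x. emeasure lborel {y. x - y \<in> A} * indicator B x \<partial>M)"
  proof (rule nn_integral_cong)
    fix x
    have "(\<integral>\<^sup>+y. indicator A (x - y) * indicator B x \<partial>lborel)
        = (\<integral>\<^sup>+y. indicator {y. x - y \<in> A} y \<partial>lborel) * indicator B x"
      by (subst nn_integral_multc[symmetric]) (auto simp: indicator_def)
    then show "(\<integral>\<^sup>+y. indicator A (x - y) * indicator B x \<partial>lborel) = emeasure lborel {y. x - y \<in> A} * indicator B x"
      by simp
  qed
  also have "\<dots> = emeasure M B * emeasure lborel A"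
    by (simp add: emeasure_lborel_translate nn_integral_cmult_indicator sets) (simp add: mult.commute)
  finally show ?thesis .
qed

text \<open>For the linear bijections below the factor is the absolute value of the determinant. It is found
  from translation invariance and symmetry alone, without matrices.\<close>

definition volume_factor :: "('a::euclidean_space \<Rightarrow> 'a) \<Rightarrow> real \<Rightarrow> bool" where
  "volume_factor f c \<longleftrightarrow> linear f \<and> bij f \<and> 0 < c \<and>
    (\<forall>A\<in>sets borel. emeasure lborel A = ennreal c * emeasure lborel (f -` A))"

lemma linear_borel_measurable: "linear f \<Longrightarrow> f \<in> borel_measurable borel"
  for f :: "'a::euclidean_space \<Rightarrow> 'b::euclidean_space"
  by (intro borel_measurable_continuous_onI linear_continuous_on) (simp add: linear_conv_bounded_linear)

lemma linear_bij_inv: "linear f \<Longrightarrow> bij f \<Longrightarrow> linear (inv f)"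
  for f :: "'a::euclidean_space \<Rightarrow> 'a"
  using inj_linear_imp_inv_linear bij_is_inj by blast

text \<open>The image of Lebesgue measure under a linear bijection is again translation invariant.\<close>

lemma volume_factor_exists:
  fixes f :: "'a::euclidean_space \<Rightarrow> 'a"
  assumes "linear f" "bij f"
  shows "\<exists>c. volume_factor f c"
proof -
  have [measurable]: "f \<in> borel_measurable borel" "inv f \<in> borel_measurable borel"
    using assms by (auto intro!: linear_borel_measurable linear_bij_inv)
  define M where "M = distr lborel borel f"
  have sets: "sets M = sets borel" by (simp add: M_def)
  have em: "emeasure M A = emeasure lborel (f -` A)" if "A \<in> sets borel" for A
    using that by (simp add: M_def emeasure_distr)
  have trans: "emeasure M {y. y + x \<in> B} = emeasure M B" if [measurable]: "B \<in> sets borel" for x B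
  proof -
    have 1: "{y. y + x \<in> B} \<in> sets borel" by measurable
    have "f -` {y. y + x \<in> B} = {z. inv f x + z \<in> f -` B}"
      using assms by (auto simp: linear_add bij_is_surj surj_f_inv_f add.commute)
    then show ?thesis using emeasure_lborel_translate(1)[of "f -` B" "inv f x"]
        measurable_sets[of f borel borel B] em[OF 1] em[of B] by simp
  qed
  have bdd: "bounded (inv f ` cball 0 r)" for r
    using linear_bij_inv[OF assms] by (intro bounded_linear_image) (auto simp: linear_conv_bounded_linear)
  have vim: "f -` S = inv f ` S" for S
    using assms(2) by (simp add: bij_vimage_eq_inv_image)
  have fin: "emeasure M (cball 0 r) < \<infinity>" for r
    unfolding em[OF borel_closed[OF closed_cball]] vim
    by (intro emeasure_bounded_finite bdd)
  have sf: "sigma_finite_measure M"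
  proof
    show "\<exists>A. countable A \<and> A \<subseteq> sets M \<and> \<Union>A = space M \<and> (\<forall>a\<in>A. emeasure M a \<noteq> \<infinity>)"
    proof (intro exI[of _ "range (\<lambda>n::nat. cball 0 (real n))"] conjI ballI)
      show "\<Union>(range (\<lambda>n::nat. cball 0 (real n))) = space M"
        using real_arch_simple by (auto simp: M_def)
    qed (use fin in \<open>auto simp: sets less_top[symmetric]\<close>)
  qed
  let ?B = "box (0::'a) One"
  have B: "emeasure lborel ?B = 1"
    by (subst emeasure_lborel_box) auto
  have key: "emeasure M A = emeasure M ?B * emeasure lborel A" if "A \<in> sets borel" for A
    using translation_invariant_measure[OF sets sf trans that, of ?B] B by simp
  obtain r where "\<forall>x\<in>?B. norm x \<le> r" using bounded_box[of "0::'a" One] unfolding bounded_iff by blast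
  then have r: "?B \<subseteq> cball 0 r" by auto
  have "emeasure M ?B \<le> emeasure M (cball 0 r)" using r by (intro emeasure_mono) (auto simp: sets)
  then have MBfin: "emeasure M ?B < \<infinity>" using fin le_less_trans by blast
  have "emeasure M ?B \<noteq> 0"
  proof
    assume "emeasure M ?B = 0"
    then have "emeasure M UNIV = 0" using key[of UNIV] by simp
    then show False using em[of UNIV] by simp
  qed
  then have m: "0 < measure M ?B" "emeasure M ?B = ennreal (measure M ?B)"
    using MBfin by (auto simp: measure_def enn2real_positive_iff less_top zero_less_iff_neq_zero)
  have "volume_factor f (1 / measure M ?B)"
    unfolding volume_factor_def
  proof (intro conjI ballI)
    fix A :: "'a set" assume A: "A \<in> sets borel"
    have "ennreal (1 / measure M ?B) * emeasure lborel (f -` A) = ennreal (1 / measure M ?B) * (ennreal (measure M ?B) * emeasure lborel A)"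
      using key[OF A] em[OF A] m(2) by simp
    also have "\<dots> = ennreal (1 / measure M ?B * measure M ?B) * emeasure lborel A"
      by (subst ennreal_mult') (use m in \<open>auto simp: mult.assoc\<close>)
    also have "\<dots> = emeasure lborel A" using m(1) by simp
    finally show "emeasure lborel A = ennreal (1 / measure M ?B) * emeasure lborel (f -` A)" by simp
  qed (use assms m in auto)
  then show ?thesis by blast
qed

lemma volume_factor_unique:
  assumes "volume_factor f c" "volume_factor f c'"
  shows "c = c'"
proof -
  let ?B = "f ` (box (0::'a::euclidean_space) One)"
  have inj: "f -` ?B = box 0 One" using assms(1) by (auto simp: volume_factor_def bij_def inj_vimage_image_eq)
  have "open ?B" using assms(1) unfolding volume_factor_def
    by (intro open_surjective_linear_image) (auto simp: bij_def)
  then have B: "?B \<in> sets borel" by auto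
  have 1: "emeasure lborel (box (0::'a) One) = 1" by (subst emeasure_lborel_box) auto
  have "emeasure lborel ?B = ennreal c" "emeasure lborel ?B = ennreal c'"
    using assms B inj 1 unfolding volume_factor_def by (metis mult.right_neutral)+
  then show ?thesis using assms by (auto simp: volume_factor_def)
qed

lemma volume_factor_id: "volume_factor id 1"
  unfolding volume_factor_def using linear_id bij_id by (simp add: id_def)

lemma volume_factor_comp:
  fixes f g :: "'a::euclidean_space \<Rightarrow> 'a"
  assumes "volume_factor f c" "volume_factor g c'"
  shows "volume_factor (f \<circ> g) (c * c')"
  unfolding volume_factor_def
proof (intro conjI ballI)
  fix A :: "'a set" assume A: "A \<in> sets borel"
  have "f -` A \<in> sets borel"
    using measurable_sets[OF linear_borel_measurable A, of f] assms by (auto simp: volume_factor_def)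
  then show "emeasure lborel A = ennreal (c * c') * emeasure lborel ((f \<circ> g) -` A)"
    using assms A unfolding volume_factor_def
    by (auto simp: ennreal_mult mult.assoc vimage_comp[symmetric])
qed (use assms in \<open>auto simp: volume_factor_def intro: linear_compose bij_comp\<close>)

text \<open>An involution preserves volumes, since the square of its factor is one.\<close>

lemma volume_factor_conj_involution:
  assumes "linear R" "R \<circ> R = id" "volume_factor f c"
  shows "volume_factor (R \<circ> f \<circ> R) c"
proof -
  have "bij R" using assms(2) o_bij by blast
  then obtain r where r: "volume_factor R r" using volume_factor_exists[OF assms(1)] by blast
  then have "r * r = 1" using volume_factor_comp[OF r r] volume_factor_unique volume_factor_id unfolding assms(2) by blast
  then show ?thesis
    using volume_factor_comp[OF volume_factor_comp[OF r assms(3)] r] by (simp add: algebra_simps)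
qed

lemma reflection:
  fixes a :: "'a::euclidean_space"
  defines "R \<equiv> (\<lambda>x. x - (2 * (a \<bullet> x) / (a \<bullet> a)) *\<^sub>R a)"
  shows "linear R" "R \<circ> R = id"
proof -
  show "linear R" unfolding R_def
    by (intro linearI) (auto simp: inner_add_right algebra_simps add_divide_distrib)
  show "R \<circ> R = id"
    by (cases "a = 0") (auto simp: R_def fun_eq_iff inner_diff_right scaleR_left_diff_distrib[symmetric]
        algebra_simps simp flip: scaleR_left.add)
qed

lemma rank_one_linear: "linear (\<lambda>x. x + (g \<bullet> x) *\<^sub>R w)"
  by (intro linearI) (auto simp: inner_add_right algebra_simps)

lemma rank_one_bij:
  fixes g w :: "'a::euclidean_space"
  assumes "1 + g \<bullet> w \<noteq> 0"
  shows "bij (\<lambda>x. x + (g \<bullet> x) *\<^sub>R w)"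
proof -
  have "inj (\<lambda>x. x + (g \<bullet> x) *\<^sub>R w)"
  proof (subst linear_injective_0[OF rank_one_linear], intro allI impI)
    fix v assume v: "v + (g \<bullet> v) *\<^sub>R w = 0"
    have "(g \<bullet> v) * (1 + g \<bullet> w) = g \<bullet> (v + (g \<bullet> v) *\<^sub>R w)" by (simp add: inner_add_right algebra_simps)
    then have "g \<bullet> v = 0" using v assms by simp
    then show "v = 0" using v by simp
  qed
  then show ?thesis using linear_inj_imp_surj[OF rank_one_linear] by (simp add: bij_def)
qed

text \<open>The reflection that sends \<open>g\<close> to \<open>- g\<close> conjugates the shear to its inverse. So the factor of the
  shear equals that of its inverse, and its square is one.\<close>

lemma volume_factor_shear:
  fixes g w :: "'a::euclidean_space"
  assumes "g \<bullet> w = 0"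
  shows "volume_factor (\<lambda>x. x + (g \<bullet> x) *\<^sub>R w) 1"
proof -
  let ?f = "\<lambda>x. x + (g \<bullet> x) *\<^sub>R w" and ?h = "\<lambda>x. x + (g \<bullet> x) *\<^sub>R (- w)"
  define R where "R = (\<lambda>x. x - (2 * (g \<bullet> x) / (g \<bullet> g)) *\<^sub>R g)"
  have R: "linear R" "R \<circ> R = id" using reflection[of g] by (simp_all add: R_def)
  obtain c where c: "volume_factor ?f c"
    using volume_factor_exists[OF rank_one_linear rank_one_bij, of g w] assms by auto
  have "R \<circ> ?f \<circ> R = ?h"
  proof
    fix x
    have "R (?f (R x)) = R (R x) + (g \<bullet> R x) *\<^sub>R R w"
      using R(1) by (simp add: linear_add linear_scale)
    moreover have "R (R x) = x" using R(2) by (metis comp_apply id_apply)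
    moreover have "R w = w" "g \<bullet> R x = - (g \<bullet> x)"
      using assms by (cases "g = 0"; simp add: R_def inner_diff_right)+
    ultimately show "(R \<circ> ?f \<circ> R) x = ?h x" by simp
  qed
  then have "volume_factor ?h c" using volume_factor_conj_involution[OF R c] by simp
  from volume_factor_comp[OF this c] have "volume_factor (?h \<circ> ?f) (c * c)" .
  moreover have "?h \<circ> ?f = id" using assms by (auto simp: fun_eq_iff inner_add_right)
  moreover note volume_factor_id
  ultimately have "c * c = 1" using volume_factor_unique by metis
  then have "c = 1" using c by (auto simp: volume_factor_def square_eq_1_iff)
  then show ?thesis using c by simp
qed

lemma volume_factor_axis_scale:
  fixes e :: "'a::euclidean_space"
  assumes "e \<in> Basis" "0 < s"
  shows "volume_factor (\<lambda>x. x + (e \<bullet> x) *\<^sub>R ((s - 1) *\<^sub>R e)) s"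
proof -
  let ?f = "\<lambda>x. x + (e \<bullet> x) *\<^sub>R ((s - 1) *\<^sub>R e)"
  define c where "c j = (if j = e then s else 1)" for j
  have f: "0 + (\<Sum>j\<in>Basis. (c j * (x \<bullet> j)) *\<^sub>R j) = ?f x" for x
  proof -
    have "(\<Sum>j\<in>Basis. (c j * (x \<bullet> j)) *\<^sub>R j)
        = (\<Sum>j\<in>Basis. (x \<bullet> j) *\<^sub>R j + (if j = e then ((s - 1) * (x \<bullet> e)) *\<^sub>R e else 0))"
      by (intro sum.cong) (auto simp: c_def algebra_simps)
    also have "\<dots> = x + ((s - 1) * (x \<bullet> e)) *\<^sub>R e"
      using assms(1) by (simp add: sum.distrib euclidean_representation)
    finally show ?thesis by (simp add: inner_commute mult.commute)
  qed
  have "\<bar>c j\<bar> = (if j = e then s else 1)" for j using assms(2) by (simp add: c_def)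
  then have p: "(\<Prod>j\<in>Basis. \<bar>c j\<bar>) = s" using assms(1) by simp
  have e: "e \<bullet> e = 1" using assms(1) by simp
  have l: "lborel = density (distr lborel borel ?f) (\<lambda>_. ennreal s)"
    using lborel_affine_euclidean[of c 0] assms(2) unfolding f p by (simp add: c_def)
  show ?thesis unfolding volume_factor_def
  proof (intro conjI ballI)
    fix A :: "'a set" assume "A \<in> sets borel"
    then show "emeasure lborel A = ennreal s * emeasure lborel (?f -` A)"
      by (subst l) (simp add: emeasure_density emeasure_distr nn_integral_cmult)
  next
    show "bij ?f" using assms e by (intro rank_one_bij) simp
    show "linear ?f" by (rule rank_one_linear)
  qed (use assms in auto)
qed

text \<open>Scalings along two unit vectors are conjugate by the reflection that exchanges the vectors. For a
  basis vector the factor is known from the coordinates.\<close>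

lemma volume_factor_scale:
  fixes \<nu> :: "'a::euclidean_space"
  assumes "norm \<nu> = 1" "0 < s"
  shows "volume_factor (\<lambda>x. x + (\<nu> \<bullet> x) *\<^sub>R ((s - 1) *\<^sub>R \<nu>)) s"
proof -
  obtain e :: 'a where e: "e \<in> Basis" using nonempty_Basis by blast
  define a where "a = \<nu> - e"
  define R where "R = (\<lambda>x. x - (2 * (a \<bullet> x) / (a \<bullet> a)) *\<^sub>R a)"
  have R: "linear R" "R \<circ> R = id" using reflection[of a] by (simp_all add: R_def)
  have RR: "R (R x) = x" for x using R(2) by (metis comp_apply id_apply)
  have 1: "\<nu> \<bullet> \<nu> = 1" "e \<bullet> e = 1" using assms(1) e by (auto simp: dot_square_norm)
  have "a \<bullet> a = 2 * (a \<bullet> \<nu>)" by (simp add: a_def inner_diff_left inner_diff_right 1 inner_commute)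
  then have Rnu: "R \<nu> = e" by (cases "a = 0") (auto simp: R_def a_def)
  then have Re: "R e = \<nu>" using RR by metis
  have Rinner: "e \<bullet> R x = \<nu> \<bullet> x" for x
  proof -
    have "a \<bullet> e = - (a \<bullet> a) / 2" by (simp add: a_def inner_diff_left inner_diff_right 1 inner_commute)
    then have "e \<bullet> R x = e \<bullet> x + a \<bullet> x" by (cases "a = 0") (auto simp: R_def inner_diff_right inner_commute)
    then show ?thesis by (simp add: a_def inner_diff_left)
  qed
  have "R \<circ> (\<lambda>x. x + (e \<bullet> x) *\<^sub>R ((s - 1) *\<^sub>R e)) \<circ> R = (\<lambda>x. x + (\<nu> \<bullet> x) *\<^sub>R ((s - 1) *\<^sub>R \<nu>))"
    using R(1) by (auto simp: fun_eq_iff linear_add linear_scale RR Re Rinner)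
  then show ?thesis
    using volume_factor_conj_involution[OF R volume_factor_axis_scale[OF e assms(2)]] by simp
qed

text \<open>A scaling along \<open>g\<close> followed by a shear.\<close>

lemma volume_factor_rank_one:
  fixes g w :: "'a::euclidean_space"
  assumes "0 < 1 + g \<bullet> w"
  shows "volume_factor (\<lambda>x. x + (g \<bullet> x) *\<^sub>R w) (1 + g \<bullet> w)"
proof (cases "g = 0")
  case True
  then show ?thesis using volume_factor_shear[of g w] by simp
next
  case False
  define s \<nu> u where "s = 1 + g \<bullet> w" and "\<nu> = g /\<^sub>R norm g" and "u = norm g *\<^sub>R w - (g \<bullet> w) *\<^sub>R \<nu>"
  have \<nu>: "norm \<nu> = 1" "\<nu> \<bullet> \<nu> = 1" using False by (auto simp: \<nu>_def dot_square_norm)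
  have g: "g = norm g *\<^sub>R \<nu>" using False by (simp add: \<nu>_def)
  have gw: "g \<bullet> w = norm g * (\<nu> \<bullet> w)" by (subst g) simp
  have u: "\<nu> \<bullet> ((1 / s) *\<^sub>R u) = 0" by (simp add: u_def inner_diff_right \<nu> gw)
  have s: "0 < s" using assms by (simp add: s_def)
  have "(\<lambda>x. x + (\<nu> \<bullet> x) *\<^sub>R ((1 / s) *\<^sub>R u)) \<circ> (\<lambda>x. x + (\<nu> \<bullet> x) *\<^sub>R ((s - 1) *\<^sub>R \<nu>)) = (\<lambda>x. x + (g \<bullet> x) *\<^sub>R w)"
  proof
    fix x
    let ?y = "x + (\<nu> \<bullet> x) *\<^sub>R ((s - 1) *\<^sub>R \<nu>)"
    have "\<nu> \<bullet> ?y = s * (\<nu> \<bullet> x)" by (simp add: inner_add_right \<nu> algebra_simps)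
    then have "?y + (\<nu> \<bullet> ?y) *\<^sub>R ((1 / s) *\<^sub>R u) = ?y + (\<nu> \<bullet> x) *\<^sub>R u" using s by simp
    also have "\<dots> = x + (\<nu> \<bullet> x) *\<^sub>R (norm g *\<^sub>R w)"
      by (simp add: u_def s_def algebra_simps)
    also have "\<dots> = x + (g \<bullet> x) *\<^sub>R w" by (subst (2) g) (simp add: mult.commute)
    finally show "((\<lambda>x. x + (\<nu> \<bullet> x) *\<^sub>R ((1 / s) *\<^sub>R u)) \<circ> (\<lambda>x. x + (\<nu> \<bullet> x) *\<^sub>R ((s - 1) *\<^sub>R \<nu>))) x = x + (g \<bullet> x) *\<^sub>R w"
      by simp
  qed
  then show ?thesis
    using volume_factor_comp[OF volume_factor_shear[OF u] volume_factor_scale[OF \<nu>(1) s]] by (simp add: s_def)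
qed


section \<open>The inverse square root of a positive definite matrix\<close>

text \<open>A maximiser of the Rayleigh quotient on an invariant subspace is an eigenvector, and its
  orthogonal complement in the subspace is again invariant.\<close>

lemma selfadjoint_eigenvector:
  fixes f :: "'a::euclidean_space \<Rightarrow> 'a"
  assumes f: "linear f" and sym: "\<And>x y. f x \<bullet> y = x \<bullet> f y"
    and V: "subspace V" "f ` V \<subseteq> V" "V \<noteq> {0}"
  obtains e \<mu> where "e \<in> V" "norm e = 1" "f e = \<mu> *\<^sub>R e"
proof -
  obtain v where v: "v \<in> V" "v \<noteq> 0" using V subspace_0 by blast
  let ?K = "V \<inter> sphere 0 1"
  have "compact ?K" using closed_subspace[OF V(1)] by (intro closed_Int_compact) auto
  moreover have "v /\<^sub>R norm v \<in> ?K" using v V(1) by (auto simp: subspace_scale)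
  then have "?K \<noteq> {}" by blast
  moreover have "continuous_on ?K (\<lambda>x. f x \<bullet> x)"
    using f by (intro continuous_intros linear_continuous_on) (simp add: linear_conv_bounded_linear)
  ultimately obtain e where e: "e \<in> ?K" "\<And>y. y \<in> ?K \<Longrightarrow> f y \<bullet> y \<le> f e \<bullet> e"
    using continuous_attains_sup[of ?K "\<lambda>x. f x \<bullet> x"] by blast
  define \<mu> where "\<mu> = f e \<bullet> e"
  have e1: "e \<in> V" "e \<bullet> e = 1" using e(1) by (auto simp: dot_square_norm)
  have max: "f y \<bullet> y \<le> \<mu> * (y \<bullet> y)" if "y \<in> V" for y
  proof (cases "y = 0")
    case False
    have "y /\<^sub>R norm y \<in> ?K" using that False V(1) by (auto simp: subspace_scale)
    from e(2)[OF this] have "(f y \<bullet> y) / (norm y * norm y) \<le> \<mu>"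
      using f by (simp add: linear_scale \<mu>_def divide_simps)
    then show ?thesis using False by (simp add: divide_simps dot_square_norm power2_eq_square)
  qed (use f in \<open>simp add: linear_0\<close>)
  define w where "w = f e - \<mu> *\<^sub>R e"
  have wV: "w \<in> V" unfolding w_def using e1 V by (intro subspace_diff subspace_scale) auto
  have we: "w \<bullet> e = 0" by (simp add: w_def inner_diff_left \<mu>_def e1)
  have "w \<bullet> w = 0"
  proof (rule ccontr)
    assume n: "w \<bullet> w \<noteq> 0"
    then have n: "0 < w \<bullet> w" by (simp add: inner_gt_zero_iff)
    have key: "2 * t * (w \<bullet> w) + t\<^sup>2 * (f w \<bullet> w - \<mu> * (w \<bullet> w)) \<le> 0" for t
    proof -
      have few: "f e \<bullet> w = w \<bullet> w" "f w \<bullet> e = w \<bullet> w"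
        using we sym[of w e] by (auto simp: w_def inner_diff_left inner_diff_right inner_commute)
      have "e + t *\<^sub>R w \<in> V" using e1 wV V(1) by (intro subspace_add subspace_scale)
      from max[OF this] show ?thesis
        using f we by (simp add: linear_add linear_scale inner_add_left inner_add_right few e1 \<mu>_def[symmetric]
            inner_commute[of e w] power2_eq_square algebra_simps)
    qed
    define b where "b = \<bar>f w \<bullet> w - \<mu> * (w \<bullet> w)\<bar> + 1"
    have b: "0 < b" "- b \<le> f w \<bullet> w - \<mu> * (w \<bullet> w)" by (auto simp: b_def)
    define t where "t = (w \<bullet> w) / b"
    have t: "0 < t" "t * b = w \<bullet> w" using n b by (auto simp: t_def)
    have "t\<^sup>2 * (- b) \<le> t\<^sup>2 * (f w \<bullet> w - \<mu> * (w \<bullet> w))" using b by (intro mult_left_mono) auto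
    then have "2 * t * (w \<bullet> w) - t * (t * b) \<le> 0" using key[of t] by (simp add: power2_eq_square algebra_simps)
    then have "t * (w \<bullet> w) \<le> 0" using t by simp
    then show False using t n by (simp add: mult_le_0_iff)
  qed
  then have "f e = \<mu> *\<^sub>R e" by (simp add: w_def)
  then show thesis using that[of e \<mu>] e by auto
qed

lemma selfadjoint_eigenbasis:
  fixes f :: "'a::euclidean_space \<Rightarrow> 'a"
  assumes f: "linear f" and sym: "\<And>x y. f x \<bullet> y = x \<bullet> f y"
    and V: "subspace V" "f ` V \<subseteq> V"
  shows "\<exists>E \<mu>. finite E \<and> E \<subseteq> V \<and> pairwise orthogonal E \<and> (\<forall>e\<in>E. norm e = 1 \<and> f e = \<mu> e *\<^sub>R e) \<and> V \<subseteq> span E"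
  using V
proof (induction "dim V" arbitrary: V rule: less_induct)
  case less
  show ?case
  proof (cases "V = {0}")
    case True
    then show ?thesis by (intro exI[of _ "{}"]) auto
  next
    case False
    obtain e \<mu> where e: "e \<in> V" "norm e = 1" "f e = \<mu> *\<^sub>R e"
      using selfadjoint_eigenvector[OF f sym less.prems False] .
    have ee: "e \<bullet> e = 1" using e by (simp add: dot_square_norm)
    let ?W = "V \<inter> {x. e \<bullet> x = 0}"
    have W: "subspace ?W" using less.prems(1) subspace_hyperplane[of e] by (rule subspace_inter)
    have fW: "f ` ?W \<subseteq> ?W"
    proof
      fix y assume "y \<in> f ` ?W"
      then obtain x where x: "y = f x" "x \<in> V" "e \<bullet> x = 0" by auto
      have "e \<bullet> y = f e \<bullet> x" using sym[of e x] x(1) by simp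
      also have "\<dots> = 0" using e(3) x(3) by simp
      finally show "y \<in> ?W" using less.prems(2) x by auto
    qed
    have "e \<notin> ?W" using ee by simp
    then have "?W \<subset> V" using e(1) by blast
    then have "span ?W \<subset> span V"
      unfolding span_eq_iff[THEN iffD2, OF W] span_eq_iff[THEN iffD2, OF less.prems(1)] .
    then have "dim ?W < dim V" by (rule dim_psubset)
    from less.hyps[OF this W fW] obtain E \<nu> where E: "finite E" "E \<subseteq> ?W" "pairwise orthogonal E"
      "\<forall>e\<in>E. norm e = 1 \<and> f e = \<nu> e *\<^sub>R e" "?W \<subseteq> span E" by blast
    have "e \<notin> E" using E(2) ee by auto
    have "V \<subseteq> span (insert e E)"
    proof
      fix x assume x: "x \<in> V"
      have "x - (e \<bullet> x) *\<^sub>R e \<in> ?W"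
        using x e less.prems(1) ee by (auto simp: inner_diff_right intro: subspace_diff subspace_scale)
      then have "x - (e \<bullet> x) *\<^sub>R e \<in> span (insert e E)" using E(5) span_mono[of E "insert e E"] by blast
      then show "x \<in> span (insert e E)"
        by (metis diff_add_cancel insertI1 span_add span_base span_scale)
    qed
    moreover have "pairwise orthogonal (insert e E)"
      using E(2,3) by (auto simp: pairwise_insert orthogonal_def inner_commute)
    ultimately show ?thesis
      using E e \<open>e \<notin> E\<close> by (intro exI[of _ "insert e E"] exI[of _ "\<nu>(e := \<mu>)"]) auto
  qed
qed

lemma selfadjoint_eigenbasis_UNIV:
  fixes f :: "'a::euclidean_space \<Rightarrow> 'a"
  assumes f: "linear f" and sym: "\<And>x y. f x \<bullet> y = x \<bullet> f y"
  obtains E \<mu> where "finite E" "\<And>e e'. e \<in> E \<Longrightarrow> e' \<in> E \<Longrightarrow> e \<bullet> e' = (if e = e' then 1 else 0)"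
    "\<And>e. e \<in> E \<Longrightarrow> f e = \<mu> e *\<^sub>R e" "\<And>x. (\<Sum>e\<in>E. (e \<bullet> x) *\<^sub>R e) = x"
proof -
  obtain E \<mu> where E: "finite E" "pairwise orthogonal E" "\<forall>e\<in>E. norm e = 1 \<and> f e = \<mu> e *\<^sub>R e" "UNIV \<subseteq> span E"
    using selfadjoint_eigenbasis[OF f sym, of UNIV] by auto
  have on: "e \<bullet> e' = (if e = e' then 1 else 0)" if "e \<in> E" "e' \<in> E" for e e'
    using E that by (auto simp: pairwise_def orthogonal_def dot_square_norm)
  have "(\<Sum>e\<in>E. (e \<bullet> x) *\<^sub>R e) = x" for x
  proof -
    obtain u where u: "x = (\<Sum>e\<in>E. u e *\<^sub>R e)" using span_finite[OF E(1)] E(4) by auto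
    have "e \<bullet> x = u e" if "e \<in> E" for e
    proof -
      have "e \<bullet> x = (\<Sum>e'\<in>E. u e' * (if e = e' then 1 else 0))"
        using on[OF that] by (simp add: u inner_sum_right)
      then show ?thesis using that E(1) by (simp add: if_distrib cong: if_cong)
    qed
    then show ?thesis using u by simp
  qed
  then show thesis using that[OF E(1) on _] E(3) by blast
qed

lemma symmetric_matrix_inner: "transpose A = A \<Longrightarrow> (A *v x) \<bullet> y = x \<bullet> (A *v y)"
  for A :: "real^'n^'n"
  by (metis dot_lmul_matrix transpose_matrix_vector)

lemma symmetric_matrixI:
  fixes B :: "real^'n^'n"
  assumes "\<And>x y. (transpose B *v x) \<bullet> y = (B *v x) \<bullet> y"
  shows "transpose B = B"
proof -
  have "transpose B *v x = B *v x" for x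
    using assms[of x] vector_eq_rdot[of "transpose B *v x" "B *v x"] by blast
  then show ?thesis by (subst matrix_eq) blast
qed

text \<open>Existence follows by diagonalisation. As to uniqueness, let \<open>C\<close> be a root of \<open>A\<close> and \<open>A e = s\<^sup>2 e\<close>
  with \<open>s > 0\<close>. Then \<open>w = C e - s e\<close> satisfies \<open>C w = - s w\<close>, hence \<open>w = 0\<close> since \<open>C\<close> is positive
  semidefinite.\<close>

lemma positive_definite_sqrt:
  fixes A :: "real^'n^'n"
  assumes sym: "transpose A = A" and pos: "\<And>x. x \<noteq> 0 \<Longrightarrow> 0 < x \<bullet> (A *v x)"
  shows "\<exists>!B. transpose B = B \<and> (\<forall>x. 0 \<le> x \<bullet> (B *v x)) \<and> B ** B = A"
proof -
  obtain E \<mu> where E: "finite E" "\<And>e e'. e \<in> E \<Longrightarrow> e' \<in> E \<Longrightarrow> e \<bullet> e' = (if e = e' then 1 else 0)"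
    "\<And>e. e \<in> E \<Longrightarrow> A *v e = \<mu> e *\<^sub>R e" "\<And>x. (\<Sum>e\<in>E. (e \<bullet> x) *\<^sub>R e) = x"
  proof -
    have "\<exists>E \<mu>. finite E \<and> (\<forall>e\<in>E. \<forall>e'\<in>E. e \<bullet> e' = (if e = e' then 1 else 0)) \<and>
        (\<forall>e\<in>E. A *v e = \<mu> e *\<^sub>R e) \<and> (\<forall>x. (\<Sum>e\<in>E. (e \<bullet> x) *\<^sub>R e) = x)"
      by (rule selfadjoint_eigenbasis_UNIV[OF matrix_vector_mul_linear[of A] symmetric_matrix_inner[OF sym]]) blast
    then show thesis
    proof (elim exE conjE)
      fix E \<mu> assume "finite E" "\<forall>e\<in>E. \<forall>e'\<in>E. e \<bullet> e' = (if e = e' then 1 else 0)"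
        "\<forall>e\<in>E. A *v e = \<mu> e *\<^sub>R e" "\<forall>x. (\<Sum>e\<in>E. (e \<bullet> x) *\<^sub>R e) = x"
      then show thesis using that[of E \<mu>] by simp
    qed
  qed
  have \<mu>: "0 < \<mu> e" if "e \<in> E" for e
  proof -
    have "e \<bullet> e = 1" "A *v e = \<mu> e *\<^sub>R e" using E(2)[OF that that] E(3)[OF that] by auto
    then show ?thesis using pos[of e] by (cases "e = 0") auto
  qed
  have ext: "C = D" if CD: "\<And>e. e \<in> E \<Longrightarrow> C *v e = D *v e" for C D :: "real^'n^'n"
  proof -
    have rep: "C *v x = (\<Sum>e\<in>E. (e \<bullet> x) *\<^sub>R (C *v e))" for C :: "real^'n^'n" and x
    proof -
      have "C *v x = C *v (\<Sum>e\<in>E. (e \<bullet> x) *\<^sub>R e)" using E(4)[of x] by simp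
      then show ?thesis by (simp add: linear_sum[OF matrix_vector_mul_linear] matrix_vector_mult_scaleR)
    qed
    have "C *v x = D *v x" for x
      unfolding rep[of C x] rep[of D x] using CD by simp
    then show ?thesis by (simp add: matrix_eq)
  qed
  have sq: "(sqrt (\<mu> e))\<^sup>2 = \<mu> e" "0 < sqrt (\<mu> e)" if "e \<in> E" for e using \<mu>[OF that] by auto
  define b where "b x = (\<Sum>e\<in>E. (sqrt (\<mu> e) * (e \<bullet> x)) *\<^sub>R e)" for x
  have "linear b" unfolding b_def
    by (intro linearI) (auto simp: inner_add_right algebra_simps sum.distrib scaleR_sum_right)
  then have B: "matrix b *v x = b x" for x by (simp add: matrix_works)
  have be: "b e = sqrt (\<mu> e) *\<^sub>R e" if "e \<in> E" for e
  proof -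
    have "b e = (\<Sum>e'\<in>E. if e' = e then sqrt (\<mu> e) *\<^sub>R e else 0)"
      unfolding b_def by (intro sum.cong) (use E(2) that in auto)
    then show ?thesis using that E(1) by simp
  qed
  have bsym: "b x \<bullet> y = (\<Sum>e\<in>E. sqrt (\<mu> e) * (e \<bullet> x) * (e \<bullet> y))" for x y
    by (simp add: b_def inner_sum_left)
  show ?thesis
  proof (intro ex1I[of _ "matrix b"] conjI allI)
    have "(transpose (matrix b) *v x) \<bullet> y = (matrix b *v x) \<bullet> y" for x y
      unfolding transpose_matrix_vector dot_lmul_matrix B inner_commute[of x "b y"] bsym
      by (intro sum.cong) auto
    then show "transpose (matrix b) = matrix b" by (rule symmetric_matrixI)
    show "0 \<le> x \<bullet> (matrix b *v x)" for x
      unfolding B inner_commute[of x "b x"] bsym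
      by (intro sum_nonneg) (use sq(2) in \<open>auto simp: mult.assoc less_imp_le intro!: mult_nonneg_nonneg\<close>)
    have "(matrix b ** matrix b) *v e = A *v e" if "e \<in> E" for e
    proof -
      have "(matrix b ** matrix b) *v e = b (b e)" by (simp add: matrix_vector_mul_assoc[symmetric] B)
      also have "\<dots> = (sqrt (\<mu> e))\<^sup>2 *\<^sub>R e"
        using linear_scale[OF \<open>linear b\<close>] be[OF that] by (simp add: power2_eq_square)
      finally show ?thesis using E(3)[OF that] sq(1)[OF that] by simp
    qed
    then show "matrix b ** matrix b = A" by (rule ext)
  next
    fix C :: "real^'n^'n" assume C: "transpose C = C \<and> (\<forall>x. 0 \<le> x \<bullet> (C *v x)) \<and> C ** C = A"
    have "C *v e = matrix b *v e" if e: "e \<in> E" for e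
    proof -
      define s w where "s = sqrt (\<mu> e)" and "w = C *v e - s *\<^sub>R e"
      have "C *v w = A *v e - s *\<^sub>R (C *v e)"
        using C by (auto simp: w_def matrix_vector_mult_diff_distrib matrix_vector_mult_scaleR matrix_vector_mul_assoc)
      also have "A *v e = s\<^sup>2 *\<^sub>R e" using E(3)[OF e] sq(1)[OF e] by (simp add: s_def)
      finally have "C *v w = - (s *\<^sub>R w)" by (simp add: w_def algebra_simps power2_eq_square)
      moreover have "0 \<le> w \<bullet> (C *v w)" using C by blast
      ultimately have "s * (w \<bullet> w) \<le> 0" by simp
      then have "w \<bullet> w \<le> 0" using sq(2)[OF e] by (simp add: s_def mult_le_0_iff)
      then have "w = 0" using inner_ge_zero[of w] inner_eq_zero_iff[of w] by linarith
      then show ?thesis using be[OF e] B by (simp add: w_def s_def)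
    qed
    then show "C = matrix b" by (rule ext)
  qed
qed

lemma inv_sqrt_injective:
  fixes A :: "real^'n^'n"
  assumes sym: "transpose A = A" and pos: "\<And>x. x \<noteq> 0 \<Longrightarrow> 0 < x \<bullet> (A *v x)"
    and x: "inv_sqrt A *v x = 0"
  shows "x = 0"
proof -
  have "inj ((*v) A)"
  proof (subst linear_injective_0[OF matrix_vector_mul_linear], intro allI impI)
    fix v assume "A *v v = 0"
    then show "v = 0" using pos[of v] by (cases "v = 0") auto
  qed
  then have "invertible A"
    using matrix_left_invertible_injective invertible_left_inverse by blast
  then have inv: "A ** matrix_inv A = mat 1" "matrix_inv A ** A = mat 1"
    using someI_ex[of "\<lambda>A'. A ** A' = mat 1 \<and> A' ** A = mat 1"] unfolding invertible_def matrix_inv_def by auto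
  have AM: "A *v (matrix_inv A *v y) = y" for y
    using inv by (simp add: matrix_vector_mul_assoc)
  have "(transpose (matrix_inv A) *v y) \<bullet> z = (matrix_inv A *v y) \<bullet> z" for y z
  proof -
    have "(transpose (matrix_inv A) *v y) \<bullet> z = y \<bullet> (matrix_inv A *v z)"
      unfolding transpose_matrix_vector dot_lmul_matrix ..
    also have "\<dots> = (A *v (matrix_inv A *v y)) \<bullet> (matrix_inv A *v z)" by (simp add: AM)
    also have "\<dots> = (matrix_inv A *v y) \<bullet> z"
      using symmetric_matrix_inner[OF sym, of "matrix_inv A *v y" "matrix_inv A *v z"] by (simp only: AM)
    finally show ?thesis .
  qed
  then have "transpose (matrix_inv A) = matrix_inv A" by (rule symmetric_matrixI)
  moreover have "0 < y \<bullet> (matrix_inv A *v y)" if "y \<noteq> 0" for y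
  proof -
    have "matrix_inv A *v y \<noteq> 0" using AM[of y] that by auto
    from pos[OF this] show ?thesis by (simp add: AM inner_commute)
  qed
  ultimately have "\<exists>!B. transpose B = B \<and> (\<forall>x. 0 \<le> x \<bullet> (B *v x)) \<and> B ** B = matrix_inv A"
    by (rule positive_definite_sqrt)
  from theI'[OF this] have "inv_sqrt A ** inv_sqrt A = matrix_inv A"
    unfolding inv_sqrt_def by blast
  then have "matrix_inv A *v x = inv_sqrt A *v (inv_sqrt A *v x)" by (simp add: matrix_vector_mul_assoc)
  then show ?thesis using x AM[of x] by simp
qed


section \<open>Smooth functions of compact support\<close>

text \<open>The functions \<open>t\<^sup>-\<^sup>k exp (-1/t)\<close>, extended by zero, and polynomials in the coordinates generate an
  algebra that is closed under differentiation.\<close>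

definition flat :: "nat \<Rightarrow> real \<Rightarrow> real" where
  "flat k t = (if 0 < t then inverse t ^ k / exp (inverse t) else 0)"

lemma DERIV_flat: "(flat k has_real_derivative (flat (k + 2) t - real k * flat (k + 1) t)) (at t)"
proof -
  consider "0 < t" | "t < 0" | "t = 0" by linarith
  then show ?thesis
  proof cases
    case 1
    have "((\<lambda>t. inverse t ^ k / exp (inverse t)) has_real_derivative (flat (k + 2) t - real k * flat (k + 1) t)) (at t)"
      using 1 by (auto intro!: derivative_eq_intros simp: flat_def field_simps power2_eq_square)
        (cases k; simp add: field_simps)
    then show ?thesis
    proof (rule has_field_derivative_transform_within_open)
      show "t \<in> {0<..}" using 1 by simp
    qed (auto simp: flat_def)
  next
    case 2
    have "((\<lambda>_. 0) has_real_derivative 0) (at t)" by simp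
    then have "(flat k has_real_derivative 0) (at t)"
    proof (rule has_field_derivative_transform_within_open)
      show "t \<in> {..<0}" using 2 by simp
    qed (auto simp: flat_def)
    then show ?thesis using 2 by (simp add: flat_def)
  next
    case 3
    have "((\<lambda>x. x ^ Suc k / exp x) \<longlongrightarrow> (0::real)) at_top" by (rule tendsto_power_div_exp_0)
    from filterlim_compose[OF this filterlim_inverse_at_top_right]
    have "((\<lambda>h. inverse h ^ Suc k / exp (inverse h)) \<longlongrightarrow> (0::real)) (at_right 0)" .
    then have r: "((\<lambda>h. flat k h / h) \<longlongrightarrow> 0) (at_right 0)"
      by (rule Lim_transform_eventually)
        (auto simp: flat_def eventually_at_filter divide_simps)
    have l: "((\<lambda>h. flat k h / h) \<longlongrightarrow> 0) (at_left 0)"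
      by (rule Lim_transform_eventually[OF tendsto_const])
        (auto simp: flat_def eventually_at_filter)
    have "((\<lambda>h. flat k h / h) \<longlongrightarrow> 0) (at 0)" using l r by (rule filterlim_split_at)
    then show ?thesis using 3 by (simp add: DERIV_def flat_def)
  qed
qed

inductive_set bump_algebra :: "real^'n \<Rightarrow> real \<Rightarrow> (real^'n \<Rightarrow> real) set"
  for c :: "real^'n" and r :: real where
    const: "(\<lambda>_. a) \<in> bump_algebra c r"
  | coord: "(\<lambda>x. x $ i) \<in> bump_algebra c r"
  | flat: "(\<lambda>x. flat k (r - (x - c) \<bullet> (x - c))) \<in> bump_algebra c r"
  | add: "f \<in> bump_algebra c r \<Longrightarrow> g \<in> bump_algebra c r \<Longrightarrow> (\<lambda>x. f x + g x) \<in> bump_algebra c r"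
  | mult: "f \<in> bump_algebra c r \<Longrightarrow> g \<in> bump_algebra c r \<Longrightarrow> (\<lambda>x. f x * g x) \<in> bump_algebra c r"

lemma bump_algebra_derivative:
  fixes f :: "real^'n \<Rightarrow> real"
  assumes "f \<in> bump_algebra c r"
  shows "\<exists>D. (\<forall>i. D i \<in> bump_algebra c r) \<and> (\<forall>x. (f has_derivative (\<lambda>h. \<Sum>i\<in>UNIV. D i x * h $ i)) (at x))"
  using assms
proof induction
  case (const a)
  show ?case by (intro exI[of _ "\<lambda>i x. 0"]) (auto intro: bump_algebra.const)
next
  case (coord j)
  have "((\<lambda>x. x $ j) has_derivative (\<lambda>h. \<Sum>i\<in>UNIV. (if i = j then 1 else 0) * h $ i)) (at x)" for x :: "real^'n"
  proof -
    have "(\<Sum>i\<in>UNIV. (if i = j then 1 else 0) * h $ i) = h $ j" for h :: "real^'n"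
    proof -
      have "(\<Sum>i\<in>UNIV. (if i = j then 1 else 0) * h $ i) = (\<Sum>i\<in>UNIV. if i = j then h $ i else 0)"
        by (intro sum.cong) auto
      then show ?thesis by simp
    qed
    then show ?thesis using bounded_linear_imp_has_derivative[OF bounded_linear_vec_nth] by simp
  qed
  then show ?case
    by (intro exI[of _ "\<lambda>i x. if i = j then 1 else 0"]) (auto intro: bump_algebra.const)
next
  case (flat k)
  define q where "q x = r - (x - c) \<bullet> (x - c)" for x
  define G where "G x = flat (k + 2) (q x) - real k * flat (k + 1) (q x)" for x
  have der: "((\<lambda>x. flat k (q x)) has_derivative (\<lambda>h. \<Sum>i\<in>UNIV. (G x * (-2 * (x $ i + - (c $ i)))) * h $ i)) (at x)" for x
  proof -
    have q: "(q has_derivative (\<lambda>h. - 2 * ((x - c) \<bullet> h))) (at x)"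
      unfolding q_def by (auto intro!: derivative_eq_intros simp: inner_commute)
    have "(flat k has_derivative (\<lambda>t. G x * t)) (at (q x))"
      using DERIV_flat[of k "q x"] unfolding G_def has_field_derivative_def by simp
    from diff_chain_at[OF q this]
    have "((\<lambda>x. flat k (q x)) has_derivative (\<lambda>h. G x * (- 2 * ((x - c) \<bullet> h)))) (at x)" by (simp add: o_def)
    moreover have "G x * (- 2 * ((x - c) \<bullet> h)) = (\<Sum>i\<in>UNIV. (G x * (-2 * (x $ i + - (c $ i)))) * h $ i)" for h
      by (simp add: inner_vec_def sum_distrib_left sum_distrib_right algebra_simps)
    ultimately show ?thesis by simp
  qed
  have "(\<lambda>x. G x * (-2 * (x $ i + - (c $ i)))) \<in> bump_algebra c r" for i
  proof -
    have "(\<lambda>x. flat (k + 2) (r - (x - c) \<bullet> (x - c)) + (- real k) * flat (k + 1) (r - (x - c) \<bullet> (x - c))) \<in> bump_algebra c r"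
      by (intro bump_algebra.intros)
    then have "G \<in> bump_algebra c r" by (simp add: G_def[abs_def] q_def)
    then show ?thesis by (intro bump_algebra.intros)
  qed
  then show ?case using der unfolding q_def by (intro exI[of _ "\<lambda>i x. G x * (-2 * (x $ i + - (c $ i)))"]) auto
next
  case (add f g)
  then obtain D E where D: "\<forall>i. D i \<in> bump_algebra c r" "\<forall>x. (f has_derivative (\<lambda>h. \<Sum>i\<in>UNIV. D i x * h $ i)) (at x)"
    and E: "\<forall>i. E i \<in> bump_algebra c r" "\<forall>x. (g has_derivative (\<lambda>h. \<Sum>i\<in>UNIV. E i x * h $ i)) (at x)" by blast
  have "((\<lambda>x. f x + g x) has_derivative (\<lambda>h. \<Sum>i\<in>UNIV. (D i x + E i x) * h $ i)) (at x)" for x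
    using has_derivative_add[OF D(2)[rule_format, of x] E(2)[rule_format, of x]]
    by (simp add: sum.distrib distrib_right)
  then show ?case using D(1) E(1)
    by (intro exI[of _ "\<lambda>i x. D i x + E i x"]) (auto intro: bump_algebra.add)
next
  case (mult f g)
  then obtain D E where D: "\<forall>i. D i \<in> bump_algebra c r" "\<forall>x. (f has_derivative (\<lambda>h. \<Sum>i\<in>UNIV. D i x * h $ i)) (at x)"
    and E: "\<forall>i. E i \<in> bump_algebra c r" "\<forall>x. (g has_derivative (\<lambda>h. \<Sum>i\<in>UNIV. E i x * h $ i)) (at x)" by blast
  have "((\<lambda>x. f x * g x) has_derivative (\<lambda>h. \<Sum>i\<in>UNIV. (f x * E i x + D i x * g x) * h $ i)) (at x)" for x
    using has_derivative_mult[OF D(2)[rule_format, of x] E(2)[rule_format, of x]]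
    by (rule has_derivative_eq_rhs) (auto simp: fun_eq_iff sum.distrib sum_distrib_left sum_distrib_right algebra_simps)
  then show ?case using D(1) E(1) mult.hyps
    by (intro exI[of _ "\<lambda>i x. f x * E i x + D i x * g x"]) (auto intro!: bump_algebra.add bump_algebra.mult)
qed

lemma grad_eqI:
  fixes f :: "real^'n \<Rightarrow> real"
  assumes "(f has_derivative f') (at x)"
  shows "grad f x $ i = f' (axis i 1)" and "grad f x \<bullet> h = f' h"
proof -
  have *: "frechet_derivative f (at x) = f'" using frechet_derivative_at[OF assms] by simp
  then show "grad f x $ i = f' (axis i 1)" by (simp add: grad_def)
  have "f' h = f' (\<Sum>i\<in>UNIV. h $ i *\<^sub>R axis i 1)"
    using basis_expansion[of h] by (simp add: scalar_mult_eq_scaleR)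
  also have "\<dots> = (\<Sum>i\<in>UNIV. h $ i *\<^sub>R f' (axis i 1))"
    using has_derivative_linear[OF assms] by (simp add: linear_sum linear_scale)
  also have "\<dots> = grad f x \<bullet> h" by (simp add: grad_def * inner_vec_def mult.commute)
  finally show "grad f x \<bullet> h = f' h" ..
qed

lemma bump_algebra_smooth:
  assumes "f \<in> bump_algebra c r"
  shows "smooth f"
proof -
  have "times_cont_diff k f" for k
    using assms
  proof (induction k arbitrary: f)
    case 0
    have "f differentiable at x" for x
      using bump_algebra_derivative[OF 0] by (auto simp: differentiable_def)
    then show ?case
      by (simp add: continuous_at_imp_continuous_on differentiable_imp_continuous_within)
  next
    case (Suc k)
    obtain D where D: "\<forall>i. D i \<in> bump_algebra c r" "\<forall>x. (f has_derivative (\<lambda>h. \<Sum>i\<in>UNIV. D i x * h $ i)) (at x)"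
      using bump_algebra_derivative[OF Suc.prems] by blast
    have "(\<lambda>x. grad f x $ i) = D i" for i
    proof
      fix x
      show "grad f x $ i = D i x"
        using grad_eqI(1)[OF D(2)[rule_format, of x], of i]
        by (simp add: axis_def if_distrib cong: if_cong)
    qed
    then show ?case using D Suc.IH by (auto simp: differentiable_def)
  qed
  then show ?thesis by (simp add: smooth_def)
qed

lemma smooth_bump:
  fixes c :: "real^'n"
  assumes "0 < r"
  obtains \<phi> where "smooth \<phi>" "\<And>x. x \<in> ball c r \<Longrightarrow> 0 < \<phi> x" "\<And>x. x \<notin> ball c r \<Longrightarrow> \<phi> x = 0"
proof
  let ?\<phi> = "\<lambda>x. flat 0 (r\<^sup>2 - (x - c) \<bullet> (x - c))"
  show "smooth ?\<phi>" by (intro bump_algebra_smooth[of _ c "r\<^sup>2"] bump_algebra.flat)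
  have *: "0 < r\<^sup>2 - (x - c) \<bullet> (x - c) \<longleftrightarrow> x \<in> ball c r" for x
  proof -
    have "norm (x - c) < r \<longleftrightarrow> (norm (x - c))\<^sup>2 < r\<^sup>2"
      using assms by (metis less_imp_le norm_ge_zero power2_less_imp_less power_strict_mono zero_less_numeral)
    then show ?thesis by (simp add: dot_square_norm dist_norm norm_minus_commute)
  qed
  show "0 < ?\<phi> x" if "x \<in> ball c r" for x
    using that unfolding *[symmetric] by (simp add: flat_def)
  show "?\<phi> x = 0" if "x \<notin> ball c r" for x
    using that unfolding *[symmetric] by (simp add: flat_def)
qed

lemma smooth_grad:
  assumes "smooth \<phi>"
  shows "(\<phi> has_derivative (\<lambda>h. grad \<phi> x \<bullet> h)) (at x)" "continuous_on UNIV (grad \<phi>)"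
proof -
  have 1: "times_cont_diff 1 \<phi>" using assms by (simp add: smooth_def)
  then have "\<phi> differentiable at x" for x by simp
  then obtain f' where f': "(\<phi> has_derivative f') (at x)" by (auto simp: differentiable_def)
  moreover have "f' = (\<lambda>h. grad \<phi> x \<bullet> h)" using grad_eqI(2)[OF f'] by auto
  ultimately show "(\<phi> has_derivative (\<lambda>h. grad \<phi> x \<bullet> h)) (at x)" by simp
  have "continuous_on UNIV (\<lambda>x. \<chi> i. grad \<phi> x $ i)" using 1 by (intro continuous_on_vec_lambda) simp
  then show "continuous_on UNIV (grad \<phi>)" by simp
qed


section \<open>Topology of the mesh\<close>

locale mesh =
  fixes \<Omega> :: "(real^'n) set" and \<T> :: "(real^'n) set set"
  assumes dim2: "2 \<le> CARD('n)"
    and open_dom: "open \<Omega>" and connected_dom: "connected \<Omega>" and nonempty_dom: "\<Omega> \<noteq> {}"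
    and bounded_dom: "bounded \<Omega>" and lipschitz: "lipschitz_boundary \<Omega>"
    and conf: "conforming_triangulation \<Omega> \<T>"
begin

lemma finite_mesh: "finite \<T>" and Union_mesh: "\<Union>\<T> = closure \<Omega>"
  and simplex: "T \<in> \<T> \<Longrightarrow> full_simplex T"
  and Int_face: "T \<in> \<T> \<Longrightarrow> T' \<in> \<T> \<Longrightarrow> (T \<inter> T') face_of T"
  using conf unfolding conforming_triangulation_def triangulation_def by auto

lemma Int_face_hull:
  assumes "T \<in> \<T>" "T' \<in> \<T>"
  obtains c where "c \<subseteq> verts T" "T \<inter> T' = convex hull c" "verts (T \<inter> T') = c"
proof -
  have T: "full_simplex T" using simplex assms by blast
  have "(T \<inter> T') face_of (convex hull verts T)"
    using Int_face[OF assms] full_simplex_verts(4)[OF T] by simp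
  then obtain c where c: "c \<subseteq> verts T" "T \<inter> T' = convex hull c"
    using face_of_convex_hull_affine_independent[OF full_simplex_verts(3)[OF T]] by auto
  have "\<not> affine_dependent c"
    using affine_dependent_subset[OF _ c(1)] full_simplex_verts(3)[OF T] by blast
  then have "verts (T \<inter> T') = c"
    using extreme_point_of_convex_hull_affine_independent c(2) by (auto simp: verts_def)
  then show thesis using that[OF c] by blast
qed

text \<open>The common face is a face of both elements. If it had all vertices of \<open>T\<close>, it would have as many
  vertices as \<open>T'\<close>, and the two elements would coincide.\<close>

lemma verts_Int_psubset:
  assumes "T \<in> \<T>" "T' \<in> \<T>" "T \<noteq> T'"
  shows "verts (T \<inter> T') \<subset> verts T"
proof -
  obtain c where c: "c \<subseteq> verts T" "T \<inter> T' = convex hull c" "verts (T \<inter> T') = c"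
    using Int_face_hull[OF assms(1,2)] .
  obtain c' where c': "c' \<subseteq> verts T'" "T' \<inter> T = convex hull c'" "verts (T' \<inter> T) = c'"
    using Int_face_hull[OF assms(2,1)] .
  have "c = c'" using c(3) c'(3) Int_commute[of T T'] by metis
  show ?thesis
  proof (rule ccontr)
    assume "\<not> ?thesis"
    then have eq: "c = verts T" using c by auto
    have "card (verts T') \<le> card c'"
      using full_simplex_verts(2)[OF simplex[OF assms(1)]] full_simplex_verts(2)[OF simplex[OF assms(2)]]
        \<open>c = c'\<close> eq by simp
    then have "c' = verts T'"
      using card_seteq[OF full_simplex_verts(1)[OF simplex[OF assms(2)]] c'(1)] by blast
    then have "T \<inter> T' = T" "T' \<inter> T = T'"
      using eq c(2) c'(2) full_simplex_verts(4)[OF simplex] assms by auto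
    then show False using assms(3) by auto
  qed
qed

lemma Int_subset_zero:
  assumes "T \<in> \<T>" "T' \<in> \<T>" "T \<noteq> T'"
  obtains p where "p \<in> verts T" "\<And>x. x \<in> T \<inter> T' \<Longrightarrow> lam T p x = 0"
proof -
  obtain c where c: "c \<subseteq> verts T" "T \<inter> T' = convex hull c" "verts (T \<inter> T') = c"
    using Int_face_hull[OF assms(1,2)] .
  obtain p where p: "p \<in> verts T" "p \<notin> c" using verts_Int_psubset[OF assms] c(3) by auto
  have "lam T p x = 0" if "x \<in> T \<inter> T'" for x
    using that p hull_subset_verts[OF simplex[OF assms(1)] c(1)] unfolding c(2) by auto
  then show thesis using that p(1) by blast
qed

text \<open>The common face contains a point at which only the barycentric coordinate of \<open>p\<close> vanishes, hence all
  vertices except \<open>p\<close>. Counting vertices shows that it is a facet of \<open>T'\<close> as well.\<close>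

lemma ofac_shared:
  assumes T: "T \<in> \<T>" "T' \<in> \<T>" "T \<noteq> T'" and p: "p \<in> verts T" and x: "x \<in> ofac T p" "x \<in> T'"
  obtains p' where "p' \<in> verts T'" "fac T' p' = fac T p" "T \<inter> T' = fac T p"
proof -
  note sT = simplex[OF T(1)] and sT' = simplex[OF T(2)]
  obtain c where c: "c \<subseteq> verts T" "T \<inter> T' = convex hull c" "verts (T \<inter> T') = c"
    using Int_face_hull[OF T(1,2)] .
  obtain c' where c': "c' \<subseteq> verts T'" "T' \<inter> T = convex hull c'" "verts (T' \<inter> T) = c'"
    using Int_face_hull[OF T(2,1)] .
  have cc: "c = c'" using c(3) c'(3) Int_commute[of T T'] by metis
  have "x \<in> T" using ofac_subset_fac[OF sT p] fac_eq[OF sT p] x by auto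
  then have xc: "x \<in> convex hull c" using x c(2) by auto
  have "q \<in> c" if "q \<in> verts T - {p}" for q
  proof (rule ccontr)
    assume "q \<notin> c"
    then have "lam T q x = 0" using that xc hull_subset_verts[OF sT c(1)] by auto
    moreover have "0 < lam T q x" using x(1) that unfolding ofac_def by blast
    ultimately show False by simp
  qed
  then have eq: "c = verts T - {p}" using verts_Int_psubset[OF T] c by auto
  have "card c = CARD('n)"
    using eq p full_simplex_verts(1,2)[OF sT] by simp
  then have "card (verts T' - c) = 1"
    using c'(1) full_simplex_verts(1,2)[OF sT'] unfolding cc
    by (subst card_Diff_subset) (auto intro: finite_subset)
  then obtain p' where p': "verts T' - c = {p'}" by (auto simp: card_1_singleton_iff)
  then have "c = verts T' - {p'}" "p' \<in> verts T'" using c'(1) cc by auto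
  then show thesis using that[of p'] eq c(2) by (simp add: fac_def)
qed

lemma locally_half:
  assumes T: "T \<in> \<T>" and p: "p \<in> verts T" and x: "x \<in> ofac T p"
  obtains e where "0 < e" "\<And>y. y \<in> ball x e \<Longrightarrow> (y \<in> T \<longleftrightarrow> 0 \<le> lam T p y)"
proof -
  note sT = simplex[OF T]
  let ?U = "\<Inter>q\<in>verts T - {p}. {y. 0 < lam T q y}"
  have "open ?U" using full_simplex_verts(1)[OF sT]
    by (intro open_INT ballI open_Collect_less continuous_intros) auto
  moreover have "x \<in> ?U" using x by (auto simp: ofac_def)
  ultimately obtain e where e: "0 < e" "ball x e \<subseteq> ?U" by (meson openE)
  have "y \<in> T \<longleftrightarrow> 0 \<le> lam T p y" if "y \<in> ball x e" for y
  proof -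
    have *: "0 < lam T q y" if "q \<in> verts T" "q \<noteq> p" for q
      using e(2) \<open>y \<in> ball x e\<close> that by blast
    have "(\<forall>q\<in>verts T. 0 \<le> lam T q y) \<longleftrightarrow> 0 \<le> lam T p y"
      using p * less_imp_le by metis
    then show ?thesis by (simp add: mem_simplex[OF sT])
  qed
  then show thesis using that e(1) by blast
qed

text \<open>Both barycentric coordinates vanish on the hyperplane of the facet, so they are proportional. A
  nonnegative factor would let the two elements overlap beyond the facet.\<close>

lemma shared_facet_opposite:
  assumes T: "T \<in> \<T>" "T' \<in> \<T>" "T \<noteq> T'" and p: "p \<in> verts T" "p' \<in> verts T'"
    and eq: "fac T' p' = fac T p" and x: "x \<in> ofac T p" "x \<in> ofac T' p'"
  obtains k where "0 < k" "\<And>y. lam T' p' y = - k * lam T p y"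
proof -
  note sT = simplex[OF T(1)] and sT' = simplex[OF T(2)]
  have v: "verts T - {p} = verts T' - {p'}" using verts_fac[OF sT, of p] verts_fac[OF sT', of p'] eq by simp
  have lam': "lam T' p' y = lam T' p' p * lam T p y" for y
  proof -
    have "lam T' p' y = (\<Sum>q\<in>verts T. lam T q y * lam T' p' q)"
      using affine_lam_repr[OF sT, of "bgrad T' p'" y] by (simp add: lam_def[of T'])
    also have "\<dots> = lam T p y * lam T' p' p"
    proof (subst sum.remove[OF full_simplex_verts(1)[OF sT] p(1)])
      have "lam T q y * lam T' p' q = 0" if "q \<in> verts T - {p}" for q
        using that v lam_vertex[OF sT', of q p'] by auto
      then have "(\<Sum>q\<in>verts T - {p}. lam T q y * lam T' p' q) = 0" by (rule sum.neutral[OF ballI])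
      then show "lam T p y * lam T' p' p + (\<Sum>q\<in>verts T - {p}. lam T q y * lam T' p' q) = lam T p y * lam T' p' p"
        by simp
    qed
    finally show ?thesis by simp
  qed
  define K where "K = lam T' p' p"
  have lamK: "lam T' p' y = K * lam T p y" for y using lam'[of y] unfolding K_def .
  have "K < 0"
  proof (rule ccontr)
    assume "\<not> K < 0"
    then have k0: "0 \<le> K" by simp
    obtain e where e: "0 < e" "\<And>y. y \<in> ball x e \<Longrightarrow> (y \<in> T \<longleftrightarrow> 0 \<le> lam T p y)"
      by (rule locally_half[OF T(1) p(1) x(1)]) (rule that)
    obtain e' where e': "0 < e'" "\<And>y. y \<in> ball x e' \<Longrightarrow> (y \<in> T' \<longleftrightarrow> 0 \<le> lam T' p' y)"
      by (rule locally_half[OF T(2) p(2) x(2)]) (rule that)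
    define m where "m = min e e' / (2 * norm (bgrad T p))"
    define y where "y = x + m *\<^sub>R bgrad T p"
    have g: "bgrad T p \<noteq> 0" using bgrad_nonzero[OF sT p(1)] .
    have "0 < m" using e e' g by (simp add: m_def)
    have "dist x y = m * norm (bgrad T p)" using \<open>0 < m\<close> by (simp add: y_def dist_norm)
    also have "\<dots> = min e e' / 2" using g by (simp add: m_def)
    finally have "y \<in> ball x e" "y \<in> ball x e'" using e e' by auto
    moreover have ly: "0 < lam T p y" using x(1) \<open>0 < m\<close> g by (simp add: y_def lam_add ofac_def)
    moreover have "0 \<le> lam T' p' y" unfolding lamK using k0 ly by simp
    ultimately have "y \<in> T \<inter> T'" using e e' by auto
    moreover have "T \<inter> T' = fac T p"
    proof (rule ofac_shared[OF T p(1) x(1)])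
      show "x \<in> T'" using ofac_subset_fac[OF sT' p(2)] x(2) fac_eq[OF sT' p(2)] by auto
    qed
    ultimately show False using ly fac_eq[OF sT p(1)] by auto
  qed
  then show thesis using that[of "- K"] lamK by simp
qed

lemma fac_ofac: 
  assumes "T \<in> \<T>" "T' \<in> \<T>" "p \<in> verts T" "p' \<in> verts T'" "fac T' p' = fac T p" "x \<in> ofac T p"
  shows "x \<in> ofac T' p'"
proof -
  note sT = simplex[OF assms(1)] and sT' = simplex[OF assms(2)]
  have v: "verts T - {p} = verts T' - {p'}" using verts_fac[OF sT, of p] verts_fac[OF sT', of p'] assms(5) by simp
  have xT': "x \<in> T'" "lam T' p' x = 0"
    using ofac_subset_fac[OF sT assms(3)] assms(5,6) fac_eq[OF sT' assms(4)] by auto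
  have "0 < lam T' q x" if q: "q \<in> verts T' - {p'}" for q
  proof -
    have "lam T' q x = (\<Sum>r\<in>verts T. lam T r x * lam T' q r)"
      using affine_lam_repr[OF sT, of "bgrad T' q" x] by (simp add: lam_def[of T'])
    also have "\<dots> = (\<Sum>r\<in>verts T - {p}. lam T r x * lam T' q r)"
      using sum.remove[OF full_simplex_verts(1)[OF sT] assms(3), of "\<lambda>r. lam T r x * lam T' q r"] assms(6)
      by (simp add: ofac_def)
    also have "\<dots> = (\<Sum>r\<in>verts T - {p}. if r = q then lam T r x else 0)"
      using v q lam_vertex[OF sT', of _ q] by (intro sum.cong) auto
    also have "\<dots> = lam T q x"
      unfolding v using full_simplex_verts(1)[OF sT'] q by (subst sum.delta) auto
    also have "\<dots> > 0" using assms(6) q v by (auto simp: ofac_def)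
    finally show ?thesis .
  qed
  then show ?thesis using xT' by (simp add: ofac_def)
qed

text \<open>The boundary is locally a Lipschitz graph, and the points just below a boundary point are
  exterior.\<close>

lemma interior_closure_dom: "interior (closure \<Omega>) = \<Omega>"
proof
  show "\<Omega> \<subseteq> interior (closure \<Omega>)" using open_dom by (simp add: interior_maximal closure_subset)
  show "interior (closure \<Omega>) \<subseteq> \<Omega>"
  proof
    fix x assume x: "x \<in> interior (closure \<Omega>)"
    show "x \<in> \<Omega>"
    proof (rule ccontr)
      assume "x \<notin> \<Omega>"
      then have xf: "x \<in> frontier \<Omega>"
        using x interior_subset open_dom by (auto simp: frontier_def interior_open)
      obtain U e \<gamma> L where U: "open U" "x \<in> U" "norm e = 1" "L-lipschitz_on {z. z \<bullet> e = 0} \<gamma>"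
        "\<Omega> \<inter> U = {y \<in> U. y \<bullet> e > \<gamma> (y - (y \<bullet> e) *\<^sub>R e)}"
        using lipschitz[unfolded lipschitz_boundary_def, rule_format, OF xf]
        by (elim exE conjE) (rule that)
      have ee: "e \<bullet> e = 1" using U(3) by (simp add: dot_square_norm)
      let ?h = "\<lambda>y. y \<bullet> e - \<gamma> (y - (y \<bullet> e) *\<^sub>R e)"
      have c\<gamma>: "continuous_on {z. z \<bullet> e = 0} \<gamma>" using U(4) lipschitz_on_continuous_on by blast
      have ch: "continuous_on UNIV ?h"
        by (intro continuous_intros continuous_on_compose2[OF c\<gamma>]) (auto simp: inner_diff_left ee)
      have mem: "y \<in> \<Omega> \<longleftrightarrow> 0 < ?h y" if "y \<in> U" for y
      proof -
        have "y \<in> \<Omega> \<longleftrightarrow> y \<in> \<Omega> \<inter> U" using that by blast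
        then show ?thesis unfolding U(5) using that by simp
      qed
      have hx: "?h x \<le> 0" using \<open>x \<notin> \<Omega>\<close> mem[OF U(2)] by linarith
      obtain r where r: "0 < r" "ball x r \<subseteq> U \<inter> interior (closure \<Omega>)"
        using U(1,2) x by (meson IntI open_Int open_interior openE)
      define y where "y = x - (r / 2) *\<^sub>R e"
      have "y \<in> ball x r" using r U(3) by (simp add: y_def dist_norm)
      then have y: "y \<in> U" "y \<in> closure \<Omega>" using r interior_subset[of "closure \<Omega>"] by blast+
      have "?h y = ?h x - r / 2"
      proof -
        have "y \<bullet> e = x \<bullet> e - r / 2" by (simp add: y_def inner_diff_left ee)
        moreover from this have "y - (y \<bullet> e) *\<^sub>R e = x - (x \<bullet> e) *\<^sub>R e"
          by (simp add: y_def algebra_simps)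
        ultimately show ?thesis by simp
      qed
      then have "?h y < 0" using hx r by simp
      let ?V = "U \<inter> {y. ?h y < 0}"
      have "open ?V" using U(1) ch by (intro open_Int open_Collect_less) auto
      moreover have "y \<in> ?V" using y \<open>?h y < 0\<close> by simp
      ultimately have "?V \<inter> \<Omega> \<noteq> {}" using open_Int_closure_eq_empty[of ?V \<Omega>] y(2) by blast
      then obtain z where "z \<in> ?V" "z \<in> \<Omega>" by blast
      then show False using mem[of z] by simp
    qed
  qed
qed

lemma frontier_dom: "frontier \<Omega> = closure \<Omega> - \<Omega>"
  using open_dom by (simp add: frontier_def interior_open)

lemma mesh_subset: "T \<in> \<T> \<Longrightarrow> T \<subseteq> closure \<Omega>"
  using Union_mesh by auto

lemma interior_element: "T \<in> \<T> \<Longrightarrow> interior T \<subseteq> \<Omega>"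
  using interior_mono[OF mesh_subset] interior_closure_dom by auto

text \<open>By the opposite signs of the barycentric coordinates the two elements fill a neighbourhood of
  the point.\<close>

lemma ofac_two_elements:
  assumes T: "T \<in> \<T>" "T' \<in> \<T>" "T \<noteq> T'" and p: "p \<in> verts T" and x: "x \<in> ofac T p" "x \<in> T'"
  shows "x \<in> \<Omega>"
proof -
  obtain p' where p': "p' \<in> verts T'" "fac T' p' = fac T p" by (rule ofac_shared[OF T p x]) (rule that)
  have x': "x \<in> ofac T' p'" using fac_ofac[OF T(1,2) p p'(1,2) x(1)] .
  obtain k where k: "0 < k" "\<And>y. lam T' p' y = - k * lam T p y"
    by (rule shared_facet_opposite[OF T p p' x(1) x']) (rule that)
  obtain e where e: "0 < e" "\<And>y. y \<in> ball x e \<Longrightarrow> (y \<in> T \<longleftrightarrow> 0 \<le> lam T p y)"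
    by (rule locally_half[OF T(1) p x(1)]) (rule that)
  obtain e' where e': "0 < e'" "\<And>y. y \<in> ball x e' \<Longrightarrow> (y \<in> T' \<longleftrightarrow> 0 \<le> lam T' p' y)"
    by (rule locally_half[OF T(2) p'(1) x']) (rule that)
  have "ball x (min e e') \<subseteq> T \<union> T'"
  proof
    fix y assume "y \<in> ball x (min e e')"
    then have y: "y \<in> ball x e" "y \<in> ball x e'" by auto
    show "y \<in> T \<union> T'"
      using e(2)[OF y(1)] e'(2)[OF y(2)] k by (cases "0 \<le> lam T p y") (auto simp: mult_le_0_iff)
  qed
  also have "T \<union> T' \<subseteq> closure \<Omega>" using T mesh_subset by auto
  finally have "x \<in> interior (closure \<Omega>)" using e(1) e'(1)
    by (meson centre_in_ball interior_maximal min_less_iff_conj open_ball subset_iff)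
  then show ?thesis using interior_closure_dom by simp
qed

text \<open>Near such a point the closure of the domain coincides with \<open>T\<close>, hence with a closed half space, and
  the domain is the interior of its closure.\<close>

lemma ofac_one_element:
  assumes T: "T \<in> \<T>" and p: "p \<in> verts T" and x: "x \<in> ofac T p"
    and only: "\<And>T'. T' \<in> \<T> \<Longrightarrow> x \<in> T' \<Longrightarrow> T' = T"
  obtains e where "0 < e" "\<Omega> \<inter> ball x e = {y \<in> ball x e. 0 < lam T p y}"
proof -
  note sT = simplex[OF T]
  obtain e where e: "0 < e" "\<And>y. y \<in> ball x e \<Longrightarrow> (y \<in> T \<longleftrightarrow> 0 \<le> lam T p y)"
    by (rule locally_half[OF T p x]) (rule that)
  have "open (- \<Union>(\<T> - {T}))" using finite_mesh compact_full_simplex simplex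
    by (intro open_Compl closed_Union) (auto intro: compact_imp_closed)
  moreover have "x \<in> - \<Union>(\<T> - {T})" using only by auto
  ultimately obtain e' where e': "0 < e'" "ball x e' \<subseteq> - \<Union>(\<T> - {T})" by (meson openE)
  define r where "r = min e e'"
  have r: "0 < r" using e e' by (simp add: r_def)
  have cl: "y \<in> closure \<Omega> \<longleftrightarrow> 0 \<le> lam T p y" if "y \<in> ball x r" for y
  proof -
    have "y \<in> closure \<Omega> \<longleftrightarrow> y \<in> T"
      using that e'(2) T unfolding Union_mesh[symmetric] r_def by fastforce
    moreover have "y \<in> T \<longleftrightarrow> 0 \<le> lam T p y"
      using that e(2) by (auto simp: r_def)
    ultimately show ?thesis by blast
  qed
  have "\<Omega> \<inter> ball x r = {y \<in> ball x r. 0 < lam T p y}"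
  proof (intro equalityI subsetI)
    fix y assume y: "y \<in> {y \<in> ball x r. 0 < lam T p y}"
    have "ball x r \<inter> {y. 0 < lam T p y} \<subseteq> closure \<Omega>" using cl less_imp_le by blast
    moreover have "open (ball x r \<inter> {y. 0 < lam T p y})"
      by (intro open_Int open_Collect_less continuous_intros) auto
    ultimately have "ball x r \<inter> {y. 0 < lam T p y} \<subseteq> interior (closure \<Omega>)" by (rule interior_maximal)
    then show "y \<in> \<Omega> \<inter> ball x r" using y interior_closure_dom by blast
  next
    fix y assume y: "y \<in> \<Omega> \<inter> ball x r"
    then obtain s where s: "0 < s" "ball y s \<subseteq> \<Omega> \<inter> ball x r" using open_dom by (meson open_Int open_ball openE)
    define g where "g = bgrad T p"
    have g: "g \<noteq> 0" using bgrad_nonzero[OF sT p] by (simp add: g_def)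
    define z where "z = y - (s / (2 * norm g)) *\<^sub>R g"
    have "z \<in> ball y s" using s g by (simp add: z_def dist_norm)
    then have "z \<in> closure \<Omega> \<inter> ball x r" using s closure_subset by blast
    then have "0 \<le> lam T p z" using cl by blast
    also have "lam T p z = lam T p y - (s / (2 * norm g)) * (g \<bullet> g)"
      by (simp add: z_def lam_def g_def inner_diff_right)
    finally have "(s / (2 * norm g)) * (g \<bullet> g) \<le> lam T p y" by simp
    moreover have "0 < (s / (2 * norm g)) * (g \<bullet> g)" using s g by simp
    ultimately show "y \<in> {y \<in> ball x r. 0 < lam T p y}" using y by simp
  qed
  then show thesis using that r by blast
qed

end


context mesh
begin

text \<open>A set of codimension two that contains all intersections of distinct facets of an element.
  Generic segments avoid it, so it neither disconnects the domain nor hides its boundary.\<close>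

definition skel :: "(real^'n) set" where
  "skel = {x. \<exists>T\<in>\<T>. \<exists>p\<in>verts T. \<exists>q\<in>verts T. p \<noteq> q \<and> lam T p x = 0 \<and> lam T q x = 0}"

lemma negligible_lam_zero: "T \<in> \<T> \<Longrightarrow> p \<in> verts T \<Longrightarrow> negligible {x. lam T p x = 0}"
proof -
  assume T: "T \<in> \<T>" "p \<in> verts T"
  have "negligible {x. bgrad T p \<bullet> x = - snd (bcoeff T p)}"
    using bgrad_nonzero[OF simplex] T by (intro negligible_hyperplane) auto
  then show ?thesis by (simp add: lam_def eq_neg_iff_add_eq_0)
qed

lemma negligible_skel: "negligible skel"
proof -
  have "skel \<subseteq> (\<Union>T\<in>\<T>. \<Union>p\<in>verts T. {x. lam T p x = 0})" by (auto simp: skel_def)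
  moreover have "negligible (\<Union>T\<in>\<T>. \<Union>p\<in>verts T. {x. lam T p x = 0})"
    using finite_mesh full_simplex_verts(1)[OF simplex] negligible_lam_zero
    by (intro negligible_Union) (auto intro!: negligible_Union)
  ultimately show ?thesis by (rule negligible_subset[rotated])
qed

lemma open_avoids_negligible:
  fixes W :: "(real^'n) set"
  assumes "open W" "W \<noteq> {}" "negligible N"
  shows "\<exists>b\<in>W. b \<notin> N"
  using assms open_not_negligible negligible_subset[of N W] by blast

text \<open>The cone with apex \<open>a\<close> over a set of codimension two is contained in a hyperplane.\<close>

lemma generic_segment:
  assumes a: "a \<notin> skel" and W: "open W" "W \<noteq> {}"
  obtains b where "b \<in> W" "closed_segment a b \<inter> skel = {}"
proof -
  \<comment> \<open>Up to a constant factor, \<open>h T p q\<close> is the affine function that vanishes at \<open>a\<close> and on the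
    intersection of the two facet hyperplanes. So it suffices that it does not vanish at \<open>b\<close>.\<close>
  define h where "h T p q x = lam T q a * lam T p x - lam T p a * lam T q x" for T p q x
  define I where "I = {(T, p, q). T \<in> \<T> \<and> p \<in> verts T \<and> q \<in> verts T \<and> p \<noteq> q}"
  have "I \<subseteq> (SIGMA T:\<T>. verts T \<times> verts T)" by (auto simp: I_def)
  then have finI: "finite I"
    by (rule finite_subset) (use finite_mesh full_simplex_verts(1)[OF simplex] in auto)
  have "negligible {x. h T p q x = 0}" if "(T, p, q) \<in> I" for T p q
  proof -
    let ?G = "lam T q a *\<^sub>R bgrad T p + (- lam T p a) *\<^sub>R bgrad T q"
    let ?c = "lam T q a * snd (bcoeff T p) - lam T p a * snd (bcoeff T q)"
    have I: "T \<in> \<T>" "p \<in> verts T" "q \<in> verts T" "p \<noteq> q" using that by (auto simp: I_def)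
    have "?G \<noteq> 0"
    proof
      assume "?G = 0"
      from bgrad_independent[OF simplex[OF I(1)] dim2 I(2-4) this] a I show False
        unfolding skel_def by auto
    qed
    then have "negligible {x. ?G \<bullet> x = - ?c}" by (intro negligible_hyperplane) auto
    moreover have "h T p q x = ?G \<bullet> x + ?c" for x
      by (simp add: h_def lam_def[of T _ x] inner_add_left inner_diff_left algebra_simps)
    then have "h T p q x = 0 \<longleftrightarrow> ?G \<bullet> x = - ?c" for x by (simp only: eq_neg_iff_add_eq_0)
    ultimately show ?thesis by (simp only:)
  qed
  then have "negligible (\<Union>(T, p, q)\<in>I. {x. h T p q x = 0})"
    using finI by (intro negligible_Union) auto
  then obtain b where b: "b \<in> W" "\<And>T p q. (T, p, q) \<in> I \<Longrightarrow> h T p q b \<noteq> 0"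
    using open_avoids_negligible[OF W] by blast
  have "x \<notin> skel" if x: "x \<in> closed_segment a b" for x
  proof
    assume "x \<in> skel"
    then obtain T p q where I: "T \<in> \<T>" "p \<in> verts T" "q \<in> verts T" "p \<noteq> q" and 0: "lam T p x = 0" "lam T q x = 0"
      by (auto simp: skel_def)
    obtain t where t: "x = (1 - t) *\<^sub>R a + t *\<^sub>R b" using x by (auto simp: closed_segment_def)
    have "h T p q x = t * h T p q b"
      unfolding t h_def lam_segment by (simp add: algebra_simps)
    then have "t * h T p q b = 0" using 0 by (simp add: h_def)
    then have "t = 0" using b(2)[of T p q] I by (simp add: I_def)
    then show False using \<open>x \<in> skel\<close> a t by simp
  qed
  then show thesis using that b(1) by blast
qed

lemma in_ofac:
  assumes "T \<in> \<T>" "x \<in> T" "x \<notin> interior T" "x \<notin> skel"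
  obtains p where "p \<in> verts T" "x \<in> ofac T p"
proof -
  obtain p where p: "p \<in> verts T" "lam T p x \<le> 0"
    using assms(3) unfolding interior_simplex[OF simplex[OF assms(1)]] by (auto simp: not_less)
  have nn: "0 \<le> lam T q x" if "q \<in> verts T" for q
    using assms(2) that mem_simplex[OF simplex[OF assms(1)]] by blast
  have p0: "lam T p x = 0" using p nn[OF p(1)] by simp
  have "0 < lam T q x" if "q \<in> verts T - {p}" for q
  proof -
    have "lam T q x \<noteq> 0" using assms(1,4) p p0 that unfolding skel_def by blast
    then show ?thesis using nn[of q] that by simp
  qed
  then show thesis using that[OF p(1)] p0 by (simp add: ofac_def)
qed

lemma ofac_frontier_unique:
  assumes "T \<in> \<T>" "p \<in> verts T" "x \<in> ofac T p" "x \<in> frontier \<Omega>" "T' \<in> \<T>" "x \<in> T'"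
  shows "T' = T"
  using ofac_two_elements[OF assms(1,5) _ assms(2,3,6)] assms(4) frontier_dom by auto

lemma elem_at_interior:
  assumes "T \<in> \<T>" "x \<in> interior T"
  shows "elem_at \<T> x = T"
  unfolding elem_at_def
proof (rule the_equality)
  show "T \<in> \<T> \<and> x \<in> T" using assms interior_subset by blast
next
  fix T' assume T': "T' \<in> \<T> \<and> x \<in> T'"
  show "T' = T"
  proof (rule ccontr)
    assume "T' \<noteq> T"
    then obtain p where "p \<in> verts T" "\<And>x. x \<in> T \<inter> T' \<Longrightarrow> lam T p x = 0"
      using Int_subset_zero[OF assms(1), of T'] T' by blast
    moreover have "x \<in> T" using assms(2) interior_subset by blast
    moreover have "0 < lam T p x" using assms(2) \<open>p \<in> verts T\<close> by (simp add: interior_simplex[OF simplex[OF assms(1)]])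
    ultimately show False using T' by force
  qed
qed

lemma ofac_subset: "T \<in> \<T> \<Longrightarrow> p \<in> verts T \<Longrightarrow> ofac T p \<subseteq> T"
  using ofac_subset_fac[OF simplex] fac_eq[OF simplex] by blast

lemma elem_at_ofac:
  assumes "T \<in> \<T>" "p \<in> verts T" "x \<in> ofac T p" "x \<in> frontier \<Omega>"
  shows "elem_at \<T> x = T"
  unfolding elem_at_def
proof (rule the_equality)
  show "T \<in> \<T> \<and> x \<in> T" using assms ofac_subset by blast
qed (use ofac_frontier_unique[OF assms] in blast)

text \<open>The boundary facets, each named by its element and the opposite vertex.\<close>

definition bfacs :: "((real^'n) set \<times> (real^'n)) set" where
  "bfacs = {(T, p). T \<in> \<T> \<and> p \<in> verts T \<and> fac T p \<subseteq> frontier \<Omega>}"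

lemma finite_bfacs: "finite bfacs"
proof -
  have "bfacs \<subseteq> (SIGMA T:\<T>. verts T)" by (auto simp: bfacs_def)
  then show ?thesis by (rule finite_subset) (use finite_mesh full_simplex_verts(1)[OF simplex] in auto)
qed

lemma ofac_segment:
  assumes T: "T \<in> \<T>" "p \<in> verts T" and "y \<in> fac T p" "x \<in> ofac T p" "0 < t" "t \<le> 1"
  shows "(1 - t) *\<^sub>R y + t *\<^sub>R x \<in> ofac T p"
  using assms unfolding ofac_def fac_eq[OF simplex[OF T(1)] T(2)] mem_simplex[OF simplex[OF T(1)]]
  by (auto simp: lam_segment intro!: add_nonneg_pos)

text \<open>Suppose that the facet contains a point of the domain. Then the domain contains a point \<open>z\<close> in the
  relative interior of the facet. If \<open>z\<close> lies in a second element, then this element contains the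
  whole facet, and the given point is interior. If not, then the domain near \<open>z\<close> is an open half
  space with \<open>z\<close> on its boundary.\<close>

lemma ofac_frontier_facet:
  assumes T: "T \<in> \<T>" "p \<in> verts T" and x: "x \<in> ofac T p" "x \<in> frontier \<Omega>"
  shows "(T, p) \<in> bfacs"
proof -
  have "y \<in> frontier \<Omega>" if y: "y \<in> fac T p" for y
  proof (rule ccontr)
    assume "y \<notin> frontier \<Omega>"
    moreover have "y \<in> closure \<Omega>"
      using y fac_eq[OF simplex[OF T(1)] T(2)] mesh_subset[OF T(1)] by auto
    ultimately have "y \<in> \<Omega>" using frontier_dom by auto
    then obtain e where e: "0 < e" "ball y e \<subseteq> \<Omega>" using open_dom by (meson openE)
    define t where "t = min 1 (e / (2 * (norm (x - y) + 1)))"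
    have t: "0 < t" "t \<le> 1" using e by (auto simp: t_def add_nonneg_pos)
    define z where "z = (1 - t) *\<^sub>R y + t *\<^sub>R x"
    have z: "z \<in> ofac T p" unfolding z_def by (rule ofac_segment[OF T y x(1) t])
    have "z - y = t *\<^sub>R (x - y)" by (simp add: z_def algebra_simps)
    then have "dist y z = t * norm (x - y)" using t by (metis abs_of_pos dist_norm norm_minus_commute norm_scaleR)
    also have "\<dots> \<le> e / (2 * (norm (x - y) + 1)) * (norm (x - y) + 1)"
      using e by (intro mult_mono) (auto simp: t_def)
    also have "\<dots> = e / 2"
    proof -
      have "e / (2 * N) * N = e / 2" if "N \<noteq> 0" for N :: real using that by simp
      moreover have "norm (x - y) + 1 \<noteq> 0" using norm_ge_zero[of "x - y"] by linarith
      ultimately show ?thesis by blast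
    qed
    also have "\<dots> < e" using e by simp
    finally have "z \<in> \<Omega>" using e(2) by auto
    show False
    proof (cases "\<exists>T'\<in>\<T>. z \<in> T' \<and> T' \<noteq> T")
      case True
      then obtain T' where T': "T' \<in> \<T>" "z \<in> T'" "T \<noteq> T'" by auto
      have "T \<inter> T' = fac T p" by (rule ofac_shared[OF T(1) T'(1,3) T(2) z T'(2)])
      then have "x \<in> T'" using ofac_subset_fac[OF simplex[OF T(1)] T(2)] x(1) by blast
      then show False using ofac_frontier_unique[OF T x T'(1)] T'(3) by blast
    next
      case False
      obtain r where "0 < r" "\<Omega> \<inter> ball z r = {y \<in> ball z r. 0 < lam T p y}"
        by (rule ofac_one_element[OF T z]) (use False in blast, rule that)
      then have "0 < lam T p z" using \<open>z \<in> \<Omega>\<close> by (metis (no_types, lifting) IntI centre_in_ball mem_Collect_eq)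
      then show False using z by (simp add: ofac_def)
    qed
  qed
  then show ?thesis using T by (auto simp: bfacs_def)
qed

lemma frontier_ofac:
  assumes x: "x \<in> frontier \<Omega>" "x \<notin> skel"
  obtains T p where "(T, p) \<in> bfacs" "x \<in> ofac T p"
proof -
  have "x \<in> \<Union>\<T>" using x frontier_dom Union_mesh by auto
  then obtain T where T: "T \<in> \<T>" "x \<in> T" by auto
  have "x \<notin> interior T" using interior_element[OF T(1)] x frontier_dom by auto
  then obtain p where "p \<in> verts T" "x \<in> ofac T p" using in_ofac[OF T _ x(2)] by blast
  then show thesis using that ofac_frontier_facet[OF T(1)] x(1) by blast
qed

text \<open>A generic segment from a point of the domain to an exterior point crosses the boundary outside the
  skeleton.\<close>

lemma frontier_generic:
  assumes x: "x \<in> frontier \<Omega>" and e: "0 < e"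
  obtains y where "y \<in> ball x e" "y \<in> frontier \<Omega>" "y \<notin> skel"
proof -
  have "x \<in> closure \<Omega>" "x \<notin> \<Omega>" using x frontier_dom by auto
  have "ball x e \<inter> \<Omega> \<noteq> {}"
    using open_Int_closure_eq_empty[of "ball x e" \<Omega>] \<open>x \<in> closure \<Omega>\<close> centre_in_ball[of x e] e by blast
  then obtain a where a: "a \<in> ball x e \<inter> \<Omega>" "a \<notin> skel"
    using open_avoids_negligible[of "ball x e \<inter> \<Omega>"] open_dom negligible_skel by blast
  let ?W = "ball x e - closure \<Omega>"
  have "?W \<noteq> {}"
  proof
    assume "?W = {}"
    then have "ball x e \<subseteq> interior (closure \<Omega>)" by (intro interior_maximal) auto
    then show False using interior_closure_dom \<open>x \<notin> \<Omega>\<close> centre_in_ball[of x e] e by blast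
  qed
  moreover have "open ?W" by auto
  ultimately obtain b where b: "b \<in> ?W" "closed_segment a b \<inter> skel = {}"
    using generic_segment[OF a(2)] by blast
  have "closed_segment a b \<inter> frontier \<Omega> \<noteq> {}"
  proof (rule connected_Int_frontier)
    show "closed_segment a b \<inter> \<Omega> \<noteq> {}" using a(1) by auto
    show "closed_segment a b - \<Omega> \<noteq> {}" using b(1) closure_subset by auto
  qed auto
  then obtain y where y: "y \<in> closed_segment a b" "y \<in> frontier \<Omega>" by auto
  moreover have "closed_segment a b \<subseteq> ball x e"
    using a b by (intro closed_segment_subset) auto
  ultimately show thesis using that b(2) by blast
qed

lemma relatively_open_meets_ofac:
  assumes "openin (top_of_set (frontier \<Omega>)) \<Gamma>" "\<Gamma> \<noteq> {}"
  obtains T p x where "(T, p) \<in> bfacs" "x \<in> ofac T p" "x \<in> \<Gamma>"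
proof -
  obtain x where x: "x \<in> \<Gamma>" using assms by auto
  then have "x \<in> frontier \<Omega>" using assms(1) openin_subset by fastforce
  obtain e where e: "0 < e" "ball x e \<inter> frontier \<Omega> \<subseteq> \<Gamma>"
    using assms(1) x unfolding openin_contains_ball by blast
  obtain y where y: "y \<in> ball x e" "y \<in> frontier \<Omega>" "y \<notin> skel"
    by (rule frontier_generic[OF \<open>x \<in> frontier \<Omega>\<close> e(1)])
  obtain T p where "(T, p) \<in> bfacs" "y \<in> ofac T p" by (rule frontier_ofac[OF y(2,3)])
  moreover have "y \<in> \<Gamma>" using e(2) y by blast
  ultimately show thesis by (rule that)
qed

definition adjacent :: "((real^'n) set \<times> (real^'n) set) set" where
  "adjacent = {(T, T'). T \<in> \<T> \<and> T' \<in> \<T> \<and> T \<noteq> T' \<and> (\<exists>p\<in>verts T. \<exists>p'\<in>verts T'. fac T p = fac T' p')}"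

text \<open>Otherwise the elements that can be reached from \<open>T0\<close> and the remaining ones would meet at a point of
  the connected domain. Near this point a generic segment leads from an element of the first kind to
  one of the second kind, and it changes the kind at a point in the relative interior of a facet that
  the two elements share.\<close>

lemma mesh_facet_connected:
  assumes "T0 \<in> \<T>" "T1 \<in> \<T>"
  shows "(T0, T1) \<in> adjacent\<^sup>*"
proof (rule ccontr)
  assume no: "(T0, T1) \<notin> adjacent\<^sup>*"
  define A where "A = {T\<in>\<T>. (T0, T) \<in> adjacent\<^sup>*}"
  define B where "B = \<T> - A"
  have T0: "T0 \<in> A" and T1: "T1 \<in> B" and AB: "A \<union> B = \<T>" using assms no by (auto simp: A_def B_def)
  have cl: "closed (\<Union>A)" "closed (\<Union>B)"
    using finite_mesh compact_full_simplex simplex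
    by (auto simp: A_def B_def intro!: closed_Union intro: compact_imp_closed)
  have cov: "closure \<Omega> \<subseteq> \<Union>A \<union> \<Union>B" using Union_mesh AB by blast
  have meets: "\<Omega> \<inter> T \<noteq> {}" if "T \<in> \<T>" for T
    using interior_element[OF that] interior_subset interior_full_simplex_nonempty[OF simplex[OF that]] by blast
  have "\<Union>A \<inter> \<Union>B \<inter> \<Omega> \<noteq> {}"
  proof
    assume "\<Union>A \<inter> \<Union>B \<inter> \<Omega> = {}"
    moreover have "\<Union>A \<inter> \<Omega> \<noteq> {}" "\<Union>B \<inter> \<Omega> \<noteq> {}" using meets T0 T1 AB by blast+
    moreover have "\<Omega> \<subseteq> \<Union>A \<union> \<Union>B" using cov closure_subset by blast
    ultimately show False using connected_dom cl unfolding connected_closed by blast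
  qed
  then obtain z TA TB where z: "z \<in> \<Omega>" "TA \<in> A" "z \<in> TA" "TB \<in> B" "z \<in> TB" by blast
  obtain r where r: "0 < r" "ball z r \<subseteq> \<Omega>" using open_dom z(1) by (meson openE)
  have ne: "ball z r \<inter> interior T \<noteq> {}" if "T \<in> \<T>" "z \<in> T" for T
  proof -
    have "closure (interior T) = closure T"
      using convex_closure_interior[OF convex_full_simplex] interior_full_simplex_nonempty simplex that by blast
    then have "z \<in> closure (interior T)" using that closure_subset by blast
    then show ?thesis
      using open_Int_closure_eq_empty[of "ball z r" "interior T"] centre_in_ball[of z r] r(1) by blast
  qed
  have TT: "TA \<in> \<T>" "TB \<in> \<T>" using z AB by auto
  obtain a where a: "a \<in> ball z r \<inter> interior TA" "a \<notin> skel"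
    using open_avoids_negligible[of "ball z r \<inter> interior TA"] ne[OF TT(1) z(3)] negligible_skel by blast
  obtain b where b: "b \<in> ball z r \<inter> interior TB" "closed_segment a b \<inter> skel = {}"
    using generic_segment[OF a(2), of "ball z r \<inter> interior TB"] ne[OF TT(2) z(5)] by blast
  have seg: "closed_segment a b \<subseteq> ball z r" using a b by (intro closed_segment_subset) auto
  have "\<Union>A \<inter> \<Union>B \<inter> closed_segment a b \<noteq> {}"
  proof
    assume "\<Union>A \<inter> \<Union>B \<inter> closed_segment a b = {}"
    moreover have "a \<in> \<Union>A \<inter> closed_segment a b" "b \<in> \<Union>B \<inter> closed_segment a b"
      using a b z interior_subset by auto
    moreover have "closed_segment a b \<subseteq> \<Union>A \<union> \<Union>B" using seg r(2) cov closure_subset by blast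
    ultimately show False using connected_segment[of a b] cl unfolding connected_closed by blast
  qed
  then obtain y T T' where y: "y \<in> closed_segment a b" "T \<in> A" "y \<in> T" "T' \<in> B" "y \<in> T'" by blast
  have T: "T \<in> \<T>" "T' \<in> \<T>" "T \<noteq> T'" using y AB by (auto simp: B_def)
  obtain q where q: "q \<in> verts T" "\<And>x. x \<in> T \<inter> T' \<Longrightarrow> lam T q x = 0" using Int_subset_zero[OF T] by blast
  have "y \<notin> interior T" using q(2)[of y] q(1) y unfolding interior_simplex[OF simplex[OF T(1)]] by force
  then obtain p where p: "p \<in> verts T" "y \<in> ofac T p" using in_ofac[OF T(1) y(3)] b(2) y(1) by blast
  obtain p' where "p' \<in> verts T'" "fac T' p' = fac T p" by (rule ofac_shared[OF T p y(5)]) (rule that)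
  then have "(T, T') \<in> adjacent" using T p(1) by (auto simp: adjacent_def)
  then have "T' \<in> A" using y(2) T(2) by (auto simp: A_def)
  then show False using y(4) by (simp add: B_def)
qed

end


section \<open>Surface measure of facets\<close>

text \<open>The surface measure is defined by volumes of right prisms of height one. Oblique prisms relate it to
  the volumes of simplices.\<close>

definition prism :: "(real^'n) set \<Rightarrow> real^'n \<Rightarrow> real \<Rightarrow> (real^'n) set" where
  "prism S u e = {s + t *\<^sub>R u | s t. s \<in> S \<and> t \<in> {0..e}}"

lemma prism_image: "prism S u e = (\<lambda>(s, t). s + t *\<^sub>R u) ` (S \<times> {0..e})"
  by (force simp: prism_def image_iff)

lemma prismI: "s \<in> S \<Longrightarrow> 0 \<le> t \<Longrightarrow> t \<le> e \<Longrightarrow> s + t *\<^sub>R u \<in> prism S u e"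
  unfolding prism_def mem_Collect_eq by (intro exI[of _ s] exI[of _ t]) auto

lemma compact_prism:
  assumes "compact S"
  shows "compact (prism S u e)"
  unfolding prism_image
  by (rule compact_continuous_image)
    (auto intro!: compact_Times assms continuous_intros simp: case_prod_unfold)

lemma measure_lebesgue_compact:
  fixes X :: "'a::euclidean_space set"
  assumes "compact X"
  shows "measure lborel X = measure lebesgue X" "emeasure lborel X = ennreal (measure lebesgue X)"
    "X \<in> lmeasurable"
proof -
  show 1: "measure lborel X = measure lebesgue X" using assms by (simp add: borel_compact)
  show "emeasure lborel X = ennreal (measure lebesgue X)"
    unfolding 1[symmetric] using emeasure_compact_finite[OF assms] by (simp add: emeasure_eq_ennreal_measure less_top)
  show "X \<in> lmeasurable" by (rule lmeasurable_compact[OF assms])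
qed

lemma measure_volume_factor_image:
  assumes "volume_factor f c" "compact X"
  shows "measure lebesgue (f ` X) = c * measure lebesgue X"
proof -
  have f: "linear f" "bij f" "0 < c" using assms(1) by (auto simp: volume_factor_def)
  have cf: "compact (f ` X)" using f(1) assms(2)
    by (intro compact_continuous_image linear_continuous_on) (auto simp: linear_conv_bounded_linear)
  have "f -` (f ` X) = X" using f(2) by (auto simp: bij_def inj_vimage_image_eq)
  then have "emeasure lborel (f ` X) = ennreal c * emeasure lborel X"
    using assms(1) borel_compact[OF cf] unfolding volume_factor_def by metis
  then have "ennreal (measure lebesgue (f ` X)) = ennreal (c * measure lebesgue X)"
    using measure_lebesgue_compact(2)[OF cf] measure_lebesgue_compact(2)[OF assms(2)] f(3)
    by (simp add: ennreal_mult')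
  then show ?thesis using f(3) by (simp add: mult_nonneg_nonneg)
qed

text \<open>A linear map that fixes the hyperplane of the base carries the right prism to the oblique one.\<close>

lemma measure_oblique_prism:
  fixes S :: "(real^'n) set"
  assumes S: "compact S" "S \<subseteq> {x. \<nu> \<bullet> x = c}" and \<nu>: "norm \<nu> = 1" and u: "0 < \<nu> \<bullet> u" and e: "0 < e"
  shows "measure lebesgue (prism S u e) = e * (\<nu> \<bullet> u) * measure lebesgue (prism S \<nu> 1)"
proof -
  have 1: "\<nu> \<bullet> \<nu> = 1" using \<nu> by (simp add: dot_square_norm)
  define w where "w = e *\<^sub>R u - \<nu>"
  define F where "F x = x + (\<nu> \<bullet> x) *\<^sub>R w" for x
  have f: "1 + \<nu> \<bullet> w = e * (\<nu> \<bullet> u)" by (simp add: w_def inner_diff_right 1)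
  have F: "volume_factor F (e * (\<nu> \<bullet> u))"
    using volume_factor_rank_one[of \<nu> w] u e unfolding f F_def[abs_def] by simp
  have eq: "F (s + t *\<^sub>R \<nu>) = c *\<^sub>R w + (s + (t * e) *\<^sub>R u)" if "s \<in> S" for s t
  proof -
    have "\<nu> \<bullet> (s + t *\<^sub>R \<nu>) = c + t" using that S(2) by (auto simp: inner_add_right 1)
    then have "F (s + t *\<^sub>R \<nu>) = s + t *\<^sub>R \<nu> + (c + t) *\<^sub>R w" by (simp add: F_def)
    then show ?thesis by (simp add: w_def algebra_simps)
  qed
  have "F ` prism S \<nu> 1 = (+) (c *\<^sub>R w) ` prism S u e"
  proof (intro equalityI subsetI)
    fix y assume "y \<in> F ` prism S \<nu> 1"
    then obtain s t where st: "s \<in> S" "0 \<le> t" "t \<le> 1" "y = F (s + t *\<^sub>R \<nu>)" by (auto simp: prism_def)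
    have "t * e \<in> {0..e}" using st e by (auto simp: mult_le_cancel_right1)
    then have "s + (t * e) *\<^sub>R u \<in> prism S u e" using st(1) by (auto simp: prism_def)
    then show "y \<in> (+) (c *\<^sub>R w) ` prism S u e" using st eq by simp
  next
    fix y assume "y \<in> (+) (c *\<^sub>R w) ` prism S u e"
    then obtain s t where st: "s \<in> S" "0 \<le> t" "t \<le> e" "y = c *\<^sub>R w + (s + t *\<^sub>R u)" by (auto simp: prism_def)
    have "s + (t / e) *\<^sub>R \<nu> \<in> prism S \<nu> 1" using st e by (intro prismI) auto
    moreover have "y = F (s + (t / e) *\<^sub>R \<nu>)" using eq[OF st(1), of "t / e"] st(4) e by simp
    ultimately show "y \<in> F ` prism S \<nu> 1" by blast
  qed
  then have "measure lebesgue (prism S u e) = measure lebesgue (F ` prism S \<nu> 1)"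
    by (simp add: measure_translation)
  then show ?thesis using measure_volume_factor_image[OF F compact_prism[OF S(1)]] by simp
qed

lemma measure_prism_uminus: "measure lebesgue (prism S (- \<nu>) 1) = measure lebesgue (prism S \<nu> 1)"
proof -
  have "prism S \<nu> 1 = (+) \<nu> ` prism S (- \<nu>) 1"
  proof (intro equalityI subsetI)
    fix y assume "y \<in> prism S \<nu> 1"
    then obtain s t where st: "s \<in> S" "0 \<le> t" "t \<le> 1" "y = s + t *\<^sub>R \<nu>" by (auto simp: prism_def)
    have "s + (1 - t) *\<^sub>R (- \<nu>) \<in> prism S (- \<nu>) 1" using st unfolding prism_def by force
    moreover have "y = \<nu> + (s + (1 - t) *\<^sub>R (- \<nu>))" using st by (simp add: algebra_simps)
    ultimately show "y \<in> (+) \<nu> ` prism S (- \<nu>) 1" by blast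
  next
    fix y assume "y \<in> (+) \<nu> ` prism S (- \<nu>) 1"
    then obtain s t where st: "s \<in> S" "0 \<le> t" "t \<le> 1" "y = \<nu> + (s + t *\<^sub>R (- \<nu>))" by (auto simp: prism_def)
    have "s + (1 - t) *\<^sub>R \<nu> \<in> prism S \<nu> 1" using st unfolding prism_def by force
    moreover have "y = s + (1 - t) *\<^sub>R \<nu>" using st by (simp add: algebra_simps)
    ultimately show "y \<in> prism S \<nu> 1" by simp
  qed
  then show ?thesis by (simp add: measure_translation)
qed

text \<open>The prism over a set of codimension two lies in a hyperplane.\<close>

lemma hyperplane_area_codim_two:
  fixes a b :: "real^'n"
  assumes ind: "\<And>\<mu> \<kappa>. \<mu> *\<^sub>R a + \<kappa> *\<^sub>R b = 0 \<Longrightarrow> \<mu> = 0 \<and> \<kappa> = 0"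
    and A: "A \<inter> H \<subseteq> {x. a \<bullet> x = s \<and> b \<bullet> x = t}"
  shows "hyperplane_area H A = 0"
proof -
  define \<nu> where "\<nu> = unit_normal H"
  let ?P = "{x + t *\<^sub>R \<nu> | x t. x \<in> A \<inter> H \<and> t \<in> {0..1}}"
  have "\<exists>G c. G \<noteq> 0 \<and> ?P \<subseteq> {y. G \<bullet> y = c}"
  proof (cases "b \<bullet> \<nu> = 0")
    case True
    have "b \<noteq> 0" using ind[of 0 1] by auto
    moreover have "?P \<subseteq> {y. b \<bullet> y = t}" using A True by (auto simp: inner_add_right)
    ultimately show ?thesis by blast
  next
    case False
    define G where "G = (b \<bullet> \<nu>) *\<^sub>R a + (- (a \<bullet> \<nu>)) *\<^sub>R b"
    have "G \<noteq> 0" using ind[of "b \<bullet> \<nu>" "- (a \<bullet> \<nu>)"] False unfolding G_def by blast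
    moreover have "G \<bullet> (x + r *\<^sub>R \<nu>) = (b \<bullet> \<nu>) * s - (a \<bullet> \<nu>) * t" if "x \<in> A \<inter> H" for x r
    proof -
      have "a \<bullet> x = s" "b \<bullet> x = t" using that A by auto
      then show ?thesis by (simp add: G_def inner_add_left inner_add_right inner_diff_left algebra_simps)
    qed
    ultimately show ?thesis by (intro exI[of _ G] exI[of _ "(b \<bullet> \<nu>) * s - (a \<bullet> \<nu>) * t"]) auto
  qed
  then obtain G c where G: "G \<noteq> 0" "?P \<subseteq> {y. G \<bullet> y = c}" by blast
  have "negligible {y. G \<bullet> y = c}" using G(1) by (intro negligible_hyperplane) auto
  then have "negligible ?P" using G(2) negligible_subset by blast
  then have "emeasure lebesgue ?P = 0" by (simp add: negligible_iff_null_sets null_setsD1)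
  then have "emeasure lborel ?P = 0" by (cases "?P \<in> sets lborel") (auto simp: emeasure_notin_sets)
  then show ?thesis by (simp add: hyperplane_area_def \<nu>_def)
qed

lemma surface_null_codim_two:
  fixes a b :: "real^'n"
  assumes "\<And>\<mu> \<kappa>. \<mu> *\<^sub>R a + \<kappa> *\<^sub>R b = 0 \<Longrightarrow> \<mu> = 0 \<and> \<kappa> = 0"
  shows "{x. a \<bullet> x = s \<and> b \<bullet> x = t} \<in> null_sets borel_surface_measure"
proof -
  have B: "{x. a \<bullet> x = s \<and> b \<bullet> x = t} \<in> sets borel" by measurable
  have "hyperplane_area H {x. a \<bullet> x = s \<and> b \<bullet> x = t} = 0" for H
    by (rule hyperplane_area_codim_two[where a = a and b = b and s = s and t = t, OF assms]) auto
  then show ?thesis using B by (auto intro!: null_setsI simp: emeasure_borel_surface_measure)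
qed

text \<open>Only the hyperplane that contains \<open>S\<close> contributes to the area of \<open>S\<close>.\<close>

lemma emeasure_surface_hyperplane:
  fixes S :: "(real^'n) set"
  assumes S: "compact S" "S \<subseteq> {x. \<nu> \<bullet> x = c}" and \<nu>: "norm \<nu> = 1"
  shows "emeasure borel_surface_measure S = ennreal (measure lebesgue (prism S \<nu> 1))"
proof -
  let ?H0 = "{x. \<nu> \<bullet> x = c}"
  have H0: "?H0 \<in> hyperplanes" using \<nu> by (auto simp: hyperplanes_def)
  obtain c0 where n0: "norm (unit_normal ?H0) = 1" "?H0 = {x. unit_normal ?H0 \<bullet> x = c0}"
    by (rule unit_normal[OF H0])
  have other: "hyperplane_area H S = 0" if H: "H \<in> hyperplanes" "H \<noteq> ?H0" for H
  proof -
    obtain c' where n: "norm (unit_normal H) = 1" "H = {x. unit_normal H \<bullet> x = c'}"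
      by (rule unit_normal[OF H(1)])
    define m where "m = unit_normal H"
    have Hm: "x \<in> H \<longleftrightarrow> m \<bullet> x = c'" for x using n(2) unfolding m_def by blast
    show ?thesis
    proof (cases "\<exists>\<mu> \<kappa>. \<mu> *\<^sub>R \<nu> + \<kappa> *\<^sub>R m = 0 \<and> \<not> (\<mu> = 0 \<and> \<kappa> = 0)")
      case False
      show ?thesis
        by (rule hyperplane_area_codim_two[of \<nu> m _ _ c c']) (use False S(2) Hm in auto)
    next
      case True
      then obtain \<mu> \<kappa> where mk: "\<mu> *\<^sub>R \<nu> + \<kappa> *\<^sub>R m = 0" "\<not> (\<mu> = 0 \<and> \<kappa> = 0)" by blast
      have "\<kappa> \<noteq> 0" "\<mu> \<noteq> 0" using mk \<nu> n(1) by (auto simp: m_def)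
      define r where "r = - \<mu> / \<kappa>"
      have "r \<noteq> 0" using \<open>\<kappa> \<noteq> 0\<close> \<open>\<mu> \<noteq> 0\<close> by (simp add: r_def)
      have "\<kappa> *\<^sub>R m = (\<kappa> * r) *\<^sub>R \<nu>" using mk(1) \<open>\<kappa> \<noteq> 0\<close> by (simp add: r_def eq_neg_iff_add_eq_0 add.commute)
      then have m: "m = r *\<^sub>R \<nu>" using \<open>\<kappa> \<noteq> 0\<close> by (metis scaleR_cancel_left scaleR_scaleR)
      have "S \<inter> H = {}"
      proof (rule ccontr)
        assume "S \<inter> H \<noteq> {}"
        then obtain x where x: "x \<in> S" "x \<in> H" by blast
        then have "\<nu> \<bullet> x = c" "m \<bullet> x = c'" using S(2) Hm by auto
        then have "c' = r * c" by (simp add: m)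
        then have "y \<in> H \<longleftrightarrow> y \<in> ?H0" for y using Hm[of y] \<open>r \<noteq> 0\<close> by (simp add: m)
        then show False using H(2) by blast
      qed
      then show ?thesis by (simp add: hyperplane_area_def)
    qed
  qed
  have "emeasure borel_surface_measure S = (\<integral>\<^sup>+ H. hyperplane_area H S \<partial>count_space hyperplanes)"
    using S(1) by (simp add: emeasure_borel_surface_measure borel_compact)
  also have "\<dots> = (\<integral>\<^sup>+ H. hyperplane_area ?H0 S * indicator {?H0} H \<partial>count_space hyperplanes)"
    by (intro nn_integral_cong) (auto simp: other split: split_indicator)
  also have "\<dots> = hyperplane_area ?H0 S" using H0 by (simp add: nn_integral_cmult_indicator)
  also have "\<dots> = emeasure lborel (prism S (unit_normal ?H0) 1)"
  proof -
    have "S \<inter> ?H0 = S" using S(2) by blast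
    then show ?thesis by (simp add: hyperplane_area_def prism_def)
  qed
  also have "\<dots> = ennreal (measure lebesgue (prism S (unit_normal ?H0) 1))"
    by (rule measure_lebesgue_compact(2)[OF compact_prism[OF S(1)]])
  also have "measure lebesgue (prism S (unit_normal ?H0) 1) = measure lebesgue (prism S \<nu> 1)"
  proof -
    define m where "m = unit_normal ?H0"
    have m: "norm m = 1" "\<And>x. \<nu> \<bullet> x = c \<longleftrightarrow> m \<bullet> x = c0" using n0 unfolding m_def by blast+
    have 1: "\<nu> \<bullet> \<nu> = 1" "m \<bullet> m = 1" using \<nu> m by (auto simp: dot_square_norm)
    define v where "v = m - (\<nu> \<bullet> m) *\<^sub>R \<nu>"
    have "\<nu> \<bullet> (c *\<^sub>R \<nu>) = c" "\<nu> \<bullet> (c *\<^sub>R \<nu> + v) = c" by (simp_all add: inner_add_right 1 v_def inner_diff_right)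
    then have "m \<bullet> (c *\<^sub>R \<nu>) = c0" "m \<bullet> (c *\<^sub>R \<nu> + v) = c0" using m(2) by blast+
    then have mv: "m \<bullet> v = 0" by (simp add: inner_add_right)
    have "v \<bullet> v = 0" using mv by (simp add: v_def inner_diff_left inner_diff_right 1 inner_commute)
    then have mr: "m = (\<nu> \<bullet> m) *\<^sub>R \<nu>" by (simp add: v_def)
    then have "norm m = \<bar>\<nu> \<bullet> m\<bar> * norm \<nu>" by (metis norm_scaleR)
    then have "\<nu> \<bullet> m = 1 \<or> \<nu> \<bullet> m = -1" using m(1) \<nu> by auto
    then have "m = \<nu> \<or> m = - \<nu>" using mr by (metis scaleR_minus1_left scaleR_one)
    then show ?thesis unfolding m_def[symmetric] using measure_prism_uminus by auto
  qed
  finally show ?thesis .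
qed

context
  fixes T :: "(real^'n) set" and p :: "real^'n"
  assumes T: "full_simplex T" and p: "p \<in> verts T"
begin

definition inner_normal :: "real^'n" where
  "inner_normal = bgrad T p /\<^sub>R norm (bgrad T p)"

lemma norm_inner_normal: "norm inner_normal = 1"
  using bgrad_nonzero[OF T p] by (simp add: inner_normal_def)

lemma fac_hyperplane: "fac T p \<subseteq> {x. inner_normal \<bullet> x = - snd (bcoeff T p) / norm (bgrad T p)}"
proof
  fix x assume "x \<in> fac T p"
  then have "bgrad T p \<bullet> x = - snd (bcoeff T p)" using fac_eq[OF T p] by (auto simp: lam_def)
  then show "x \<in> {x. inner_normal \<bullet> x = - snd (bcoeff T p) / norm (bgrad T p)}"
    by (simp add: inner_normal_def divide_inverse mult.commute)
qed

lemma emeasure_fac: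
  "emeasure borel_surface_measure (fac T p) = ennreal (measure lebesgue (prism (fac T p) inner_normal 1))"
  by (rule emeasure_surface_hyperplane[OF compact_fac[OF T] fac_hyperplane norm_inner_normal])

lemma area_fac: "area (fac T p) = measure lebesgue (prism (fac T p) inner_normal 1)"
  using emeasure_fac borel_compact[OF compact_fac[OF T]] by (simp add: measure_def)

text \<open>Let \<open>V\<close> be the volume of \<open>T\<close>, \<open>A\<close> the area of the facet and \<open>h\<close> the height. The part of \<open>T\<close>
  within the fraction \<open>e\<close> of the height from the facet has volume \<open>(1 - (1 - e)\<^sup>d) V\<close>. It lies in an
  oblique prism of volume \<open>e h A\<close> and contains the image of that prism under a homothety of ratio
  \<open>1 - e\<close>. Division by \<open>e\<close> and \<open>e \<rightarrow> 0\<close> give \<open>d V = h A\<close>.\<close>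

lemma volume_height_area: "CARD('n) * vol T * norm (bgrad T p) = area (fac T p)"
proof -
  define \<nu> where "\<nu> = inner_normal"
  define S where "S = fac T p"
  define g where "g = norm (bgrad T p)"
  define d where "d = CARD('n)"
  define V A where "V = vol T" and "A = area S"
  have g: "0 < g" using bgrad_nonzero[OF T p] by (simp add: g_def)
  obtain s0 where s0: "s0 \<in> verts T" "s0 \<noteq> p" using ex_other_vertex[OF T] by blast
  define u where "u = p - s0"
  have bu: "bgrad T q \<bullet> u = (if q = p then 1 else 0) - (if q = s0 then 1 else 0)" if "q \<in> verts T" for q
    using lam_diff[of T q p s0] p s0 that
    by (cases "q = p"; cases "q = s0") (auto simp: u_def lam_vertex[OF T])
  have \<nu>u: "\<nu> \<bullet> u = 1 / g" using bu[OF p] s0(2) by (simp add: \<nu>_def inner_normal_def g_def divide_inverse)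
  have cS: "compact S" using compact_fac[OF T] by (simp add: S_def)
  have Q: "measure lebesgue (prism S u e) = e * A / g" if "0 < e" for e
    using measure_oblique_prism[OF cS _ norm_inner_normal _ that, of _ u] fac_hyperplane area_fac \<nu>u g
    unfolding \<nu>_def S_def A_def by auto
  have hom: "measure lebesgue ((\<lambda>y. c + (1 - e) *\<^sub>R (y - c)) ` X) = (1 - e) ^ d * measure lebesgue X"
    if "e < 1" for c :: "real^'n" and e X
  proof -
    have eq: "(\<lambda>y. c + (1 - e) *\<^sub>R (y - c)) = (\<lambda>y. (1 - e) *\<^sub>R y + e *\<^sub>R c)" by (auto simp: algebra_simps)
    show ?thesis unfolding eq using that measure_lebesgue_affine[of "1 - e" "e *\<^sub>R c" X] by (simp add: d_def)
  qed
  have main: "(1 - e) ^ d * (e * A / g) + (1 - e) ^ d * V \<le> V \<and> V \<le> e * A / g + (1 - e) ^ d * V"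
    if e: "0 < e" "e < 1" for e
  proof -
    define T' where "T' = (\<lambda>y. p + (1 - e) *\<^sub>R (y - p)) ` T"
    define C where "C = (\<lambda>y. s0 + (1 - e) *\<^sub>R (y - s0)) ` prism S u e"
    have comb: "c + (1 - e) *\<^sub>R (y - c) = (1 - (1 - e)) *\<^sub>R c + (1 - e) *\<^sub>R y" for c y :: "real^'n"
      by (simp add: algebra_simps)
    have cT': "compact T'" unfolding T'_def
      by (intro compact_continuous_image continuous_intros compact_full_simplex[OF T])
    have cC: "compact C" unfolding C_def
      by (intro compact_continuous_image continuous_intros compact_prism[OF cS])
    have mT': "measure lebesgue T' = (1 - e) ^ d * V" unfolding T'_def V_def by (rule hom[OF e(2)])
    have mC: "measure lebesgue C = (1 - e) ^ d * (e * A / g)" unfolding C_def using hom[OF e(2)] Q[OF e(1)] by simp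
    have T'_sub: "T' \<subseteq> {x\<in>T. e \<le> lam T p x}"
    proof
      fix x assume "x \<in> T'"
      then obtain y where y: "y \<in> T" "x = (1 - (1 - e)) *\<^sub>R p + (1 - e) *\<^sub>R y" unfolding T'_def comb by blast
      have nn: "0 \<le> lam T q y" if "q \<in> verts T" for q using y(1) that mem_simplex[OF T] by blast
      have "lam T q x = e * (if p = q then 1 else 0) + (1 - e) * lam T q y" if "q \<in> verts T" for q
        unfolding y(2) lam_segment using lam_vertex[OF T p] by simp
      then show "x \<in> {x\<in>T. e \<le> lam T p x}" using nn e p by (auto simp: mem_simplex[OF T])
    qed
    have T'_sup: "{x\<in>T. e \<le> lam T p x} \<subseteq> T'"
    proof
      fix x assume x: "x \<in> {x\<in>T. e \<le> lam T p x}"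
      define y where "y = (1 - 1 / (1 - e)) *\<^sub>R p + (1 / (1 - e)) *\<^sub>R x"
      have xy: "x = p + (1 - e) *\<^sub>R (y - p)"
      proof -
        have "(1 - e) *\<^sub>R y = ((1 - e) - 1) *\<^sub>R p + x"
          using e by (simp add: y_def scaleR_add_right right_diff_distrib)
        then show ?thesis by (simp add: algebra_simps)
      qed
      have "0 \<le> lam T q y" if q: "q \<in> verts T" for q
      proof -
        have "lam T q x = e * (if p = q then 1 else 0) + (1 - e) * lam T q y"
          unfolding xy comb lam_segment using lam_vertex[OF T p] by simp
        moreover have "0 \<le> lam T q x" using x q mem_simplex[OF T] by blast
        ultimately have "0 \<le> (1 - e) * lam T q y" using x by (cases "q = p") auto
        then show ?thesis using e by (auto simp: zero_le_mult_iff)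
      qed
      then have "y \<in> T" by (simp add: mem_simplex[OF T])
      with xy have "\<exists>y\<in>T. x = p + (1 - e) *\<^sub>R (y - p)" by blast
      then show "x \<in> T'" by (auto simp: T'_def)
    qed
    have cov: "T \<subseteq> prism S u e \<union> T'"
    proof
      fix x assume x: "x \<in> T"
      have nn: "0 \<le> lam T q x" if "q \<in> verts T" for q using x that mem_simplex[OF T] by blast
      show "x \<in> prism S u e \<union> T'"
      proof (cases "e \<le> lam T p x")
        case True
        then show ?thesis using x T'_sup by blast
      next
        case False
        define t where "t = lam T p x"
        define s where "s = x + (- t) *\<^sub>R u"
        have ls: "lam T q s = lam T q x - t * ((if q = p then 1 else 0) - (if q = s0 then 1 else 0))" if "q \<in> verts T" for q
          unfolding s_def lam_add using bu[OF that] by simp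
        have t: "0 \<le> t" "t \<le> e" using nn[OF p] False by (auto simp: t_def)
        have "0 \<le> lam T q s" if "q \<in> verts T" for q
          using ls[OF that] nn[OF that] t s0(2) by (auto simp: t_def)
        moreover have "lam T p s = 0" using ls[OF p] s0(2) by (simp add: t_def)
        ultimately have "s \<in> S" by (simp add: S_def fac_eq[OF T p] mem_simplex[OF T])
        moreover have "x = s + t *\<^sub>R u" by (simp add: s_def)
        ultimately show ?thesis using t by (auto simp: prism_def)
      qed
    qed
    have C_sub: "C \<subseteq> {x\<in>T. lam T p x < e}"
    proof
      fix x assume "x \<in> C"
      then obtain s t where st: "s \<in> S" "0 \<le> t" "t \<le> e"
        "x = (1 - (1 - e)) *\<^sub>R s0 + (1 - e) *\<^sub>R (s + t *\<^sub>R u)"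
        unfolding C_def comb prism_def by auto
      have s: "lam T p s = 0" "\<And>q. q \<in> verts T \<Longrightarrow> 0 \<le> lam T q s"
        using st(1) by (auto simp: S_def fac_eq[OF T p] mem_simplex[OF T])
      have lx: "lam T q x = e * (if s0 = q then 1 else 0) + (1 - e) * (lam T q s + t * ((if q = p then 1 else 0) - (if q = s0 then 1 else 0)))"
        if "q \<in> verts T" for q
      proof -
        have "lam T q (s + t *\<^sub>R u) = lam T q s + t * ((if q = p then 1 else 0) - (if q = s0 then 1 else 0))"
          unfolding lam_add using bu[OF that] by simp
        then show ?thesis unfolding st(4) lam_segment using lam_vertex[OF T s0(1)] by simp
      qed
      have te: "(1 - e) * t \<le> (1 - e) * e" using st e by (intro mult_left_mono) auto
      have "0 \<le> lam T q x" if q: "q \<in> verts T" for q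
      proof (cases "q = s0")
        case True
        have "0 \<le> (1 - e) * lam T s0 s" using s(2)[OF s0(1)] e by simp
        moreover have "lam T s0 x = e + (1 - e) * lam T s0 s - (1 - e) * t"
          using lx[OF s0(1)] s0(2) by (simp add: algebra_simps)
        moreover have "(1 - e) * e \<le> e" using e by (simp add: algebra_simps)
        ultimately show ?thesis unfolding True using te by linarith
      next
        case False
        then show ?thesis using lx[OF q] s(2)[OF q] st e by (auto intro!: mult_nonneg_nonneg add_nonneg_nonneg)
      qed
      moreover have "lam T p x < e"
      proof -
        have "lam T p x = (1 - e) * t" using lx[OF p] s(1) s0(2) by simp
        also have "\<dots> \<le> (1 - e) * e" by (rule te)
        also have "\<dots> < e" using e by (simp add: algebra_simps)
        finally show ?thesis .
      qed
      ultimately show "x \<in> {x\<in>T. lam T p x < e}" by (simp add: mem_simplex[OF T])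
    qed
    have lm: "T \<in> lmeasurable" "T' \<in> lmeasurable" "C \<in> lmeasurable" "prism S u e \<in> lmeasurable"
      using compact_full_simplex[OF T] cT' cC compact_prism[OF cS] by (simp_all add: lmeasurable_compact)
    have disj: "C \<inter> T' = {}"
    proof -
      have "x \<notin> T'" if "x \<in> C" for x
        using subsetD[OF C_sub that] subsetD[OF T'_sub, of x] by auto
      then show ?thesis by blast
    qed
    have "measure lebesgue C + measure lebesgue T' = measure lebesgue (C \<union> T')"
      by (rule measure_Union[symmetric, OF _ _ fmeasurableD[OF lm(3)] fmeasurableD[OF lm(2)] disj])
        (use fmeasurableD2[OF lm(3)] fmeasurableD2[OF lm(2)] in \<open>simp_all only: infinity_ennreal_def not_False_eq_True\<close>)
    also have "\<dots> \<le> V" unfolding V_def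
      using lm C_sub T'_sub by (intro measure_mono_fmeasurable) (auto simp: fmeasurableD)
    finally have 1: "measure lebesgue C + measure lebesgue T' \<le> V" .
    have "V \<le> measure lebesgue (prism S u e \<union> T')" unfolding V_def
      using lm cov by (intro measure_mono_fmeasurable) (auto simp: fmeasurableD)
    also have "\<dots> \<le> measure lebesgue (prism S u e) + measure lebesgue T'"
      using lm by (intro measure_Un_le) (auto simp: fmeasurableD)
    finally show ?thesis using 1 mT' mC Q[OF e(1)] by simp
  qed
  have lim: "((\<lambda>e. (1 - (1 - e) ^ d) * V / e) \<longlongrightarrow> real d * V) (at_right 0)"
  proof -
    have "((\<lambda>e. 1 - (1 - e) ^ d) has_real_derivative real d) (at 0)"
      by (auto intro!: derivative_eq_intros)
    then have "((\<lambda>e. (1 - (1 - e) ^ d) / e) \<longlongrightarrow> real d) (at_right 0)"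
      by (auto simp: DERIV_def intro: filterlim_mono[OF _ order_refl at_le])
    from tendsto_mult_right[OF this, of V] show ?thesis by simp
  qed
  have ev: "\<forall>\<^sub>F e in at_right 0. 0 < e \<and> e < (1::real)"
    using eventually_at_right_real[of 0 "1::real"] by simp
  have "real d * V \<le> A / g"
  proof (rule tendsto_upperbound[OF lim])
    show "\<forall>\<^sub>F e in at_right 0. (1 - (1 - e) ^ d) * V / e \<le> A / g"
      using ev by eventually_elim (use main in \<open>auto simp: field_simps\<close>)
  qed auto
  moreover have "A / g \<le> real d * V"
  proof (rule tendsto_le[OF _ lim])
    show "((\<lambda>e. (1 - e) ^ d * (A / g)) \<longlongrightarrow> A / g) (at_right 0)"
    proof -
      have "((\<lambda>e. (1 - e) ^ d * (A / g)) \<longlongrightarrow> (1 - 0) ^ d * (A / g)) (at_right 0)"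
        by (intro tendsto_mult tendsto_power tendsto_diff tendsto_const tendsto_ident_at)
      then show ?thesis by simp
    qed
    show "\<forall>\<^sub>F e in at_right 0. (1 - e) ^ d * (A / g) \<le> (1 - (1 - e) ^ d) * V / e"
      using ev by eventually_elim (use main in \<open>auto simp: field_simps\<close>)
  qed auto
  ultimately have "real d * V = A / g" by simp
  then have "real d * V * g = A" using g by simp
  then show ?thesis unfolding d_def V_def A_def S_def g_def .
qed

end


section \<open>The divergence theorem for lowest-order fields on a simplex\<close>

lemma lint_compact:
  fixes g :: "real^'n \<Rightarrow> 'b::euclidean_space"
  assumes "compact T" "continuous_on UNIV g"
  shows "integrable (lebesgue_on T) g"
    and "(LINT x|lebesgue_on T. g x) = (LINT x|lborel. indicator T x *\<^sub>R g x)"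
    and "integrable lborel (\<lambda>x. indicator T x *\<^sub>R g x)"
proof -
  show 1: "integrable lborel (\<lambda>x. indicator T x *\<^sub>R g x)"
    using borel_integrable_compact[OF assms(1), of g] assms(2) continuous_on_subset by blast
  have T: "T \<in> sets lebesgue" using assms(1) by (simp add: borel_compact)
  have "integrable lebesgue (\<lambda>x. indicator T x *\<^sub>R g x)"
    using 1 by (simp add: integrable_completion borel_measurable_integrable)
  then show "integrable (lebesgue_on T) g" using T by (simp add: integrable_restrict_space)
  show "(LINT x|lebesgue_on T. g x) = (LINT x|lborel. indicator T x *\<^sub>R g x)"
    using T 1 by (simp add: integral_restrict_space integral_completion borel_measurable_integrable)
qed

lemma lborel_volume_factor:
  fixes f :: "'a::euclidean_space \<Rightarrow> 'a"
  assumes "volume_factor f c"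
  shows "lborel = density (distr lborel borel (\<lambda>x. f x + w)) (\<lambda>_. ennreal c)"
proof (rule measure_eqI)
  have [measurable]: "f \<in> borel_measurable borel"
    using assms by (auto simp: volume_factor_def intro: linear_borel_measurable)
  fix A :: "'a set" assume "A \<in> sets lborel"
  then have [measurable]: "A \<in> sets borel" by simp
  have "{y. w + y \<in> A} \<in> sets borel" by measurable
  then have "emeasure lborel {y. w + y \<in> A} = ennreal c * emeasure lborel (f -` {y. w + y \<in> A})"
    using assms unfolding volume_factor_def by blast
  then have "emeasure lborel A = ennreal c * emeasure lborel (f -` {y. w + y \<in> A})"
    by (simp only: emeasure_lborel_translate(1)[OF \<open>A \<in> sets borel\<close>])
  then show "emeasure lborel A = emeasure (density (distr lborel borel (\<lambda>x. f x + w)) (\<lambda>_. ennreal c)) A"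
    by (simp add: emeasure_density emeasure_distr nn_integral_cmult vimage_def add.commute)
qed simp

lemma integral_volume_factor:
  fixes f :: "'a::euclidean_space \<Rightarrow> 'a" and h :: "'a \<Rightarrow> real"
  assumes f: "volume_factor f c" and [measurable]: "h \<in> borel_measurable borel"
  shows "(LINT x|lborel. h x) = c * (LINT x|lborel. h (f x + w))"
proof -
  have [measurable]: "f \<in> borel_measurable borel" and c: "0 < c"
    using f by (auto simp: volume_factor_def intro: linear_borel_measurable)
  have "(LINT x|lborel. h x) = (LINT x|density (distr lborel borel (\<lambda>x. f x + w)) (\<lambda>_. ennreal c). h x)"
    using lborel_volume_factor[OF f, of w] by simp
  also have "\<dots> = (LINT x|distr lborel borel (\<lambda>x. f x + w). c *\<^sub>R h x)"
    using c by (subst integral_density) auto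
  also have "\<dots> = c * (LINT x|lborel. h (f x + w))"
    by (subst integral_distr) auto
  finally show ?thesis .
qed

lemma volume_factor_homothety:
  assumes "0 < s"
  shows "volume_factor (\<lambda>x::real^'n. s *\<^sub>R x) (s ^ CARD('n))"
  unfolding volume_factor_def
proof (intro conjI ballI)
  let ?f = "\<lambda>x::real^'n. s *\<^sub>R x"
  show "linear ?f" by (simp add: linear_scale_self)
  show "bij ?f" using assms by (intro o_bij[of "\<lambda>x. (1 / s) *\<^sub>R x"]) (auto simp: fun_eq_iff)
  show "0 < s ^ CARD('n)" using assms by simp
  fix A :: "(real^'n) set" assume A: "A \<in> sets borel"
  have "lborel = density (distr lborel borel (\<lambda>x::real^'n. 0 + s *\<^sub>R x)) (\<lambda>_. ennreal (\<bar>s\<bar> ^ DIM(real^'n)))"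
    using lborel_affine[of s "0::real^'n"] assms by simp
  from arg_cong[OF this, of "\<lambda>M. emeasure M A"] A assms
  show "emeasure lborel A = ennreal (s ^ CARD('n)) * emeasure lborel (?f -` A)"
    by (simp add: emeasure_density emeasure_distr nn_integral_cmult vimage_def)
qed

text \<open>Let \<open>p\<close> be the apex. The integral of \<open>\<psi>\<close> over the homothetic copy \<open>p + s (T - p)\<close> is
  \<open>\<integral> s\<^sup>d \<psi>(p + s (y - p)) dy\<close> over \<open>T\<close>, whose derivative at \<open>s = 1\<close> is the left-hand side below. The
  difference quotient is also the integral over a layer of height \<open>1 - s\<close> at the facet, divided by
  \<open>1 - s\<close>; it tends to zero because the values of \<open>\<psi>\<close> in this layer are of the order of its height.\<close>

lemma divergence_theorem_zero_facet:
  fixes T :: "(real^'n) set" and \<psi> :: "real^'n \<Rightarrow> real"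
  assumes T: "full_simplex T" and p: "p \<in> verts T"
    and der: "\<And>x. (\<psi> has_derivative (\<lambda>h. D x \<bullet> h)) (at x)" and D: "continuous_on UNIV D"
    and L: "L-lipschitz_on UNIV \<psi>" and zero: "\<And>x. x \<in> fac T p \<Longrightarrow> \<psi> x = 0"
  shows "(LINT x|lebesgue_on T. CARD('n) * \<psi> x + D x \<bullet> (x - p)) = 0"
proof -
  define d where "d = CARD('n)"
  define e where "e k = 1 / (real k + 2)" for k :: nat
  have e: "0 < e k" "e k < 1" for k by (auto simp: e_def)
  have e0: "e \<longlonglongrightarrow> 0" proof -
    have "(\<lambda>k. 1 / (real k + 2)) \<longlonglongrightarrow> 0" using LIMSEQ_ignore_initial_segment[OF lim_1_over_n, of 2] by (simp add: add.commute)
    then show ?thesis by (simp add: e_def[abs_def])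
  qed
  have c\<psi>: "continuous_on UNIV \<psi>" using L by (rule lipschitz_on_continuous_on)
  have [measurable]: "\<psi> \<in> borel_measurable borel" "T \<in> sets borel"
    using c\<psi> compact_full_simplex[OF T] by (auto intro: borel_measurable_continuous_onI borel_compact)
  have cT: "compact T" by (rule compact_full_simplex[OF T])
  have L0: "0 \<le> L" using L by (rule lipschitz_on_nonneg)
  have Ld: "\<bar>\<psi> x - \<psi> y\<bar> \<le> L * dist x y" for x y
    using lipschitz_onD[OF L, of x y] by (simp add: dist_real_def)
  obtain s0 where s0: "s0 \<in> verts T" "s0 \<noteq> p" using ex_other_vertex[OF T] by blast
  define u where "u = p - s0"
  have nn: "0 \<le> lam T q x" if "x \<in> T" "q \<in> verts T" for q x using that mem_simplex[OF T] by blast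
  \<comment> \<open>\<open>F k\<close> is the difference quotient of \<open>s\<^sup>d \<psi>(p + s (y - p))\<close> at \<open>s = 1\<close>, and \<open>G k\<close> is \<open>\<psi>\<close> on the layer at the
    facet that the homothetic copy leaves uncovered, divided by \<open>e k\<close>.\<close>
  define F where "F k y = indicator T y * ((\<psi> y - (1 - e k) ^ d * \<psi> ((1 - e k) *\<^sub>R y + e k *\<^sub>R p)) / e k)" for k y
  define G where "G k y = indicator {y\<in>T. lam T p y < e k} y * (\<psi> y / e k)" for k y
  have [measurable]: "F k \<in> borel_measurable borel" "G k \<in> borel_measurable borel" for k
    unfolding F_def[abs_def] G_def[abs_def] by measurable
  have in_T: "(1 - e k) *\<^sub>R y + e k *\<^sub>R p \<in> T \<and> e k \<le> lam T p ((1 - e k) *\<^sub>R y + e k *\<^sub>R p) \<longleftrightarrow> y \<in> T" for k y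
  proof -
    have l: "lam T q ((1 - e k) *\<^sub>R y + e k *\<^sub>R p) = (1 - e k) * lam T q y + e k * (if p = q then 1 else 0)" for q
      using lam_segment[of T q "e k" y p] by (simp add: lam_vertex[OF T p])
    show ?thesis
    proof
      assume *: "(1 - e k) *\<^sub>R y + e k *\<^sub>R p \<in> T \<and> e k \<le> lam T p ((1 - e k) *\<^sub>R y + e k *\<^sub>R p)"
      have "0 \<le> (1 - e k) * lam T q y" if "q \<in> verts T" for q
        using * nn[OF conjunct1[OF *] that] unfolding l by (cases "q = p") auto
      then show "y \<in> T" using e[of k] by (auto simp: mem_simplex[OF T] zero_le_mult_iff)
    next
      assume "y \<in> T"
      then have "0 \<le> (1 - e k) * lam T q y" if "q \<in> verts T" for q using nn that e(2)[of k] by simp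
      then show "(1 - e k) *\<^sub>R y + e k *\<^sub>R p \<in> T \<and> e k \<le> lam T p ((1 - e k) *\<^sub>R y + e k *\<^sub>R p)"
        using e[of k] p by (auto simp: mem_simplex[OF T] l)
    qed
  qed
  have FG: "(LINT x|lborel. F k x) = (LINT x|lborel. G k x)" for k
  proof -
    define h where "h x = indicator {x\<in>T. e k \<le> lam T p x} x * \<psi> x" for x
    have [measurable]: "h \<in> borel_measurable borel" unfolding h_def[abs_def] by measurable
    have i\<psi>: "integrable lborel (\<lambda>x. indicator T x * \<psi> x)"
      using lint_compact(3)[OF cT c\<psi>] by simp
    have ih: "integrable lborel h"
      by (rule Bochner_Integration.integrable_bound[OF i\<psi>]) (auto simp: h_def indicator_def)
    have hh: "h ((1 - e k) *\<^sub>R y + e k *\<^sub>R p) = indicator T y * \<psi> ((1 - e k) *\<^sub>R y + e k *\<^sub>R p)" for y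
      using in_T[of k y] by (simp add: h_def indicator_def)
    have vf: "volume_factor (\<lambda>x::real^'n. (1 - e k) *\<^sub>R x) ((1 - e k) ^ d)"
      unfolding d_def by (rule volume_factor_homothety) (use e[of k] in simp)
    have I: "(LINT x|lborel. h x) = (1 - e k) ^ d * (LINT y|lborel. indicator T y * \<psi> ((1 - e k) *\<^sub>R y + e k *\<^sub>R p))"
      using integral_volume_factor[OF vf, of h "e k *\<^sub>R p"] by (simp add: hh)
    have i2: "integrable lborel (\<lambda>y. indicator T y * \<psi> ((1 - e k) *\<^sub>R y + e k *\<^sub>R p))"
    proof -
      have "continuous_on UNIV (\<lambda>y. \<psi> ((1 - e k) *\<^sub>R y + e k *\<^sub>R p))"
        by (rule continuous_on_compose2[OF c\<psi>]) (auto intro!: continuous_intros)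
      from lint_compact(3)[OF cT this] show ?thesis by simp
    qed
    have "(LINT x|lborel. F k x) = (LINT x|lborel. (indicator T x * \<psi> x - (1 - e k) ^ d * (indicator T x * \<psi> ((1 - e k) *\<^sub>R x + e k *\<^sub>R p))) / e k)"
      by (intro Bochner_Integration.integral_cong) (auto simp: F_def indicator_def)
    also have "\<dots> = ((LINT x|lborel. indicator T x * \<psi> x) - (LINT x|lborel. h x)) / e k"
      using i\<psi> i2 unfolding I by simp
    also have "\<dots> = (LINT x|lborel. (indicator T x * \<psi> x - h x) / e k)" using i\<psi> ih by simp
    also have "\<dots> = (LINT x|lborel. G k x)"
      by (intro Bochner_Integration.integral_cong) (auto simp: G_def h_def indicator_def)
    finally show ?thesis .
  qed
  obtain B where B: "\<And>x. x \<in> T \<Longrightarrow> \<bar>\<psi> x\<bar> \<le> B"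
    using compact_continuous_image[OF continuous_on_subset[OF c\<psi>] cT, THEN compact_imp_bounded]
    by (auto simp: bounded_iff)
  obtain R where R: "\<And>x. x \<in> T \<Longrightarrow> dist x p \<le> R"
    using compact_imp_bounded[OF cT] bounded_any_center[of T p] by (auto simp: dist_commute)
  have pT: "p \<in> T" using p verts_subset[OF T] by blast
  have B0: "0 \<le> B" using B[OF pT] by linarith
  have iT: "integrable lborel (indicator T :: _ \<Rightarrow> real)"
    using lint_compact(3)[OF cT, of "\<lambda>_. 1 :: real"] by simp
  have limF: "(\<lambda>k. LINT x|lborel. F k x) \<longlonglongrightarrow> (LINT x|lborel. indicator T x * (d * \<psi> x + D x \<bullet> (x - p)))"
  proof (rule integral_dominated_convergence[where w = "\<lambda>x. indicator T x * (L * R + d * B)" and s = F and M = lborel])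
    show "(\<lambda>x. indicator T x * (d * \<psi> x + D x \<bullet> (x - p))) \<in> borel_measurable lborel"
      using borel_measurable_continuous_onI[OF D] by measurable
    show "integrable lborel (\<lambda>x. indicator T x * (L * R + d * B))" using iT by simp
    show "AE x in lborel. (\<lambda>k. F k x) \<longlonglongrightarrow> indicator T x * (d * \<psi> x + D x \<bullet> (x - p))"
    proof (rule AE_I2)
      fix y
      define c where "c t = p + t *\<^sub>R (y - p)" for t :: real
      have "(c has_derivative (\<lambda>t. t *\<^sub>R (y - p))) (at 1)"
        unfolding c_def by (auto intro!: derivative_eq_intros)
      from has_derivative_compose[OF this, of \<psi> "\<lambda>h. D y \<bullet> h"]
      have "((\<lambda>t. \<psi> (c t)) has_derivative (\<lambda>t. D y \<bullet> (t *\<^sub>R (y - p)))) (at 1)"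
        using der[of y] by (simp add: c_def)
      then have "((\<lambda>t. \<psi> (c t)) has_real_derivative D y \<bullet> (y - p)) (at 1)"
      proof -
        have "(\<lambda>t. D y \<bullet> (t *\<^sub>R (y - p))) = (*) (D y \<bullet> (y - p))" by (auto simp: mult.commute)
        then show "((\<lambda>t. \<psi> (c t)) has_derivative (\<lambda>t. D y \<bullet> (t *\<^sub>R (y - p)))) (at 1) \<Longrightarrow> ?thesis"
          by (simp only: has_field_derivative_def)
      qed
      then have "((\<lambda>t. t ^ d * \<psi> (c t)) has_real_derivative d * \<psi> y + D y \<bullet> (y - p)) (at 1)"
        by (auto intro!: derivative_eq_intros simp: c_def)
      then have "((\<lambda>h. ((1 + h) ^ d * \<psi> (c (1 + h)) - \<psi> y) / h) \<longlongrightarrow> d * \<psi> y + D y \<bullet> (y - p)) (at 0)"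
        by (simp add: DERIV_def c_def)
      moreover have "filterlim (\<lambda>k. - e k) (at 0) sequentially"
      proof -
        have "e k \<noteq> 0" for k using e(1)[of k] by simp
        then show ?thesis using tendsto_minus[OF e0] by (simp add: filterlim_at)
      qed
      ultimately have "(\<lambda>k. ((1 + - e k) ^ d * \<psi> (c (1 + - e k)) - \<psi> y) / - e k) \<longlonglongrightarrow> d * \<psi> y + D y \<bullet> (y - p)"
        by (rule filterlim_compose)
      moreover have "((1 + - e k) ^ d * \<psi> (c (1 + - e k)) - \<psi> y) / - e k
          = (\<psi> y - (1 - e k) ^ d * \<psi> ((1 - e k) *\<^sub>R y + e k *\<^sub>R p)) / e k" for k
      proof -
        have "c (1 + - e k) = (1 - e k) *\<^sub>R y + e k *\<^sub>R p" by (simp add: c_def algebra_simps)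
        moreover have "(a - b) / - t = (b - a) / t" for a b t :: real
          by (metis minus_diff_eq minus_divide_divide)
        ultimately show ?thesis by simp
      qed
      ultimately have "(\<lambda>k. (\<psi> y - (1 - e k) ^ d * \<psi> ((1 - e k) *\<^sub>R y + e k *\<^sub>R p)) / e k) \<longlonglongrightarrow> d * \<psi> y + D y \<bullet> (y - p)"
        by simp
      from tendsto_mult_left[OF this, of "indicator T y"]
      show "(\<lambda>k. F k y) \<longlonglongrightarrow> indicator T y * (d * \<psi> y + D y \<bullet> (y - p))" by (simp add: F_def)
    qed
    show "AE x in lborel. norm (F k x) \<le> indicator T x * (L * R + d * B)" for k
    proof (rule AE_I2)
      fix y
      show "norm (F k y) \<le> indicator T y * (L * R + d * B)"
      proof (cases "y \<in> T")
        case True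
        define z where "z = (1 - e k) *\<^sub>R y + e k *\<^sub>R p"
        have zT: "z \<in> T" using in_T[of k y] True by (simp add: z_def)
        have "y - z = e k *\<^sub>R (y - p)" by (simp add: z_def algebra_simps)
        then have "dist y z = e k * dist y p" using e[of k] by (simp add: dist_norm)
        then have "L * dist y z \<le> L * (e k * R)" using R[OF True] L0 e[of k] by (intro mult_left_mono) auto
        then have 1: "\<bar>\<psi> y - \<psi> z\<bar> \<le> e k * (L * R)" using Ld[of y z] by (simp add: algebra_simps)
        have "1 + real d * (- e k) \<le> (1 + - e k) ^ d" by (rule Bernoulli_inequality) (use e[of k] in simp)
        then have "0 \<le> 1 - (1 - e k) ^ d" "1 - (1 - e k) ^ d \<le> d * e k"
          using e[of k] by (auto simp: power_le_one)
        then have 2: "\<bar>(1 - (1 - e k) ^ d) * \<psi> z\<bar> \<le> (d * e k) * B"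
          unfolding abs_mult using B[OF zT] by (intro mult_mono) auto
        have "\<bar>\<psi> y - (1 - e k) ^ d * \<psi> z\<bar> = \<bar>(\<psi> y - \<psi> z) + (1 - (1 - e k) ^ d) * \<psi> z\<bar>"
          by (simp add: algebra_simps)
        also have "\<dots> \<le> e k * (L * R + d * B)" using 1 2 by (simp add: algebra_simps)
        finally have "\<bar>\<psi> y - (1 - e k) ^ d * \<psi> z\<bar> / e k \<le> L * R + d * B"
          using e[of k] by (simp add: pos_divide_le_eq mult.commute)
        then show ?thesis using True e[of k] by (simp add: F_def z_def abs_divide)
      qed (simp add: F_def)
    qed
  qed auto
  have limG: "(\<lambda>k. LINT x|lborel. G k x) \<longlonglongrightarrow> (LINT x::real^'n|lborel. (0::real))"
  proof (rule integral_dominated_convergence[where w = "\<lambda>x. indicator T x * (L * norm u)" and f = "\<lambda>_. 0" and s = G and M = lborel])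
    show "integrable lborel (\<lambda>x. indicator T x * (L * norm u))" using iT by simp
    show "AE x in lborel. (\<lambda>k. G k x) \<longlonglongrightarrow> 0"
    proof (rule AE_I2)
      fix y
      have "\<forall>\<^sub>F k in sequentially. G k y = 0"
      proof (cases "y \<in> T \<and> lam T p y > 0")
        case True
        have "\<forall>\<^sub>F k in sequentially. e k < lam T p y" using order_tendstoD(2)[OF e0] True by blast
        then show ?thesis by eventually_elim (auto simp: G_def)
      next
        case False
        then have "y \<in> T \<Longrightarrow> \<psi> y = 0" using nn[OF _ p] zero fac_eq[OF T p] by force
        then show ?thesis by (intro always_eventually) (auto simp: G_def indicator_def)
      qed
      then show "(\<lambda>k. G k y) \<longlonglongrightarrow> 0" by (rule tendsto_eventually)
    qed
    show "AE x in lborel. norm (G k x) \<le> indicator T x * (L * norm u)" for k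
    proof (rule AE_I2)
      fix y
      show "norm (G k y) \<le> indicator T y * (L * norm u)"
      proof (cases "y \<in> T \<and> lam T p y < e k")
        case True
        define t where "t = lam T p y"
        have t: "0 \<le> t" "t < e k" using True nn[OF _ p] by (auto simp: t_def)
        \<comment> \<open>The oblique projection of \<open>y\<close> to the facet along the edge from \<open>s0\<close> to \<open>p\<close>.\<close>
        define s where "s = y + (- t) *\<^sub>R u"
        have bu: "bgrad T q \<bullet> u = (if q = p then 1 else 0) - (if q = s0 then 1 else 0)" if "q \<in> verts T" for q
          using lam_diff[of T q p s0] p s0 that
          by (cases "q = p"; cases "q = s0") (auto simp: u_def lam_vertex[OF T])
        have ls: "lam T q s = lam T q y - t * ((if q = p then 1 else 0) - (if q = s0 then 1 else 0))" if "q \<in> verts T" for q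
          unfolding s_def lam_add using bu[OF that] by simp
        have "0 \<le> lam T q s" if "q \<in> verts T" for q
          using ls[OF that] nn[OF conjunct1[OF True] that] t s0(2) by (auto simp: t_def)
        moreover have "lam T p s = 0" using ls[OF p] s0(2) by (simp add: t_def)
        ultimately have "s \<in> fac T p" by (simp add: fac_eq[OF T p] mem_simplex[OF T])
        then have "\<psi> s = 0" by (rule zero)
        then have "\<bar>\<psi> y\<bar> \<le> L * dist y s" using Ld[of y s] by simp
        also have "dist y s = t * norm u" using t by (simp add: s_def dist_norm)
        also have "L * (t * norm u) \<le> L * (e k * norm u)" using t L0 by (intro mult_left_mono mult_right_mono) auto
        finally have "\<bar>\<psi> y\<bar> / e k \<le> L * norm u" using e[of k] by (simp add: pos_divide_le_eq algebra_simps)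
        then show ?thesis using True e[of k] by (simp add: G_def abs_divide)
      qed (auto simp: G_def L0 indicator_def)
    qed
  qed auto
  have "(LINT x|lborel. indicator T x * (d * \<psi> x + D x \<bullet> (x - p))) = 0"
    using LIMSEQ_unique[OF limF limG[folded FG]] by simp
  moreover have "continuous_on UNIV (\<lambda>x. d * \<psi> x + D x \<bullet> (x - p))"
    using c\<psi> D by (intro continuous_intros)
  ultimately show ?thesis using lint_compact(2)[OF cT, of "\<lambda>x. d * \<psi> x + D x \<bullet> (x - p)"] by (simp add: d_def)
qed


section \<open>Facet means\<close>

lemma smooth_compact_support_lipschitz:
  fixes \<phi> :: "real^'n \<Rightarrow> real"
  assumes \<phi>: "smooth \<phi>" and C: "compact C" "\<And>x. x \<notin> C \<Longrightarrow> \<phi> x = 0"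
  shows "\<exists>L. L-lipschitz_on UNIV \<phi>"
proof -
  have zero: "grad \<phi> x = 0" if "x \<notin> C" for x
  proof -
    have op: "open (- C)" using C(1) by (simp add: compact_imp_closed open_Compl)
    have "((\<lambda>_. 0) has_derivative (\<lambda>h. 0)) (at x)" by simp
    then have "(\<phi> has_derivative (\<lambda>h. 0)) (at x)"
      by (rule has_derivative_transform_within_open[OF _ op]) (use that C in auto)
    then have "grad \<phi> x \<bullet> grad \<phi> x = 0" by (rule grad_eqI(2))
    then show ?thesis by simp
  qed
  have "bounded (grad \<phi> ` C)"
    using smooth_grad(2)[OF \<phi>] C(1) by (intro compact_imp_bounded compact_continuous_image) (auto intro: continuous_on_subset)
  then obtain B where B: "\<And>x. x \<in> C \<Longrightarrow> norm (grad \<phi> x) \<le> B" by (auto simp: bounded_iff)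
  have B': "norm (grad \<phi> x) \<le> max B 0" for x
    using B[of x] zero[of x] by (cases "x \<in> C") auto
  have "norm (\<phi> y - \<phi> x) \<le> max B 0 * norm (y - x)" for x y
  proof (rule differentiable_bound[of UNIV \<phi> "\<lambda>x h. grad \<phi> x \<bullet> h"])
    show "onorm ((\<bullet>) (grad \<phi> x)) \<le> max B 0" for x
      by (rule onorm_le) (metis B' Cauchy_Schwarz_ineq2 mult_right_mono norm_ge_zero order_trans real_norm_def)
  qed (use smooth_grad(1)[OF \<phi>] in auto)
  then have "(max B 0)-lipschitz_on UNIV \<phi>"
    by (intro lipschitz_onI) (auto simp: dist_norm)
  then show ?thesis by blast
qed

text \<open>The mean of \<open>\<phi>\<close> over the facet opposite \<open>p\<close>, written as an integral over the element: the field
  \<open>x - p\<close> has divergence \<open>d\<close>, its normal component is the height on this facet and zero on the other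
  facets.\<close>

definition fmean :: "(real^'n) set \<Rightarrow> real^'n \<Rightarrow> (real^'n \<Rightarrow> real) \<Rightarrow> real" where
  "fmean T p \<phi> = (LINT x|lebesgue_on T. real CARD('n) * \<phi> x + grad \<phi> x \<bullet> (x - p)) / (real CARD('n) * vol T)"

lemma vol_full_simplex_pos: "full_simplex T \<Longrightarrow> 0 < vol T" for T :: "(real^'n) set"
proof -
  assume T: "full_simplex T"
  have "\<not> negligible T"
    using open_not_negligible[OF open_interior interior_full_simplex_nonempty[OF T]] negligible_subset interior_subset by blast
  then show "0 < vol T"
    using lmeasurable_compact[OF compact_full_simplex[OF T]]
    by (metis negligible_iff_measure zero_less_measure_iff measure_nonneg less_eq_real_def)
qed

lemma fmean_zero:
  fixes T :: "(real^'n) set"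
  assumes "full_simplex T" "p \<in> verts T" "smooth \<phi>" "L-lipschitz_on UNIV \<phi>" "\<And>x. x \<in> fac T p \<Longrightarrow> \<phi> x = 0"
  shows "fmean T p \<phi> = 0"
  unfolding fmean_def
  using divergence_theorem_zero_facet[OF assms(1,2) smooth_grad[OF assms(3)] assms(4,5)] by simp

text \<open>The mean depends on the facet only: for two elements with a common facet, pull \<open>\<phi>\<close> back by the
  affine map between them that fixes the facet. The difference of \<open>\<phi>\<close> and its pullback vanishes on
  the facet.\<close>

lemma fmean_shared_facet:
  fixes T T' :: "(real^'n) set"
  assumes T: "full_simplex T" "p \<in> verts T" and T': "full_simplex T'" "p' \<in> verts T'"
    and eq: "fac T p = fac T' p'" and \<phi>: "smooth \<phi>" and L: "L-lipschitz_on UNIV \<phi>"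
  shows "fmean T p \<phi> = fmean T' p' \<phi>"
proof -
  define d where "d = CARD('n)"
  have v: "verts T - {p} = verts T' - {p'}" using verts_fac[OF T(1), of p] verts_fac[OF T'(1), of p'] eq by simp
  define w where "w = p' - p"
  define f where "f x = x + (bgrad T p \<bullet> x) *\<^sub>R w" for x
  define b where "b = snd (bcoeff T p) *\<^sub>R w"
  define M where "M x = x + lam T p x *\<^sub>R w" for x
  have Mf: "M x = f x + b" for x by (simp add: M_def f_def b_def lam_def scaleR_left_distrib)
  have Mp: "M p = p'" by (simp add: M_def w_def lam_vertex[OF T])
  have Mr: "M r = r" if "r \<in> verts T - {p}" for r using that by (simp add: M_def lam_vertex[OF T(1)])
  have lamM: "lam T' q (M x) = (\<Sum>r\<in>verts T. lam T r x * lam T' q (M r))" for q x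
  proof -
    have aff: "lam T' q (M x) = (bgrad T' q + (bgrad T' q \<bullet> w) *\<^sub>R bgrad T p) \<bullet> x + ((bgrad T' q \<bullet> w) * snd (bcoeff T p) + snd (bcoeff T' q))" for x
      by (simp add: lam_def M_def inner_add_left inner_add_right algebra_simps)
    show ?thesis unfolding aff by (rule affine_lam_repr[OF T(1)])
  qed
  have lamM_p: "lam T' p' (M x) = lam T p x" for x
  proof -
    have eqs: "lam T' p' (M r) = (if r = p then 1 else 0)" if "r \<in> verts T" for r
    proof (cases "r = p")
      case True
      then show ?thesis using Mp lam_vertex[OF T'] by simp
    next
      case False
      then have "r \<in> verts T - {p}" using that by blast
      moreover from this have "r \<in> verts T'" "r \<noteq> p'" using v by blast+
      ultimately show ?thesis using False Mr[of r] lam_vertex[OF T'(1)] by simp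
    qed
    have "lam T' p' (M x) = (\<Sum>r\<in>verts T. lam T r x * (if r = p then 1 else 0))"
      unfolding lamM[of p' x] by (intro sum.cong refl) (simp only: eqs)
    then show ?thesis using full_simplex_verts(1)[OF T(1)] T(2) by (simp add: if_distrib cong: if_cong)
  qed
  have lamM_q: "lam T' q (M x) = lam T q x" if q: "q \<in> verts T - {p}" for q x
  proof -
    have q': "q \<in> verts T'" "q \<noteq> p'" "q \<noteq> p" using q v by blast+
    have eqs: "lam T' q (M r) = (if r = q then 1 else 0)" if "r \<in> verts T" for r
    proof (cases "r = p")
      case True
      then show ?thesis using Mp lam_vertex[OF T'] q' by simp
    next
      case False
      then have "r \<in> verts T - {p}" using that by blast
      moreover from this have "r \<in> verts T'" using v by blast
      ultimately show ?thesis using Mr[of r] lam_vertex[OF T'(1)] by simp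
    qed
    have "lam T' q (M x) = (\<Sum>r\<in>verts T. lam T r x * (if r = q then 1 else 0))"
      unfolding lamM[of q x] by (intro sum.cong refl) (simp only: eqs)
    then show ?thesis using full_simplex_verts(1)[OF T(1)] q by (simp add: if_distrib cong: if_cong)
  qed
  have MT: "M x \<in> T' \<longleftrightarrow> x \<in> T" for x
  proof -
    have "M x \<in> T' \<longleftrightarrow> 0 \<le> lam T' p' (M x) \<and> (\<forall>q\<in>verts T' - {p'}. 0 \<le> lam T' q (M x))"
      unfolding mem_simplex[OF T'(1)] using T'(2) by blast
    also have "\<dots> \<longleftrightarrow> 0 \<le> lam T p x \<and> (\<forall>q\<in>verts T - {p}. 0 \<le> lam T q x)"
      using lamM_p lamM_q v by metis
    also have "\<dots> \<longleftrightarrow> x \<in> T" unfolding mem_simplex[OF T(1)] using T(2) by blast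
    finally show ?thesis .
  qed
  have "lam T p p' \<noteq> 0"
  proof
    assume 0: "lam T p p' = 0"
    have "lam T p y = (\<Sum>r\<in>verts T'. lam T' r y * lam T p r)" for y
      using affine_lam_repr[OF T'(1), of "bgrad T p" y] by (simp add: lam_def[of T])
    moreover have "lam T p r = 0" if "r \<in> verts T'" for r
    proof (cases "r = p'")
      case False
      then have "r \<in> verts T - {p}" using that v by blast
      then show ?thesis using lam_vertex[OF T(1)] by simp
    qed (use 0 in simp)
    ultimately have "lam T p p = 0" by simp
    then show False using lam_vertex[OF T] by simp
  qed
  moreover have "lam T p p' = 1 + bgrad T p \<bullet> w"
    using lam_diff[of T p p' p] lam_vertex[OF T] by (simp add: w_def)
  ultimately have "1 + bgrad T p \<bullet> w \<noteq> 0" by simp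
  then obtain c where vf: "volume_factor f c"
    unfolding f_def[abs_def] using volume_factor_exists[OF rank_one_linear rank_one_bij] by blast
  have c: "0 < c" using vf by (simp add: volume_factor_def)
  have cT: "compact T" "compact T'" using compact_full_simplex T T' by blast+
  have [measurable]: "T' \<in> sets borel" using cT by (simp add: borel_compact)
  have tr: "(LINT x|lebesgue_on T'. h x) = c * (LINT x|lebesgue_on T. h (M x))" if h: "continuous_on UNIV h" for h :: "real^'n \<Rightarrow> real"
  proof -
    have [measurable]: "h \<in> borel_measurable borel" using h by (rule borel_measurable_continuous_onI)
    have "(LINT x|lebesgue_on T'. h x) = (LINT x|lborel. indicator T' x * h x)"
      using lint_compact(2)[OF cT(2) h] by simp
    also have "\<dots> = c * (LINT x|lborel. indicator T' (M x) * h (M x))"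
      using integral_volume_factor[OF vf, of "\<lambda>x. indicator T' x * h x" b] by (simp add: Mf)
    also have "(LINT x|lborel. indicator T' (M x) * h (M x)) = (LINT x|lborel. indicator T x *\<^sub>R h (M x))"
      using MT by (intro Bochner_Integration.integral_cong) (auto simp: indicator_def)
    also have "\<dots> = (LINT x|lebesgue_on T. h (M x))"
    proof -
      have "continuous_on UNIV (\<lambda>x. h (M x))"
        unfolding M_def by (rule continuous_on_compose2[OF h]) (auto intro!: continuous_intros)
      then show ?thesis using lint_compact(2)[OF cT(1)] by metis
    qed
    finally show ?thesis .
  qed
  have volT: "vol T' = c * vol T"
    using tr[of "\<lambda>_. 1"] cT by (simp add: lmeasurable_compact measure_restrict_space borel_compact)
  note D = smooth_grad[OF \<phi>]
  have c\<phi>: "continuous_on UNIV \<phi>" using L by (rule lipschitz_on_continuous_on)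
  have cM: "continuous_on UNIV M" unfolding M_def by (intro continuous_intros)
  define D' where "D' x = grad \<phi> x - (grad \<phi> (M x) + (grad \<phi> (M x) \<bullet> w) *\<^sub>R bgrad T p)" for x
  have derM: "(M has_derivative (\<lambda>h. h + (bgrad T p \<bullet> h) *\<^sub>R w)) (at x)" for x
    unfolding M_def lam_def by (auto intro!: derivative_eq_intros)
  have der: "((\<lambda>x. \<phi> x - \<phi> (M x)) has_derivative (\<lambda>h. D' x \<bullet> h)) (at x)" for x
    using has_derivative_diff[OF D(1) has_derivative_compose[OF derM D(1)], of x]
    by (rule has_derivative_eq_rhs) (auto simp: D'_def fun_eq_iff inner_add_left inner_diff_left inner_add_right algebra_simps)
  have cD': "continuous_on UNIV D'"
    unfolding D'_def by (intro continuous_intros D(2) continuous_on_compose2[OF D(2) cM]) auto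
  have "bounded_linear f" using vf by (simp add: volume_factor_def linear_conv_bounded_linear)
  then obtain B where B: "0 < B" "\<And>x. norm (f x) \<le> norm x * B" using bounded_linear.pos_bounded by blast
  have "(L * B)-lipschitz_on UNIV (\<lambda>x. \<phi> (M x))"
  proof (rule lipschitz_onI)
    fix x y
    have "dist (M x) (M y) = norm (f (x - y))"
      using vf by (simp add: Mf dist_norm volume_factor_def linear_diff)
    then have "L * dist (M x) (M y) \<le> L * (B * dist x y)"
      using B(2)[of "x - y"] lipschitz_on_nonneg[OF L] by (intro mult_left_mono) (auto simp: dist_norm mult.commute)
    then show "dist (\<phi> (M x)) (\<phi> (M y)) \<le> L * B * dist x y"
      using lipschitz_onD[OF L, of "M x" "M y"] by (simp add: mult.assoc)
  qed (use lipschitz_on_nonneg[OF L] B(1) in auto)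
  from lipschitz_on_diff[OF L this] have lip: "(L + L * B)-lipschitz_on UNIV (\<lambda>x. \<phi> x - \<phi> (M x))" by simp
  have "(LINT x|lebesgue_on T. d * (\<phi> x - \<phi> (M x)) + D' x \<bullet> (x - p)) = 0"
    unfolding d_def
  proof (rule divergence_theorem_zero_facet[OF T der cD' lip])
    show "\<phi> x - \<phi> (M x) = 0" if "x \<in> fac T p" for x
      using that fac_eq[OF T] by (auto simp: M_def)
  qed
  moreover have "d * (\<phi> x - \<phi> (M x)) + D' x \<bullet> (x - p) = (d * \<phi> x + grad \<phi> x \<bullet> (x - p)) - (d * \<phi> (M x) + grad \<phi> (M x) \<bullet> (M x - p'))" for x
  proof -
    have eq: "M x - p' = (x - p) + (bgrad T p \<bullet> (x - p)) *\<^sub>R w"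
      unfolding Mp[symmetric] by (simp add: M_def lam_diff[symmetric] scaleR_left_diff_distrib)
    show ?thesis unfolding eq D'_def by (simp add: inner_add_left inner_diff_left inner_add_right algebra_simps)
  qed
  moreover have "integrable (lebesgue_on T) (\<lambda>x. d * \<phi> x + grad \<phi> x \<bullet> (x - p))"
    using cT(1) c\<phi> D(2) by (intro lint_compact(1) continuous_intros)
  moreover have "integrable (lebesgue_on T) (\<lambda>x. d * \<phi> (M x) + grad \<phi> (M x) \<bullet> (M x - p'))"
    using cT(1) by (intro lint_compact(1) continuous_intros continuous_on_compose2[OF c\<phi> cM] continuous_on_compose2[OF D(2) cM] cM) auto
  ultimately have "(LINT x|lebesgue_on T. d * \<phi> x + grad \<phi> x \<bullet> (x - p)) = (LINT x|lebesgue_on T. d * \<phi> (M x) + grad \<phi> (M x) \<bullet> (M x - p'))"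
    by simp
  moreover have "continuous_on UNIV (\<lambda>x. d * \<phi> x + grad \<phi> x \<bullet> (x - p'))" using c\<phi> D(2) by (intro continuous_intros)
  ultimately show ?thesis
    unfolding fmean_def volT using tr[of "\<lambda>x. d * \<phi> x + grad \<phi> x \<bullet> (x - p')"] c by (simp add: d_def)
qed

lemma lint_position_field:
  fixes T :: "(real^'n) set"
  assumes T: "full_simplex T" and \<phi>: "smooth \<phi>" and L: "L-lipschitz_on UNIV \<phi>"
  shows "(LINT x|lebesgue_on T. grad \<phi> x \<bullet> (x - p)) = real CARD('n) * (vol T * fmean T p \<phi> - (LINT x|lebesgue_on T. \<phi> x))"
proof -
  have cT: "compact T" by (rule compact_full_simplex[OF T])
  have c\<phi>: "continuous_on UNIV \<phi>" using L by (rule lipschitz_on_continuous_on)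
  have i: "integrable (lebesgue_on T) \<phi>" "integrable (lebesgue_on T) (\<lambda>x. grad \<phi> x \<bullet> (x - p))"
    using cT c\<phi> smooth_grad(2)[OF \<phi>] by (auto intro!: lint_compact(1) continuous_intros)
  have "real CARD('n) * vol T * fmean T p \<phi> = (LINT x|lebesgue_on T. real CARD('n) * \<phi> x + grad \<phi> x \<bullet> (x - p))"
    using vol_full_simplex_pos[OF T] by (simp add: fmean_def)
  also have "\<dots> = real CARD('n) * (LINT x|lebesgue_on T. \<phi> x) + (LINT x|lebesgue_on T. grad \<phi> x \<bullet> (x - p))"
    using i by simp
  finally show ?thesis by (simp add: algebra_simps)
qed

text \<open>The facet means of such a function vanish, so that the claim holds for the fields \<open>x - p\<close> with a
  vertex \<open>p\<close>. Every point is an affine combination of the vertices, and every affine field here is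
  a combination of fields \<open>x - z\<close>.\<close>

lemma lint_affine_field_interior:
  fixes T :: "(real^'n) set"
  assumes T: "full_simplex T" and \<phi>: "smooth \<phi>" and L: "L-lipschitz_on UNIV \<phi>"
    and zero: "\<And>x. x \<notin> interior T \<Longrightarrow> \<phi> x = 0"
  shows "(LINT x|lebesgue_on T. (a + b *\<^sub>R x) \<bullet> grad \<phi> x) = - (real CARD('n) * b) * (LINT x|lebesgue_on T. \<phi> x)"
proof -
  define I where "I = (LINT x|lebesgue_on T. \<phi> x)"
  have cT: "compact T" by (rule compact_full_simplex[OF T])
  note D = smooth_grad(2)[OF \<phi>]
  have cont: "integrable (lebesgue_on T) (\<lambda>x. grad \<phi> x \<bullet> (h x))" if "continuous_on UNIV h" for h
    using cT D that by (intro lint_compact(1) continuous_intros)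
  have vertex: "(LINT x|lebesgue_on T. grad \<phi> x \<bullet> (x - p)) = - real CARD('n) * I" if p: "p \<in> verts T" for p
  proof -
    have "fmean T p \<phi> = 0"
    proof (rule fmean_zero[OF T p \<phi> L])
      show "\<phi> x = 0" if "x \<in> fac T p" for x
        using that p fac_eq[OF T p] interior_simplex[OF T] by (intro zero) force
    qed
    then show ?thesis using lint_position_field[OF T \<phi> L, of p] by (simp add: I_def)
  qed
  have point: "(LINT x|lebesgue_on T. grad \<phi> x \<bullet> (x - z)) = - real CARD('n) * I" for z
  proof -
    have "grad \<phi> x \<bullet> (x - z) = (\<Sum>p\<in>verts T. lam T p z * (grad \<phi> x \<bullet> (x - p)))" for x
      using affine_lam_repr[OF T, of "- grad \<phi> x" z "grad \<phi> x \<bullet> x"] by (simp add: inner_diff_right)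
    then have "(LINT x|lebesgue_on T. grad \<phi> x \<bullet> (x - z)) = (\<Sum>p\<in>verts T. lam T p z * (LINT x|lebesgue_on T. grad \<phi> x \<bullet> (x - p)))"
      using cont by (simp add: Bochner_Integration.integral_sum continuous_intros)
    also have "\<dots> = (\<Sum>p\<in>verts T. lam T p z) * (- real CARD('n) * I)"
      using vertex by (simp add: sum_distrib_right sum_negf)
    finally show ?thesis by (simp add: lam_sum[OF T])
  qed
  have i: "integrable (lebesgue_on T) (\<lambda>x. grad \<phi> x \<bullet> (x - z))" for z by (intro cont continuous_intros)
  have const: "(LINT x|lebesgue_on T. grad \<phi> x \<bullet> a) = 0"
  proof -
    have "(LINT x|lebesgue_on T. grad \<phi> x \<bullet> a) = (LINT x|lebesgue_on T. grad \<phi> x \<bullet> (x - 0) - grad \<phi> x \<bullet> (x - a))"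
      by (simp add: inner_diff_right)
    also have "\<dots> = 0" using i[of 0] i[of a] point[of 0] point[of a]
      by (subst Bochner_Integration.integral_diff) simp_all
    finally show ?thesis .
  qed
  have "(LINT x|lebesgue_on T. (a + b *\<^sub>R x) \<bullet> grad \<phi> x) = (LINT x|lebesgue_on T. grad \<phi> x \<bullet> a + b * (grad \<phi> x \<bullet> (x - 0)))"
  proof (intro Bochner_Integration.integral_cong refl)
    show "(a + b *\<^sub>R x) \<bullet> grad \<phi> x = grad \<phi> x \<bullet> a + b * (grad \<phi> x \<bullet> (x - 0))" for x
      unfolding inner_commute[of _ "grad \<phi> x"] by (simp add: inner_add_right)
  qed
  also have "\<dots> = b * (- real CARD('n) * I)"
    using i[of 0] cont[of "\<lambda>_. a"] const point[of 0] by (subst Bochner_Integration.integral_add) simp_all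
  finally show ?thesis by (simp add: I_def)
qed


section \<open>Almost-everywhere identities on the mesh\<close>

lemma complete_restrict_completion:
  assumes "S \<in> sets (completion M)"
  shows "complete_measure (restrict_space (completion M) S)"
proof
  fix A B assume BA: "B \<subseteq> A" and "A \<in> null_sets (restrict_space (completion M) S)"
  then have A: "A \<subseteq> S" "A \<in> null_sets (completion M)" using null_sets_restrict_space[OF assms] by auto
  then have "B \<in> sets (completion M)" "B \<subseteq> S" using BA completion.complete by blast+
  then show "B \<in> sets (restrict_space (completion M) S)"
    using assms by (subst sets_restrict_space_iff) (auto dest: sets.sets_into_space)
qed

lemma AE_eq_measurable:
  fixes f g :: "'a \<Rightarrow> 'b::topological_space"
  assumes M: "complete_measure M" and f: "f \<in> borel_measurable M" and eq: "AE x in M. g x = f x"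
  shows "g \<in> borel_measurable M"
proof (rule measurableI)
  interpret complete_measure M by fact
  obtain N where N: "N \<in> null_sets M" "{x\<in>space M. g x \<noteq> f x} \<subseteq> N"
    using eq by (auto elim!: AE_E intro: null_setsI)
  fix A :: "'b set" assume A: "A \<in> sets borel"
  have "g -` A \<inter> space M = ((f -` A \<inter> space M) - N) \<union> (g -` A \<inter> space M \<inter> N)" using N(2) by auto
  moreover have "g -` A \<inter> space M \<inter> N \<in> sets M" using complete[of "g -` A \<inter> space M \<inter> N" N] N(1) by auto
  moreover have "(f -` A \<inter> space M) - N \<in> sets M" using measurable_sets[OF f A] N(1) by auto
  ultimately show "g -` A \<inter> space M \<in> sets M" by (metis sets.Un)
qed simp

lemma AE_eq_integrable:
  fixes f g :: "'a \<Rightarrow> 'b::euclidean_space"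
  assumes M: "complete_measure M" and f: "integrable M f" and eq: "AE x in M. g x = f x"
  shows "integrable M g" "(LINT x|M. g x) = (LINT x|M. f x)"
proof -
  have m: "g \<in> borel_measurable M" by (rule AE_eq_measurable[OF M _ eq]) (use f in simp)
  show "integrable M g" using integrable_cong_AE[OF m _ eq] f by simp
  show "(LINT x|M. g x) = (LINT x|M. f x)" by (rule integral_cong_AE[OF m _ eq]) (use f in simp)
qed

lemma affine_eq_on_open:
  fixes f g :: "real^'n \<Rightarrow> 'b::euclidean_space"
  assumes U: "open U" "U \<noteq> {}" "U \<in> sets lebesgue" and ae: "AE x in lebesgue_on U. f x = g x"
    and cont: "continuous_on UNIV f" "continuous_on UNIV g"
  shows "\<forall>x\<in>U. f x = g x"
proof (rule ccontr)
  assume "\<not> ?thesis"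
  then have "U \<inter> {x. f x \<noteq> g x} \<noteq> {}" by blast
  moreover have "open (U \<inter> {x. f x \<noteq> g x})" using U(1) cont by (intro open_Int open_Collect_neq) auto
  moreover have "negligible (U \<inter> {x. f x \<noteq> g x})"
  proof -
    have "AE x in lebesgue. x \<in> U \<longrightarrow> f x = g x" using ae U(3) by (subst (asm) AE_restrict_space_iff) auto
    then obtain N where N: "N \<in> null_sets lebesgue" "{x \<in> space lebesgue. \<not> (x \<in> U \<longrightarrow> f x = g x)} \<subseteq> N"
      unfolding eventually_ae_filter by blast
    have "U \<inter> {x. f x \<noteq> g x} \<subseteq> N" using N(2) by auto
    with N(1) show ?thesis using negligible_subset[of N] unfolding negligible_iff_null_sets by blast
  qed
  ultimately show False using open_not_negligible by blast
qed

context mesh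
begin

lemma element_lmeasurable: "T \<in> \<T> \<Longrightarrow> T \<in> sets lebesgue"
  using lmeasurable_compact[OF compact_full_simplex[OF simplex]] by (simp add: fmeasurableD)

lemma complete_lebesgue_on: "T \<in> \<T> \<Longrightarrow> complete_measure (lebesgue_on T)"
  by (rule complete_restrict_completion) (rule element_lmeasurable)

lemma dom_measurable: "\<Omega> \<in> sets lebesgue" using open_dom by (simp add: borel_open)

lemma AE_generic: "AE x in lebesgue. \<forall>T\<in>\<T>. x \<notin> frontier T"
proof -
  have "AE x in lebesgue. x \<notin> frontier T" if "T \<in> \<T>" for T
    using negligible_convex_frontier[OF convex_full_simplex[OF simplex[OF that]]]
    by (intro AE_not_in) (simp add: negligible_iff_null_sets)
  then show ?thesis using finite_mesh by (simp add: AE_finite_all)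
qed

lemma closed_element: "T \<in> \<T> \<Longrightarrow> closed T"
  using compact_full_simplex[OF simplex] compact_imp_closed by blast

lemma generic_cases:
  assumes "\<forall>T\<in>\<T>. x \<notin> frontier T"
  shows "T \<in> \<T> \<Longrightarrow> x \<in> T \<Longrightarrow> x \<in> interior T \<and> x \<in> \<Omega> \<and> elem_at \<T> x = T \<and> (\<forall>T'\<in>\<T>. x \<in> T' \<longrightarrow> T' = T)"
    and "x \<in> \<Omega> \<Longrightarrow> \<exists>T\<in>\<T>. x \<in> T"
proof -
  have *: "x \<in> interior T" if "T \<in> \<T>" "x \<in> T" for T
    using assms that closed_element[OF that(1)] by (auto simp: frontier_def)
  show "T \<in> \<T> \<Longrightarrow> x \<in> T \<Longrightarrow> x \<in> interior T \<and> x \<in> \<Omega> \<and> elem_at \<T> x = T \<and> (\<forall>T'\<in>\<T>. x \<in> T' \<longrightarrow> T' = T)"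
    using * elem_at_interior interior_element by blast
  show "x \<in> \<Omega> \<Longrightarrow> \<exists>T\<in>\<T>. x \<in> T" using Union_mesh closure_subset by blast
qed

lemma AE_element_iff: "T \<in> \<T> \<Longrightarrow> (AE x in lebesgue_on T. P x) \<longleftrightarrow> (AE x in lebesgue. x \<in> T \<longrightarrow> P x)"
  using element_lmeasurable by (subst AE_restrict_space_iff) auto

lemma AE_dom_iff: "(AE x in lebesgue_on \<Omega>. P x) \<longleftrightarrow> (\<forall>T\<in>\<T>. AE x in lebesgue_on T. P x)"
proof -
  have "(AE x in lebesgue_on \<Omega>. P x) \<longleftrightarrow> (AE x in lebesgue. x \<in> \<Omega> \<longrightarrow> P x)"
    using dom_measurable by (subst AE_restrict_space_iff) auto
  also have "\<dots> \<longleftrightarrow> (AE x in lebesgue. \<forall>T\<in>\<T>. x \<in> T \<longrightarrow> P x)"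
  proof
    assume "AE x in lebesgue. x \<in> \<Omega> \<longrightarrow> P x"
    with AE_generic show "AE x in lebesgue. \<forall>T\<in>\<T>. x \<in> T \<longrightarrow> P x"
      by eventually_elim (use generic_cases(1) in blast)
  next
    assume "AE x in lebesgue. \<forall>T\<in>\<T>. x \<in> T \<longrightarrow> P x"
    with AE_generic show "AE x in lebesgue. x \<in> \<Omega> \<longrightarrow> P x"
      by eventually_elim (use generic_cases(2) in blast)
  qed
  also have "\<dots> \<longleftrightarrow> (\<forall>T\<in>\<T>. AE x in lebesgue. x \<in> T \<longrightarrow> P x)" by (rule AE_finite_all[OF finite_mesh])
  finally show ?thesis using AE_element_iff by simp
qed

lemma AE_elem_at: "T \<in> \<T> \<Longrightarrow> AE x in lebesgue_on T. elem_at \<T> x = T \<and> x \<in> interior T"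
  unfolding AE_element_iff using AE_generic by eventually_elim (use generic_cases(1) in blast)

lemma lint_dom:
  fixes g :: "real^'n \<Rightarrow> 'b::euclidean_space"
  assumes i: "\<And>T. T \<in> \<T> \<Longrightarrow> integrable (lebesgue_on T) g"
  shows "integrable (lebesgue_on \<Omega>) g" "(LINT x|lebesgue_on \<Omega>. g x) = (\<Sum>T\<in>\<T>. LINT x|lebesgue_on T. g x)"
proof -
  have iT: "integrable lebesgue (\<lambda>x. indicator T x *\<^sub>R g x)" if "T \<in> \<T>" for T
    using i[OF that] element_lmeasurable[OF that] by (simp add: integrable_restrict_space)
  have ae: "AE x in lebesgue. indicator \<Omega> x *\<^sub>R g x = (\<Sum>T\<in>\<T>. indicator T x *\<^sub>R g x)"
    using AE_generic
  proof eventually_elim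
    case (elim x)
    show ?case
    proof (cases "x \<in> \<Omega>")
      case True
      then obtain T where T: "T \<in> \<T>" "x \<in> T" using generic_cases(2)[OF elim] by blast
      have only: "x \<notin> T'" if "T' \<in> \<T>" "T' \<noteq> T" for T'
        using generic_cases(1)[OF elim T] that by blast
      have "(\<Sum>T'\<in>\<T>. indicator T' x *\<^sub>R g x) = (\<Sum>T'\<in>\<T>. if T' = T then g x else 0)"
        by (intro sum.cong refl) (simp add: T(2) only)
      then show ?thesis using True T finite_mesh by simp
    next
      case False
      then have "x \<notin> T" if "T \<in> \<T>" for T using generic_cases(1)[OF elim that] by blast
      then show ?thesis using False by simp
    qed
  qed
  have cm: "complete_measure (completion lborel :: (real^'n) measure)" by unfold_locales
  have i2: "integrable lebesgue (\<lambda>x. \<Sum>T\<in>\<T>. indicator T x *\<^sub>R g x)" using iT by (intro Bochner_Integration.integrable_sum)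
  note A = AE_eq_integrable[OF cm i2 ae]
  show "integrable (lebesgue_on \<Omega>) g" using A(1) dom_measurable by (simp add: integrable_restrict_space)
  have "(LINT x|lebesgue_on \<Omega>. g x) = (\<Sum>T\<in>\<T>. LINT x|lebesgue. indicator T x *\<^sub>R g x)"
    using A(2) dom_measurable iT by (simp add: integral_restrict_space)
  also have "\<dots> = (\<Sum>T\<in>\<T>. LINT x|lebesgue_on T. g x)"
    using element_lmeasurable by (intro sum.cong) (auto simp: integral_restrict_space)
  finally show "(LINT x|lebesgue_on \<Omega>. g x) = (\<Sum>T\<in>\<T>. LINT x|lebesgue_on T. g x)" .
qed

lemma lint_element:
  fixes g h :: "real^'n \<Rightarrow> 'b::euclidean_space"
  assumes T: "T \<in> \<T>" and ae: "AE x in lebesgue_on T. g x = h x" and h: "continuous_on UNIV h"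
  shows "integrable (lebesgue_on T) g" "(LINT x|lebesgue_on T. g x) = (LINT x|lebesgue_on T. h x)"
  using AE_eq_integrable[OF complete_lebesgue_on[OF T] lint_compact(1)[OF compact_full_simplex[OF simplex[OF T]] h] ae]
  by auto

lemma lint_piecewise:
  fixes g :: "real^'n \<Rightarrow> 'b::euclidean_space"
  assumes ae: "\<And>T. T \<in> \<T> \<Longrightarrow> AE x in lebesgue_on T. g x = h T x" and h: "\<And>T. T \<in> \<T> \<Longrightarrow> continuous_on UNIV (h T)"
  shows "integrable (lebesgue_on \<Omega>) g" "(LINT x|lebesgue_on \<Omega>. g x) = (\<Sum>T\<in>\<T>. LINT x|lebesgue_on T. h T x)"
proof -
  note * = lint_element[OF _ ae h]
  show "integrable (lebesgue_on \<Omega>) g" by (rule lint_dom(1)) (use * in blast)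
  show "(LINT x|lebesgue_on \<Omega>. g x) = (\<Sum>T\<in>\<T>. LINT x|lebesgue_on T. h T x)"
    using * by (subst lint_dom(2)) (auto intro!: sum.cong)
qed

lemma piecewise_L2:
  fixes g :: "real^'n \<Rightarrow> 'b::euclidean_space"
  assumes ae: "\<And>T. T \<in> \<T> \<Longrightarrow> AE x in lebesgue_on T. g x = h T x" and h: "\<And>T. T \<in> \<T> \<Longrightarrow> continuous_on UNIV (h T)"
  shows "g \<in> L2 (lebesgue_on \<Omega>)"
proof -
  have "integrable (lebesgue_on \<Omega>) g" by (rule lint_piecewise(1)[of g h]) (fact ae h)+
  moreover have "integrable (lebesgue_on \<Omega>) (\<lambda>x. (norm (g x))\<^sup>2)"
  proof (rule lint_piecewise(1)[of _ "\<lambda>T x. (norm (h T x))\<^sup>2"])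
    show "AE x in lebesgue_on T. (norm (g x))\<^sup>2 = (norm (h T x))\<^sup>2" if "T \<in> \<T>" for T
      using ae[OF that] by eventually_elim simp
    show "continuous_on UNIV (\<lambda>x. (norm (h T x))\<^sup>2)" if "T \<in> \<T>" for T
      using h[OF that] by (intro continuous_intros)
  qed
  ultimately show ?thesis by (simp add: L2_def)
qed

section \<open>Piecewise Raviart--Thomas fields\<close>

definition rt_rep :: "(real^'n \<Rightarrow> real^'n) \<Rightarrow> ((real^'n) set \<Rightarrow> real^'n) \<Rightarrow> ((real^'n) set \<Rightarrow> real) \<Rightarrow> bool" where
  "rt_rep v a b \<longleftrightarrow> (\<forall>T\<in>\<T>. AE x in lebesgue_on T. v x = a T + b T *\<^sub>R x)"

definition rt_field :: "((real^'n) set \<Rightarrow> real^'n) \<Rightarrow> ((real^'n) set \<Rightarrow> real) \<Rightarrow> real^'n \<Rightarrow> real^'n" where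
  "rt_field a b x = a (elem_at \<T> x) + b (elem_at \<T> x) *\<^sub>R x"

lemma rt_rep_field: "rt_rep (rt_field a b) a b"
  unfolding rt_rep_def
proof
  fix T assume "T \<in> \<T>"
  from AE_elem_at[OF this] show "AE x in lebesgue_on T. rt_field a b x = a T + b T *\<^sub>R x"
    by eventually_elim (simp add: rt_field_def)
qed

lemma RT0_rep:
  assumes "v \<in> RT0 \<Omega> \<T>"
  obtains a b where "rt_rep v a b"
proof -
  have "\<forall>T\<in>\<T>. \<exists>ab. AE x in lebesgue_on T. v x = fst ab + snd ab *\<^sub>R x"
  proof
    fix T assume "T \<in> \<T>"
    then obtain w where w: "w \<in> RT_local" "AE x in lebesgue_on T. v x = w x" using assms by (auto simp: RT0_def)
    then obtain a b where "w = (\<lambda>x. a + b *\<^sub>R x)" by (auto simp: RT_local_def)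
    then show "\<exists>ab. AE x in lebesgue_on T. v x = fst ab + snd ab *\<^sub>R x" using w(2) by (intro exI[of _ "(a, b)"]) simp
  qed
  from bchoice[OF this] obtain F where "\<forall>T\<in>\<T>. AE x in lebesgue_on T. v x = fst (F T) + snd (F T) *\<^sub>R x" ..
  then have "rt_rep v (\<lambda>T. fst (F T)) (\<lambda>T. snd (F T))" by (simp add: rt_rep_def)
  then show thesis by (rule that)
qed

lemma AE_interior_eq:
  fixes f g :: "real^'n \<Rightarrow> 'b::euclidean_space"
  assumes T: "T \<in> \<T>" and ae: "AE x in lebesgue_on T. f x = g x"
    and cont: "continuous_on UNIV f" "continuous_on UNIV g"
  shows "\<forall>x\<in>interior T. f x = g x"
proof (rule affine_eq_on_open[OF _ _ _ _ cont])
  show "AE x in lebesgue_on (interior T). f x = g x"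
    using ae unfolding AE_element_iff[OF T]
    by (subst AE_restrict_space_iff) (auto simp: borel_open elim!: eventually_mono dest: interior_subset[THEN subsetD])
qed (use interior_full_simplex_nonempty[OF simplex[OF T]] in \<open>auto simp: borel_open\<close>)

lemma affine_functions_eq:
  fixes a a' :: "real^'n"
  assumes U: "open U" "U \<noteq> {}" and eq: "\<forall>x\<in>U. a + b *\<^sub>R x = a' + b' *\<^sub>R x"
  shows "a = a'" "b = b'"
proof -
  obtain z where "z \<in> U" using U by blast
  then obtain e where e: "0 < e" "ball z e \<subseteq> U" using U(1) by (meson openE)
  define k :: "real^'n" where "k = (SOME k. k \<in> Basis)"
  have k: "norm k = 1" unfolding k_def using someI_ex[of "\<lambda>k::real^'n. k \<in> Basis"] nonempty_Basis by (auto intro: norm_Basis)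
  have "z + (e / 2) *\<^sub>R k \<in> U" using e k by (auto simp: dist_norm intro!: subsetD[OF e(2)])
  then have 2: "a + b *\<^sub>R (z + (e / 2) *\<^sub>R k) = a' + b' *\<^sub>R (z + (e / 2) *\<^sub>R k)" "a + b *\<^sub>R z = a' + b' *\<^sub>R z"
    using eq \<open>z \<in> U\<close> by auto
  have "(b * (e / 2)) *\<^sub>R k = (a + b *\<^sub>R (z + (e / 2) *\<^sub>R k)) - (a + b *\<^sub>R z)" by (simp add: scaleR_add_right)
  also have "\<dots> = (b' * (e / 2)) *\<^sub>R k" unfolding 2 by (simp add: scaleR_add_right)
  finally have "(b * (e / 2)) *\<^sub>R k = (b' * (e / 2)) *\<^sub>R k" .
  then show "b = b'" using e(1) k by auto
  then show "a = a'" using eq \<open>z \<in> U\<close> by auto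
qed

lemma local_poly_RT:
  assumes T: "T \<in> \<T>" and ae: "AE x in lebesgue_on T. v x = a + b *\<^sub>R x"
  shows "local_poly RT_local v T = (\<lambda>x. a + b *\<^sub>R x)"
  unfolding local_poly_def
proof (rule the_equality)
  show "(\<lambda>x. a + b *\<^sub>R x) \<in> RT_local \<and> (AE x in lebesgue_on T. v x = a + b *\<^sub>R x)"
    using ae by (auto simp: RT_local_def)
next
  fix w assume w: "w \<in> RT_local \<and> (AE x in lebesgue_on T. v x = w x)"
  then obtain a' b' where w': "w = (\<lambda>x. a' + b' *\<^sub>R x)" by (auto simp: RT_local_def)
  have "AE x in lebesgue_on T. a' + b' *\<^sub>R x = a + b *\<^sub>R x"
    using ae w unfolding w' by (auto elim: eventually_elim2)
  then have "\<forall>x\<in>interior T. a' + b' *\<^sub>R x = a + b *\<^sub>R x"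
    by (rule AE_interior_eq[OF T]) (intro continuous_intros)+
  from affine_functions_eq[OF open_interior interior_full_simplex_nonempty[OF simplex[OF T]] this]
  show "w = (\<lambda>x. a + b *\<^sub>R x)" by (simp add: w')
qed

lemma test_function_props:
  assumes "\<phi> \<in> test_functions \<Omega>"
  shows "smooth \<phi>" "\<exists>L. L-lipschitz_on UNIV \<phi>" "\<And>x. x \<notin> \<Omega> \<Longrightarrow> \<phi> x = 0" "continuous_on UNIV \<phi>" "continuous_on UNIV (grad \<phi>)"
proof -
  obtain C where C: "smooth \<phi>" "compact C" "C \<subseteq> \<Omega>" "\<And>x. x \<notin> C \<Longrightarrow> \<phi> x = 0" using assms by (auto simp: test_functions_def)
  show "smooth \<phi>" by fact
  show L: "\<exists>L. L-lipschitz_on UNIV \<phi>" by (rule smooth_compact_support_lipschitz[OF C(1,2,4)])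
  show "continuous_on UNIV \<phi>" using L lipschitz_on_continuous_on by blast
  show "continuous_on UNIV (grad \<phi>)" by (rule smooth_grad(2)[OF C(1)])
  show "\<And>x. x \<notin> \<Omega> \<Longrightarrow> \<phi> x = 0" using C by blast
qed

lemma has_weak_div_rep:
  assumes v: "rt_rep v a b" and w: "\<And>T. T \<in> \<T> \<Longrightarrow> AE x in lebesgue_on T. w x = c T"
  shows "has_weak_div \<Omega> v w \<longleftrightarrow> (\<forall>\<phi>\<in>test_functions \<Omega>.
    (\<Sum>T\<in>\<T>. LINT x|lebesgue_on T. (a T + b T *\<^sub>R x) \<bullet> grad \<phi> x) = - (\<Sum>T\<in>\<T>. c T * (LINT x|lebesgue_on T. \<phi> x)))"
proof -
  have vae: "AE x in lebesgue_on T. v x = a T + b T *\<^sub>R x" if "T \<in> \<T>" for T using v that by (simp add: rt_rep_def)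
  have "v \<in> L2 (lebesgue_on \<Omega>)" by (rule piecewise_L2[OF vae]) (auto intro!: continuous_intros)
  moreover have "w \<in> L2 (lebesgue_on \<Omega>)" by (rule piecewise_L2[OF w]) (auto intro!: continuous_intros)
  moreover have "(LINT x|lebesgue_on \<Omega>. v x \<bullet> grad \<phi> x) = (\<Sum>T\<in>\<T>. LINT x|lebesgue_on T. (a T + b T *\<^sub>R x) \<bullet> grad \<phi> x)"
    if "\<phi> \<in> test_functions \<Omega>" for \<phi>
  proof (rule lint_piecewise(2))
    show "AE x in lebesgue_on T. v x \<bullet> grad \<phi> x = (a T + b T *\<^sub>R x) \<bullet> grad \<phi> x" if "T \<in> \<T>" for T
      using vae[OF that] by eventually_elim simp
  qed (use test_function_props(5)[OF that] in \<open>intro continuous_intros\<close>)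
  moreover have "(LINT x|lebesgue_on \<Omega>. w x * \<phi> x) = (\<Sum>T\<in>\<T>. c T * (LINT x|lebesgue_on T. \<phi> x))"
    if "\<phi> \<in> test_functions \<Omega>" for \<phi>
  proof -
    have "(LINT x|lebesgue_on \<Omega>. w x * \<phi> x) = (\<Sum>T\<in>\<T>. LINT x|lebesgue_on T. c T * \<phi> x)"
    proof (rule lint_piecewise(2))
      show "AE x in lebesgue_on T. w x * \<phi> x = c T * \<phi> x" if "T \<in> \<T>" for T
        using w[OF that] by eventually_elim simp
    qed (use test_function_props(4)[OF that] in \<open>intro continuous_intros\<close>)
    then show ?thesis by simp
  qed
  ultimately show ?thesis unfolding has_weak_div_def by simp
qed

text \<open>The test function is a bump inside one element, where the field is smooth with divergence
  \<open>d * b T\<close>.\<close>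

lemma weak_div_coefficient:
  assumes v: "rt_rep v a b" and w: "\<And>T. T \<in> \<T> \<Longrightarrow> AE x in lebesgue_on T. w x = c T"
    and div: "has_weak_div \<Omega> v w" and T: "T \<in> \<T>"
  shows "c T = real CARD('n) * b T"
proof -
  obtain z where "z \<in> interior T" using interior_full_simplex_nonempty[OF simplex[OF T]] by blast
  then obtain r where r: "0 < r" "cball z r \<subseteq> interior T" using open_interior open_contains_cball by blast
  obtain \<phi> where \<phi>: "smooth \<phi>" "\<And>x. x \<in> ball z r \<Longrightarrow> 0 < \<phi> x" "\<And>x. x \<notin> ball z r \<Longrightarrow> \<phi> x = 0"
    using smooth_bump[OF r(1)] by blast
  have supp: "\<phi> x = 0" if "x \<notin> cball z r" for x using that by (intro \<phi>(3)) auto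
  have test: "\<phi> \<in> test_functions \<Omega>"
    using \<phi>(1) supp r(2) interior_element[OF T] unfolding test_functions_def by (auto intro!: exI[of _ "cball z r"])
  obtain L where L: "L-lipschitz_on UNIV \<phi>" using test_function_props(2)[OF test] by blast
  have zero: "\<phi> x = 0" if "x \<notin> interior T" for x using supp r(2) that by blast
  have g0: "grad \<phi> x = 0" if "x \<notin> cball z r" for x
  proof -
    have "((\<lambda>_. 0) has_derivative (\<lambda>h. 0)) (at x)" by simp
    then have "(\<phi> has_derivative (\<lambda>h. 0)) (at x)"
      by (rule has_derivative_transform_within_open[where s = "- cball z r"]) (use that supp in auto)
    then have "grad \<phi> x \<bullet> grad \<phi> x = 0" by (rule grad_eqI(2))
    then show ?thesis by simp
  qed
  have off: "x \<notin> cball z r" if T': "T' \<in> \<T>" "T' \<noteq> T" "x \<in> T'" for T' x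
  proof
    assume "x \<in> cball z r"
    then have xi: "x \<in> interior T" using r(2) by blast
    obtain p where p: "p \<in> verts T" "\<And>x. x \<in> T \<inter> T' \<Longrightarrow> lam T p x = 0"
      by (rule Int_subset_zero[OF T T'(1) T'(2)[symmetric]]) (rule that)
    have "lam T p x = 0" using p(2) xi T'(3) interior_subset by blast
    moreover have "0 < lam T p x" using xi p(1) interior_simplex[OF simplex[OF T]] by blast
    ultimately show False by simp
  qed
  have 1: "(LINT x|lebesgue_on T'. (a T' + b T' *\<^sub>R x) \<bullet> grad \<phi> x) = 0" "(LINT x|lebesgue_on T'. \<phi> x) = 0"
    if "T' \<in> \<T>" "T' \<noteq> T" for T'
  proof -
    have "(LINT x|lebesgue_on T'. (a T' + b T' *\<^sub>R x) \<bullet> grad \<phi> x) = (LINT x|lebesgue_on T'. 0)"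
      by (intro Bochner_Integration.integral_cong) (use off[OF that] g0 in \<open>auto simp: space_restrict_space\<close>)
    then show "(LINT x|lebesgue_on T'. (a T' + b T' *\<^sub>R x) \<bullet> grad \<phi> x) = 0" by simp
    have "(LINT x|lebesgue_on T'. \<phi> x) = (LINT x|lebesgue_on T'. 0)"
      by (intro Bochner_Integration.integral_cong) (use off[OF that] supp in \<open>auto simp: space_restrict_space\<close>)
    then show "(LINT x|lebesgue_on T'. \<phi> x) = 0" by simp
  qed
  define I where "I = (LINT x|lebesgue_on T. \<phi> x)"
  have "(\<Sum>T'\<in>\<T>. LINT x|lebesgue_on T'. (a T' + b T' *\<^sub>R x) \<bullet> grad \<phi> x) = - (\<Sum>T'\<in>\<T>. c T' * (LINT x|lebesgue_on T'. \<phi> x))"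
    using div test has_weak_div_rep[OF v w] by blast
  then have "(LINT x|lebesgue_on T. (a T + b T *\<^sub>R x) \<bullet> grad \<phi> x) = - (c T * I)"
    using 1 by (simp add: sum.remove[OF finite_mesh T] I_def)
  moreover have "(LINT x|lebesgue_on T. (a T + b T *\<^sub>R x) \<bullet> grad \<phi> x) = - (real CARD('n) * b T) * I"
    unfolding I_def by (rule lint_affine_field_interior[OF simplex[OF T] \<phi>(1) L zero])
  ultimately have "- (c T * I) = - (real CARD('n) * b T) * I" by (rule trans[OF sym])
  then have *: "c T * I = real CARD('n) * b T * I" by simp
  have "I \<noteq> 0"
  proof
    assume "I = 0"
    have "integrable (lebesgue_on T) \<phi>"
      by (rule lint_compact(1)[OF compact_full_simplex[OF simplex[OF T]] test_function_props(4)[OF test]])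
    moreover have "0 \<le> \<phi> x" for x using \<phi>(2,3)[of x] by (cases "x \<in> ball z r") auto
    ultimately have "AE x in lebesgue_on T. \<phi> x = 0"
      using integral_nonneg_eq_0_iff_AE[of "lebesgue_on T" \<phi>] \<open>I = 0\<close> by (simp add: I_def)
    then have "\<forall>x\<in>interior T. \<phi> x = 0"
      by (rule AE_interior_eq[OF T]) (use test_function_props(4)[OF test] in auto)
    then have "\<phi> z = 0" using \<open>z \<in> interior T\<close> by blast
    then show False using \<phi>(2)[of z] r(1) by simp
  qed
  then show ?thesis using * by simp
qed

end


section \<open>Boundary fluxes\<close>

text \<open>The value of \<open>x \<bullet> n\<close> on the facet opposite \<open>p\<close>, where \<open>n = - inner_normal T p\<close>.\<close>

definition facet_offset :: "(real^'n) set \<Rightarrow> real^'n \<Rightarrow> real" where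
  "facet_offset T p = snd (bcoeff T p) / norm (bgrad T p)"

definition bflux :: "((real^'n) set \<Rightarrow> real^'n) \<Rightarrow> ((real^'n) set \<Rightarrow> real) \<Rightarrow> (real^'n) set \<Rightarrow> real^'n \<Rightarrow> real" where
  "bflux a b T p = a T \<bullet> (- inner_normal T p) + b T * facet_offset T p"

lemma inner_normal_fac:
  assumes "full_simplex T" "p \<in> verts T" "x \<in> fac T p"
  shows "x \<bullet> (- inner_normal T p) = facet_offset T p"
  using subsetD[OF fac_hyperplane[OF assms(1,2)] assms(3)]
  by (simp add: facet_offset_def inner_commute)

context mesh
begin

lemma skel_null: "skel \<in> null_sets borel_surface_measure"
proof -
  let ?S = "\<lambda>T p q. {x. bgrad T p \<bullet> x = - snd (bcoeff T p) \<and> bgrad T q \<bullet> x = - snd (bcoeff T q)}"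
  let ?J = "\<lambda>T p. {q \<in> verts T. p \<noteq> q}"
  have "skel = (\<Union>T\<in>\<T>. \<Union>p\<in>verts T. \<Union>q\<in>?J T p. ?S T p q)"
    unfolding skel_def lam_def by (auto simp: eq_neg_iff_add_eq_0)
  moreover have "?S T p q \<in> null_sets borel_surface_measure" if "T \<in> \<T>" "p \<in> verts T" "q \<in> ?J T p" for T p q
    by (rule surface_null_codim_two) (use bgrad_independent[OF simplex[OF that(1)] dim2 that(2)] that(3) in blast)
  moreover have "finite (verts T)" "finite (?J T p)" if "T \<in> \<T>" for T p using full_simplex_verts(1)[OF simplex[OF that]] by auto
  ultimately show ?thesis using finite_mesh by (auto intro!: null_sets.finite_UN)
qed

lemma AE_not_skel: "AE x in surface_measure. x \<notin> skel"
  using skel_null by (intro AE_completion AE_not_in)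

lemma fac_measurable: "T \<in> \<T> \<Longrightarrow> fac T p \<in> sets surface_measure"
  using borel_compact[OF compact_fac[OF simplex]] by (auto intro: sets_completionI_sets)

lemma AE_fac:
  assumes T: "T \<in> \<T>" "p \<in> verts T"
  shows "AE x in surface_on (fac T p). x \<in> ofac T p"
proof -
  have "AE x in surface_measure. x \<in> fac T p \<longrightarrow> x \<in> ofac T p"
    using AE_not_skel
  proof eventually_elim
    case (elim x)
    show ?case
    proof
      assume x: "x \<in> fac T p"
      then have nn: "lam T p x = 0" "\<And>q. q \<in> verts T \<Longrightarrow> 0 \<le> lam T q x"
        using fac_eq[OF simplex[OF T(1)] T(2)] mem_simplex[OF simplex[OF T(1)]] by auto
      have "lam T q x \<noteq> 0" if "q \<in> verts T - {p}" for q using elim T nn(1) that unfolding skel_def by blast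
      then have "0 < lam T q x" if "q \<in> verts T - {p}" for q using nn(2)[of q] that by (simp add: less_le)
      then show "x \<in> ofac T p" using nn(1) by (simp add: ofac_def)
    qed
  qed
  then show ?thesis using fac_measurable[OF T(1)] by (subst AE_restrict_space_iff) auto
qed

lemma ofac_nonempty:
  assumes T: "T \<in> \<T>" "p \<in> verts T"
  shows "ofac T p \<noteq> {}"
proof -
  have n: "0 < real CARD('n)" by simp
  define u where "u q = (if q = p then 0 else 1 / real CARD('n))" for q
  note fv = full_simplex_verts[OF simplex[OF T(1)]]
  have "sum u (verts T) = (\<Sum>q\<in>verts T - {p}. 1 / real CARD('n))"
    using sum.remove[OF fv(1) T(2), of u] by (simp add: u_def)
  also have "\<dots> = 1" using fv T(2) by simp
  finally have u: "sum u (verts T) = 1" .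
  have "(\<Sum>q\<in>verts T. u q *\<^sub>R q) \<in> ofac T p"
    using lam_vertex_comb[OF simplex[OF T(1)] u] T(2) by (auto simp: ofac_def u_def)
  then show ?thesis by blast
qed

lemma fac_inj_boundary: "inj_on (\<lambda>(T, p). fac T p) bfacs"
proof (rule inj_onI, clarify)
  fix T p T' p' assume *: "(T, p) \<in> bfacs" "(T', p') \<in> bfacs" "fac T p = fac T' p'"
  then have T: "T \<in> \<T>" "p \<in> verts T" "T' \<in> \<T>" "p' \<in> verts T'" "fac T p \<subseteq> frontier \<Omega>" by (auto simp: bfacs_def)
  obtain x where x: "x \<in> ofac T p" using ofac_nonempty[OF T(1,2)] by blast
  then have xf: "x \<in> fac T p" using ofac_subset_fac[OF simplex[OF T(1)] T(2)] by blast
  then have "x \<in> T'" using *(3) fac_eq[OF simplex[OF T(3)] T(4)] by blast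
  then have "T' = T" using ofac_frontier_unique[OF T(1,2) x _ T(3)] xf T(5) by blast
  moreover from this have "p' = p" using fac_inj[OF simplex[OF T(1)]] T *(3) by metis
  ultimately show "T = T' \<and> p = p'" by simp
qed

lemma facets_on_eq: "facets_on \<Omega> \<T> \<Gamma> = (\<lambda>(T, p). fac T p) ` {(T, p) \<in> bfacs. fac T p \<subseteq> closure \<Gamma>}"
proof -
  have "facets \<T> = {fac T p | T p. T \<in> \<T> \<and> p \<in> verts T}"
    unfolding facets_def using facet_of_simplex[OF simplex] by blast
  then show ?thesis unfolding facets_on_def boundary_facets_def bfacs_def by auto
qed

lemma area_fac_pos: "T \<in> \<T> \<Longrightarrow> p \<in> verts T \<Longrightarrow> 0 < area (fac T p)"
  unfolding volume_height_area[OF simplex, symmetric]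
  using vol_full_simplex_pos[OF simplex] bgrad_nonzero[OF simplex] by simp

lemma AE_fac_const:
  assumes T: "T \<in> \<T>" "p \<in> verts T" and ae: "AE x in surface_on (fac T p). P"
  shows P
proof (rule ccontr)
  assume "\<not> P"
  with ae have "AE x in surface_measure. x \<notin> fac T p"
    using fac_measurable[OF T(1)] by (subst (asm) AE_restrict_space_iff) auto
  then have "emeasure surface_measure (fac T p) = 0"
    using fac_measurable[OF T(1)] AE_iff_measurable[of "fac T p" surface_measure "\<lambda>x. x \<notin> fac T p"] by (auto simp: space_completion)
  then have "area (fac T p) = 0" by (simp add: measure_def)
  then show False using area_fac_pos[OF T] by simp
qed

lemma outward_normal_ofac:
  assumes T: "(T, p) \<in> bfacs" and x: "x \<in> ofac T p"
  shows "outward_normal \<Omega> x = - inner_normal T p"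
proof -
  have T': "T \<in> \<T>" "p \<in> verts T" "fac T p \<subseteq> frontier \<Omega>" using T by (auto simp: bfacs_def)
  note sT = simplex[OF T'(1)]
  have xf: "x \<in> frontier \<Omega>" using ofac_subset_fac[OF sT T'(2)] x T'(3) by blast
  obtain e where e: "0 < e" "\<Omega> \<inter> ball x e = {y \<in> ball x e. 0 < lam T p y}"
    by (rule ofac_one_element[OF T'(1,2) x]) (use ofac_frontier_unique[OF T'(1,2) x xf] in blast, rule that)
  define n where "n = - inner_normal T p"
  have n1: "norm n = 1" using norm_inner_normal[OF sT T'(2)] by (simp add: n_def)
  have g: "0 < norm (bgrad T p)" using bgrad_nonzero[OF sT T'(2)] by simp
  have lam: "0 < lam T p y \<longleftrightarrow> (y - x) \<bullet> n < 0" for y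
  proof -
    have "lam T p y = bgrad T p \<bullet> (y - x)" using lam_diff[of T p y x] x by (simp add: ofac_def)
    moreover have "(y - x) \<bullet> n = - ((bgrad T p \<bullet> (y - x)) / norm (bgrad T p))"
      by (simp add: n_def inner_normal_def[OF sT T'(2)] inner_commute divide_inverse)
    ultimately show ?thesis using g by (simp add: zero_less_divide_iff)
  qed
  have half: "\<Omega> \<inter> ball x e = {y \<in> ball x e. (y - x) \<bullet> n < 0}" using e(2) lam by simp
  show ?thesis unfolding outward_normal_def n_def[symmetric]
  proof (rule the_equality)
    show "norm n = 1 \<and> (\<exists>\<epsilon>>0. \<Omega> \<inter> ball x \<epsilon> = {y \<in> ball x \<epsilon>. (y - x) \<bullet> n < 0})" using n1 e(1) half by blast
  next
    fix m assume "norm m = 1 \<and> (\<exists>\<epsilon>>0. \<Omega> \<inter> ball x \<epsilon> = {y \<in> ball x \<epsilon>. (y - x) \<bullet> m < 0})"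
    then obtain r where m: "norm m = 1" "0 < r" "\<Omega> \<inter> ball x r = {y \<in> ball x r. (y - x) \<bullet> m < 0}" by blast
    have small: "h \<bullet> n < 0 \<longleftrightarrow> h \<bullet> m < 0" if "norm h < min e r" for h
    proof -
      have b: "x + h \<in> ball x e" "x + h \<in> ball x r" using that by (auto simp: dist_norm)
      have "h \<bullet> n < 0 \<longleftrightarrow> x + h \<in> \<Omega> \<inter> ball x e" unfolding half using b(1) by simp
      also have "\<dots> \<longleftrightarrow> x + h \<in> \<Omega> \<inter> ball x r" using b by blast
      also have "\<dots> \<longleftrightarrow> h \<bullet> m < 0" unfolding m(3) using b(2) by simp
      finally show ?thesis .
    qed
    have 1: "n \<bullet> n = 1" "m \<bullet> m = 1" using n1 m(1) by (auto simp: dot_square_norm)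
    define t where "t = min e r / 4"
    have t: "0 < t" using e(1) m(2) by (simp add: t_def)
    \<comment> \<open>If two unit vectors differ, then their difference has a positive inner product with the one and a
      negative inner product with the other.\<close>
    define h where "h = t *\<^sub>R (m - n)"
    have "norm h \<le> t * 2" unfolding h_def using t norm_triangle_ineq4[of m n] n1 m(1) by simp
    also have "\<dots> < min e r"
    proof -
      have "0 < min e r" using e(1) m(2) by simp
      then show ?thesis unfolding t_def by linarith
    qed
    finally have s: "h \<bullet> n < 0 \<longleftrightarrow> h \<bullet> m < 0" by (rule small)
    have "h \<bullet> n = t * (m \<bullet> n - 1)" "h \<bullet> m = t * (1 - m \<bullet> n)"
      by (simp_all add: h_def inner_diff_left inner_diff_right 1 inner_commute)
    moreover have "m \<bullet> n \<le> 1" using norm_cauchy_schwarz[of m n] n1 m(1) by simp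
    ultimately have "m \<bullet> n = 1" using s t by (simp add: mult_less_0_iff)
    then have "(m - n) \<bullet> (m - n) = 0" by (simp add: inner_diff_left inner_diff_right 1 inner_commute)
    then show "m = n" by simp
  qed
qed

lemma normal_flux_ofac:
  assumes v: "rt_rep v a b" and T: "(T, p) \<in> bfacs" and x: "x \<in> ofac T p"
  shows "normal_flux \<Omega> \<T> v x = bflux a b T p"
proof -
  have T': "T \<in> \<T>" "p \<in> verts T" "fac T p \<subseteq> frontier \<Omega>" using T by (auto simp: bfacs_def)
  have xf: "x \<in> fac T p" using ofac_subset_fac[OF simplex[OF T'(1)] T'(2)] x by blast
  then have "elem_at \<T> x = T" using elem_at_ofac[OF T'(1,2) x] T'(3) by blast
  moreover have "local_poly RT_local v T = (\<lambda>x. a T + b T *\<^sub>R x)"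
    by (rule local_poly_RT[OF T'(1)]) (use v T'(1) in \<open>simp add: rt_rep_def\<close>)
  ultimately have "normal_flux \<Omega> \<T> v x = (a T + b T *\<^sub>R x) \<bullet> (- inner_normal T p)"
    unfolding normal_flux_def boundary_value_def outward_normal_ofac[OF T x] by simp
  also have "\<dots> = a T \<bullet> (- inner_normal T p) + b T * (x \<bullet> (- inner_normal T p))" by (simp add: inner_add_left)
  also have "\<dots> = bflux a b T p" unfolding inner_normal_fac[OF simplex[OF T'(1)] T'(2) xf] bflux_def ..
  finally show ?thesis .
qed

lemma AE_Pi_h:
  assumes "T \<in> \<T>"
  shows "AE x in lebesgue_on T. Pi_h \<T> g x = const_proj (lebesgue_on T) g"
  using AE_elem_at[OF assms] by eventually_elim (simp add: Pi_h_def)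

text \<open>The divergence is constant on each element and the normal flux on each boundary facet. So the
  constraints become linear equations and inequalities for the coefficients.\<close>

lemma K_star_rep:
  assumes v: "rt_rep v a b"
  shows "v \<in> K_star \<Omega> \<Gamma> \<T> f \<alpha> \<beta> \<longleftrightarrow>
    (\<forall>\<phi>\<in>test_functions \<Omega>. (\<Sum>T\<in>\<T>. LINT x|lebesgue_on T. (a T + b T *\<^sub>R x) \<bullet> grad \<phi> x)
        = - (\<Sum>T\<in>\<T>. const_proj (lebesgue_on T) f * (LINT x|lebesgue_on T. \<phi> x))) \<and>
    (\<forall>T p. (T, p) \<in> bfacs \<longrightarrow> fac T p \<subseteq> closure \<Gamma> \<longrightarrow>
        pi_h \<Gamma> \<alpha> (fac T p) \<le> bflux a b T p \<and> bflux a b T p \<le> pi_h \<Gamma> \<beta> (fac T p))"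
proof -
  have W: "has_weak_div \<Omega> v (Pi_h \<T> f) \<longleftrightarrow> (\<forall>\<phi>\<in>test_functions \<Omega>. (\<Sum>T\<in>\<T>. LINT x|lebesgue_on T. (a T + b T *\<^sub>R x) \<bullet> grad \<phi> x)
        = - (\<Sum>T\<in>\<T>. const_proj (lebesgue_on T) f * (LINT x|lebesgue_on T. \<phi> x)))"
    by (rule has_weak_div_rep[OF v AE_Pi_h])
  have F: "(AE x in surface_on (fac T p). pi_h \<Gamma> \<alpha> (fac T p) \<le> normal_flux \<Omega> \<T> v x \<and> normal_flux \<Omega> \<T> v x \<le> pi_h \<Gamma> \<beta> (fac T p))
    \<longleftrightarrow> pi_h \<Gamma> \<alpha> (fac T p) \<le> bflux a b T p \<and> bflux a b T p \<le> pi_h \<Gamma> \<beta> (fac T p)" (is "?L \<longleftrightarrow> ?R")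
    if "(T, p) \<in> bfacs" for T p
  proof -
    have T: "T \<in> \<T>" "p \<in> verts T" using that by (auto simp: bfacs_def)
    have ae: "AE x in surface_on (fac T p). normal_flux \<Omega> \<T> v x = bflux a b T p"
      using AE_fac[OF T] by eventually_elim (rule normal_flux_ofac[OF v that])
    show ?thesis
    proof
      assume ?L
      with ae have "AE x in surface_on (fac T p). ?R" by eventually_elim simp
      then show ?R by (rule AE_fac_const[OF T])
    next
      assume R: ?R
      from ae show ?L by eventually_elim (use R in simp)
    qed
  qed
  have "v \<in> RT0 \<Omega> \<T>" if "has_weak_div \<Omega> v (Pi_h \<T> f)"
  proof -
    have "\<exists>w\<in>RT_local. AE x in lebesgue_on T. v x = w x" if "T \<in> \<T>" for T
      using v that by (intro bexI[of _ "\<lambda>x. a T + b T *\<^sub>R x"]) (auto simp: rt_rep_def RT_local_def)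
    then show ?thesis using that by (auto simp: RT0_def Hdiv_def)
  qed
  moreover have "(\<forall>S \<in> facets_on \<Omega> \<T> \<Gamma>. AE x in surface_on S.
        pi_h \<Gamma> \<alpha> S \<le> normal_flux \<Omega> \<T> v x \<and> normal_flux \<Omega> \<T> v x \<le> pi_h \<Gamma> \<beta> S)
    \<longleftrightarrow> (\<forall>T p. (T, p) \<in> bfacs \<longrightarrow> fac T p \<subseteq> closure \<Gamma> \<longrightarrow>
        pi_h \<Gamma> \<alpha> (fac T p) \<le> bflux a b T p \<and> bflux a b T p \<le> pi_h \<Gamma> \<beta> (fac T p))"
    (is "?A \<longleftrightarrow> ?B")
  proof -
    have mem: "S \<in> facets_on \<Omega> \<T> \<Gamma> \<longleftrightarrow> (\<exists>T p. (T, p) \<in> bfacs \<and> fac T p \<subseteq> closure \<Gamma> \<and> S = fac T p)" for S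
      unfolding facets_on_eq by auto
    have "?A \<longleftrightarrow> (\<forall>T p. (T, p) \<in> bfacs \<longrightarrow> fac T p \<subseteq> closure \<Gamma> \<longrightarrow>
        (AE x in surface_on (fac T p). pi_h \<Gamma> \<alpha> (fac T p) \<le> normal_flux \<Omega> \<T> v x \<and> normal_flux \<Omega> \<T> v x \<le> pi_h \<Gamma> \<beta> (fac T p)))"
      unfolding Ball_def mem by blast
    then show ?thesis using F by blast
  qed
  ultimately show ?thesis unfolding K_star_def mem_Collect_eq using W by blast
qed

lemma K_star_coefficient:
  assumes "v \<in> K_star \<Omega> \<Gamma> \<T> f \<alpha> \<beta>" "rt_rep v a b" "T \<in> \<T>"
  shows "b T = const_proj (lebesgue_on T) f / real CARD('n)"
proof -
  have "has_weak_div \<Omega> v (Pi_h \<T> f)" using assms(1) by (simp add: K_star_def)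
  from weak_div_coefficient[OF assms(2) AE_Pi_h this assms(3)]
  show ?thesis by simp
qed

end


section \<open>The dual functional in terms of the coefficients\<close>

lemma const_proj_eq_mean:
  fixes g :: "'a \<Rightarrow> 'b::euclidean_space"
  assumes "finite_measure M" and m: "0 < measure M (space M)" and g: "integrable M g"
  shows "const_proj M g = (LINT x|M. g x) /\<^sub>R measure M (space M)"
proof -
  interpret finite_measure M by fact
  let ?m = "measure M (space M)"
  have I: "(LINT x|M. (g x - c) \<bullet> k) = ((LINT x|M. g x) - ?m *\<^sub>R c) \<bullet> k" for c k
    using g by (simp add: integral_inner_left)
  show ?thesis unfolding const_proj_def
  proof (rule the_equality)
    show "\<forall>k. (LINT x|M. (g x - (LINT x|M. g x) /\<^sub>R ?m) \<bullet> k) = 0" using m by (simp add: I)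
  next
    fix c assume "\<forall>k. (LINT x|M. (g x - c) \<bullet> k) = 0"
    then have "\<forall>k. ((LINT x|M. g x) - ?m *\<^sub>R c) \<bullet> k = 0" unfolding I .
    then have "(LINT x|M. g x) = ?m *\<^sub>R c" by (metis eq_iff_diff_eq_0 inner_eq_zero_iff)
    then show "c = (LINT x|M. g x) /\<^sub>R ?m" using m by simp
  qed
qed

context mesh
begin

lemma finite_lebesgue_on:
  assumes "T \<in> \<T>"
  shows "finite_measure (lebesgue_on T)" "measure (lebesgue_on T) (space (lebesgue_on T)) = vol T"
    and "measure (lebesgue_on T) T = vol T"
proof -
  have l: "T \<in> lmeasurable" using lmeasurable_compact[OF compact_full_simplex[OF simplex[OF assms]]] .
  show "finite_measure (lebesgue_on T)" using l by (rule finite_measure_lebesgue_on)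
  show "measure (lebesgue_on T) (space (lebesgue_on T)) = vol T"
    using element_lmeasurable[OF assms] by (simp add: space_restrict_space measure_restrict_space)
  then show "measure (lebesgue_on T) T = vol T" by (simp add: space_restrict_space)
qed

lemmas const_proj_element = const_proj_eq_mean[OF finite_lebesgue_on(1)]

definition centroid :: "(real^'n) set \<Rightarrow> real^'n" where
  "centroid T = (LINT x|lebesgue_on T. x) /\<^sub>R vol T"

lemma const_proj_rt:
  assumes v: "rt_rep v a b" and T: "T \<in> \<T>"
  shows "const_proj (lebesgue_on T) v = a T + b T *\<^sub>R centroid T"
proof -
  have V: "0 < vol T" by (rule vol_full_simplex_pos[OF simplex[OF T]])
  have ae: "AE x in lebesgue_on T. v x = a T + b T *\<^sub>R x" using v T by (simp add: rt_rep_def)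
  have c: "continuous_on UNIV (\<lambda>x. a T + b T *\<^sub>R x)" by (intro continuous_intros)
  note L = lint_element[OF T ae c]
  have i: "integrable (lebesgue_on T) (\<lambda>x. x)"
    by (rule lint_compact(1)[OF compact_full_simplex[OF simplex[OF T]] continuous_on_id])
  have "(LINT x|lebesgue_on T. a T + b T *\<^sub>R x) = vol T *\<^sub>R a T + b T *\<^sub>R (LINT x|lebesgue_on T. x)"
  proof -
    interpret finite_measure "lebesgue_on T" by (rule finite_lebesgue_on(1)[OF T])
    show ?thesis using i by (simp add: finite_lebesgue_on(3)[OF T])
  qed
  then have "const_proj (lebesgue_on T) v = (vol T *\<^sub>R a T + b T *\<^sub>R (LINT x|lebesgue_on T. x)) /\<^sub>R vol T"
    using const_proj_element[OF T _ L(1)] V L(2) by (simp add: finite_lebesgue_on(3)[OF T])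
  then show ?thesis using V by (simp add: centroid_def scaleR_add_right)
qed

lemma energy_rep:
  fixes K :: "real^'n \<Rightarrow> real^'n^'n"
  assumes v: "rt_rep v a b"
  shows "(LINT x|lebesgue_on \<Omega>. (norm (inv_sqrt (Pi_h \<T> K x) *v Pi_h \<T> v x))\<^sup>2)
    = (\<Sum>T\<in>\<T>. vol T * (norm (inv_sqrt (const_proj (lebesgue_on T) K) *v (a T + b T *\<^sub>R centroid T)))\<^sup>2)"
proof -
  let ?c = "\<lambda>T. (norm (inv_sqrt (const_proj (lebesgue_on T) K) *v (a T + b T *\<^sub>R centroid T)))\<^sup>2"
  have "(LINT x|lebesgue_on \<Omega>. (norm (inv_sqrt (Pi_h \<T> K x) *v Pi_h \<T> v x))\<^sup>2) = (\<Sum>T\<in>\<T>. LINT x|lebesgue_on T. ?c T)"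
  proof (rule lint_piecewise(2))
    fix T assume T: "T \<in> \<T>"
    from AE_Pi_h[OF T, of K] AE_Pi_h[OF T, of v]
    show "AE x in lebesgue_on T. (norm (inv_sqrt (Pi_h \<T> K x) *v Pi_h \<T> v x))\<^sup>2 = ?c T"
      by eventually_elim (simp add: const_proj_rt[OF v T])
  qed (intro continuous_intros)
  also have "\<dots> = (\<Sum>T\<in>\<T>. vol T * ?c T)"
    by (intro sum.cong refl) (simp add: finite_lebesgue_on(3))
  finally show ?thesis .
qed

lemma local_poly_P1:
  assumes T: "T \<in> \<T>" and w: "w \<in> P1" and ae: "AE x in lebesgue_on T. q x = w x"
  shows "local_poly P1 q T = w"
  unfolding local_poly_def
proof (rule the_equality)
  show "w \<in> P1 \<and> (AE x in lebesgue_on T. q x = w x)" using w ae by blast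
next
  have cont: "continuous_on UNIV w" if "w \<in> P1" for w :: "real^'n \<Rightarrow> real"
    using that by (auto simp: P1_def intro!: continuous_intros)
  fix w' assume w': "w' \<in> P1 \<and> (AE x in lebesgue_on T. q x = w' x)"
  have "AE x in lebesgue_on T. w' x = w x" using ae w' by (auto elim: eventually_elim2)
  then have eq: "\<forall>x\<in>interior T. w' x = w x" by (rule AE_interior_eq[OF T]) (use w w' cont in auto)
  obtain a b where ab: "w = (\<lambda>x. a \<bullet> x + b)" using w by (auto simp: P1_def)
  obtain a' b' where ab': "w' = (\<lambda>x. a' \<bullet> x + b')" using w' by (auto simp: P1_def)
  obtain z where "z \<in> interior T" using interior_full_simplex_nonempty[OF simplex[OF T]] by blast
  then obtain e where e: "0 < e" "ball z e \<subseteq> interior T" by (meson open_interior openE)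
  have "a' - a = 0"
  proof (rule ccontr)
    assume n: "a' - a \<noteq> 0"
    define h where "h = (e / (2 * norm (a' - a))) *\<^sub>R (a' - a)"
    have "norm h < e" using e(1) n by (simp add: h_def)
    then have "z + h \<in> interior T" using e(2) by (auto simp: dist_norm intro!: subsetD[OF e(2)])
    then have "a' \<bullet> (z + h) + b' = a \<bullet> (z + h) + b" "a' \<bullet> z + b' = a \<bullet> z + b"
      using eq \<open>z \<in> interior T\<close> unfolding ab ab' by blast+
    then have "(a' - a) \<bullet> h = 0" by (simp add: inner_add_right inner_diff_left)
    then show False using n e(1) by (simp add: h_def)
  qed
  then show "w' = w" using eq \<open>z \<in> interior T\<close> unfolding ab ab' by auto
qed

text \<open>The basis function of a facet is the function that equals \<open>1 - d \<lambda>\<close> on the elements of that facet,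
  where \<open>\<lambda>\<close> is the barycentric coordinate that vanishes on it, and zero elsewhere: at the barycenter
  of any other facet of such an element \<open>\<lambda>\<close> is \<open>1 / d\<close>.\<close>

lemma cr_basis_CR:
  assumes "S \<in> facets \<T>"
  shows "cr_basis \<Omega> \<T> S \<in> CR \<Omega> \<T>"
proof -
  define w where "w T = (if \<exists>p\<in>verts T. fac T p = S
      then (\<lambda>x. 1 - real CARD('n) * lam T (SOME p. p \<in> verts T \<and> fac T p = S) x) else (\<lambda>x. 0))" for T
  define \<phi> where "\<phi> x = w (elem_at \<T> x) x" for x
  have wP1: "w T \<in> P1" for T
  proof (cases "\<exists>p\<in>verts T. fac T p = S")
    case True
    then show ?thesis unfolding w_def P1_def lam_def
      by (auto intro!: exI[of _ "- real CARD('n) *\<^sub>R bgrad T (SOME p. p \<in> verts T \<and> fac T p = S)"]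
          exI[of _ "1 - real CARD('n) * snd (bcoeff T (SOME p. p \<in> verts T \<and> fac T p = S))"] simp: algebra_simps)
  next
    case False
    then show ?thesis unfolding w_def P1_def by (auto intro!: exI[of _ 0])
  qed
  have ae: "AE x in lebesgue_on T. \<phi> x = w T x" if "T \<in> \<T>" for T
    using AE_elem_at[OF that] by eventually_elim (simp add: \<phi>_def)
  have lp: "local_poly P1 \<phi> T = w T" if "T \<in> \<T>" for T by (rule local_poly_P1[OF that wP1 ae[OF that]])
  have val: "local_poly P1 \<phi> T (barycenter S') = (if S' = S then 1 else 0)" if T: "T \<in> \<T>" and S': "S' facet_of T" for T S'
  proof -
    note sT = simplex[OF T]
    obtain p' where p': "p' \<in> verts T" "S' = fac T p'" using S' facet_of_simplex[OF sT] by blast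
    have V: "{v. v extreme_point_of S'} = verts T - {p'}" using verts_fac[OF sT, of p'] p'(2) by (simp add: verts_def)
    have card: "card (verts T - {p'}) = CARD('n)" using full_simplex_verts(1,2)[OF sT] p'(1) by simp
    define u where "u q = (if q = p' then 0 else 1 / real CARD('n))" for q
    have u: "sum u (verts T) = 1"
      using sum.remove[OF full_simplex_verts(1)[OF sT] p'(1), of u] card by (simp add: u_def)
    have bc: "barycenter S' = (\<Sum>q\<in>verts T. u q *\<^sub>R q)"
      unfolding barycenter_def V card sum.remove[OF full_simplex_verts(1)[OF sT] p'(1)]
      by (simp add: u_def scaleR_sum_right divide_inverse)
    show ?thesis
    proof (cases "\<exists>p\<in>verts T. fac T p = S")
      case True
      define p where "p = (SOME p. p \<in> verts T \<and> fac T p = S)"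
      have p: "p \<in> verts T" "fac T p = S" unfolding p_def using someI_ex[of "\<lambda>p. p \<in> verts T \<and> fac T p = S"] True by auto
      have "w T = (\<lambda>x. 1 - real CARD('n) * lam T p x)" using True by (simp add: w_def p_def)
      then have "local_poly P1 \<phi> T (barycenter S') = 1 - real CARD('n) * u p"
        using lp[OF T] lam_vertex_comb[OF sT u p(1)] by (simp add: bc)
      moreover have "S' = S \<longleftrightarrow> p = p'" using fac_inj[OF sT] p p' by metis
      ultimately show ?thesis by (simp add: u_def)
    next
      case False
      then have "w T = (\<lambda>x. 0)" "S' \<noteq> S" using p' by (auto simp: w_def)
      then show ?thesis using lp[OF T] by simp
    qed
  qed
  have "\<phi> \<in> CR \<Omega> \<T>" unfolding CR_def using wP1 ae val by auto
  then have "\<exists>\<phi>. \<phi> \<in> CR \<Omega> \<T> \<and> (\<forall>S'\<in>facets \<T>. \<forall>T\<in>\<T>. S' facet_of T \<longrightarrow>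
        local_poly P1 \<phi> T (barycenter S') = (if S' = S then 1 else 0))" using val by blast
  from someI_ex[OF this] show ?thesis unfolding cr_basis_def by blast
qed

lemma Pi_cr_piecewise_P1:
  assumes T: "T \<in> \<T>"
  shows "\<exists>w\<in>P1. AE x in lebesgue_on T. Pi_cr \<Omega> \<T> q x = w x"
proof -
  have fin: "finite (facets \<T>)"
  proof -
    have "facets \<T> \<subseteq> (\<Union>T\<in>\<T>. fac T ` verts T)"
    proof
      fix S assume "S \<in> facets \<T>"
      then obtain T where T: "T \<in> \<T>" "S facet_of T" unfolding facets_def by blast
      then obtain p where "p \<in> verts T" "S = fac T p" using facet_of_simplex[OF simplex[OF T(1)], of S] by auto
      then show "S \<in> (\<Union>T\<in>\<T>. fac T ` verts T)" using T(1) by blast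
    qed
    then show ?thesis by (rule finite_subset) (use finite_mesh full_simplex_verts(1)[OF simplex] in auto)
  qed
  have lin: "\<exists>w\<in>P1. AE x in lebesgue_on T. (\<Sum>S\<in>I. c S * \<phi> S x) = w x"
    if "finite I" "\<And>S. S \<in> I \<Longrightarrow> \<exists>w\<in>P1. AE x in lebesgue_on T. \<phi> S x = w x" for I :: "(real^'n) set set" and c \<phi>
    using that
  proof (induction I)
    case empty
    then show ?case by (auto simp: P1_def intro!: bexI[of _ "\<lambda>x. 0"] exI[of _ 0])
  next
    case (insert S I)
    have "\<exists>w\<in>P1. AE x in lebesgue_on T. (\<Sum>S\<in>I. c S * \<phi> S x) = w x"
      by (rule insert.IH) (use insert.prems in auto)
    moreover have "\<exists>w\<in>P1. AE x in lebesgue_on T. \<phi> S x = w x" by (rule insert.prems) simp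
    ultimately obtain w w' where w: "w \<in> P1" "AE x in lebesgue_on T. (\<Sum>S\<in>I. c S * \<phi> S x) = w x"
      "w' \<in> P1" "AE x in lebesgue_on T. \<phi> S x = w' x" by blast
    have "(\<lambda>x. c S * w' x + w x) \<in> P1"
    proof -
      obtain a b a' b' where "w = (\<lambda>x. a \<bullet> x + b)" "w' = (\<lambda>x. a' \<bullet> x + b')" using w(1,3) by (auto simp: P1_def)
      then show ?thesis
        by (auto simp: P1_def inner_add_left algebra_simps intro!: exI[of _ "c S *\<^sub>R a' + a"] exI[of _ "c S * b' + b"])
    qed
    moreover have "AE x in lebesgue_on T. (\<Sum>S\<in>insert S I. c S * \<phi> S x) = c S * w' x + w x"
      using w(2,4) by eventually_elim (use insert.hyps in simp)
    ultimately show ?case by (intro bexI[of _ "\<lambda>x. c S * w' x + w x"])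
  qed
  have each: "\<exists>w\<in>P1. AE x in lebesgue_on T. cr_basis \<Omega> \<T> S x = w x" if "S \<in> facets \<T>" for S
    using cr_basis_CR[OF that] T unfolding CR_def by blast
  show ?thesis unfolding Pi_cr_def by (rule lin[OF fin each])
qed

text \<open>Outside the skeleton, which is a null set, each boundary point lies in the relative interior of
  exactly one facet, and the normal flux is constant there.\<close>

lemma boundary_functional_rep:
  assumes \<Gamma>: "openin (top_of_set (frontier \<Omega>)) \<Gamma>"
    and q: "\<And>T. T \<in> \<T> \<Longrightarrow> \<exists>w\<in>P1. AE x in lebesgue_on T. q x = w x"
  shows "\<exists>\<kappa>. \<forall>v a b. rt_rep v a b \<longrightarrow>
    (LINT x|surface_on \<Gamma>. boundary_value \<T> P1 q x * normal_flux \<Omega> \<T> v x) = (\<Sum>(T, p)\<in>bfacs. \<kappa> T p * bflux a b T p)"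
proof -
  obtain w where w: "\<And>T. T \<in> \<T> \<Longrightarrow> w T \<in> P1" "\<And>T. T \<in> \<T> \<Longrightarrow> AE x in lebesgue_on T. q x = w T x"
    using q by metis
  obtain U where U: "open U" "\<Gamma> = U \<inter> frontier \<Omega>" using \<Gamma> by (auto simp: openin_open)
  have G: "\<Gamma> \<in> sets borel" unfolding U(2) using U(1) by (intro sets.Int) auto
  then have G': "\<Gamma> \<in> sets surface_measure" by (auto intro: sets_completionI_sets)
  have ofac_borel: "ofac T p \<in> sets borel" if "T \<in> \<T>" for T p
  proof -
    have "ofac T p = {x. lam T p x = 0} \<inter> (\<Inter>q\<in>verts T - {p}. {x. 0 < lam T q x})" by (auto simp: ofac_def)
    moreover have "{x. lam T p x = 0} \<in> sets borel" by measurable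
    moreover have "{x. 0 < lam T q x} \<in> sets borel" for q by measurable
    moreover have "finite (verts T - {p})" "verts T - {p} \<noteq> {}"
      using full_simplex_verts(1)[OF simplex[OF that]] ex_other_vertex[OF simplex[OF that], of p] by auto
    ultimately show ?thesis by (auto intro!: sets.Int sets.finite_INT)
  qed
  define k where "k T p x = indicator (\<Gamma> \<inter> ofac T p) x * w T x" for T p x
  have ik: "integrable surface_measure (k T p)" if "(T, p) \<in> bfacs" for T p
  proof -
    have T: "T \<in> \<T>" "p \<in> verts T" using that by (auto simp: bfacs_def)
    have cw: "continuous_on UNIV (w T)" using w(1)[OF T(1)] by (auto simp: P1_def intro!: continuous_intros)
    have "bounded (w T ` fac T p)"
      by (intro compact_imp_bounded compact_continuous_image compact_fac[OF simplex[OF T(1)]] continuous_on_subset[OF cw]) auto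
    then obtain B where B: "\<And>x. x \<in> fac T p \<Longrightarrow> \<bar>w T x\<bar> \<le> B" by (auto simp: bounded_iff)
    have sub: "\<Gamma> \<inter> ofac T p \<subseteq> fac T p" using ofac_subset_fac[OF simplex[OF T(1)] T(2)] by blast
    have m: "\<Gamma> \<inter> ofac T p \<in> sets borel" using G ofac_borel[OF T(1)] by auto
    have fin: "emeasure borel_surface_measure (fac T p) < \<infinity>" using emeasure_fac[OF simplex[OF T(1)] T(2)] by simp
    have "integrable borel_surface_measure (k T p)"
    proof (rule integrableI_bounded_set[where A = "fac T p" and B = B])
      show "fac T p \<in> sets borel_surface_measure" using borel_compact[OF compact_fac[OF simplex[OF T(1)]]] by simp
      show "k T p \<in> borel_measurable borel_surface_measure"
        unfolding k_def[abs_def] using m borel_measurable_continuous_onI[OF cw] by measurable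
      show "AE x in borel_surface_measure. x \<in> fac T p \<longrightarrow> norm (k T p x) \<le> B"
      proof (rule AE_I2, rule impI)
        fix x assume x: "x \<in> fac T p"
        have "0 \<le> B" using B[OF x] by linarith
        then show "norm (k T p x) \<le> B" using B[OF x] by (auto simp: k_def indicator_def)
      qed
      show "AE x in borel_surface_measure. x \<notin> fac T p \<longrightarrow> k T p x = 0"
        using sub by (intro AE_I2) (auto simp: k_def indicator_def)
    qed (use fin in auto)
    then show ?thesis by (simp add: integrable_completion borel_measurable_integrable)
  qed
  have main: "(LINT x|surface_on \<Gamma>. boundary_value \<T> P1 q x * normal_flux \<Omega> \<T> v x) = (\<Sum>(T, p)\<in>bfacs. (LINT x|surface_measure. k T p x) * bflux a b T p)"
    if v: "rt_rep v a b" for v a b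
  proof -
    have ae: "AE x in surface_measure. indicator \<Gamma> x *\<^sub>R (boundary_value \<T> P1 q x * normal_flux \<Omega> \<T> v x) = (\<Sum>(T, p)\<in>bfacs. k T p x * bflux a b T p)"
      using AE_not_skel
    proof eventually_elim
      case (elim x)
      show ?case
      proof (cases "x \<in> \<Gamma>")
        case True
        then have xf: "x \<in> frontier \<Omega>" using U(2) by blast
        obtain T p where T: "(T, p) \<in> bfacs" "x \<in> ofac T p" by (rule frontier_ofac[OF xf elim])
        then have T': "T \<in> \<T>" "p \<in> verts T" by (auto simp: bfacs_def)
        have other: "k T' p' x * bflux a b T' p' = 0" if "(T', p') \<in> bfacs - {(T, p)}" for T' p'
        proof (cases "x \<in> ofac T' p'")
          case True
          have S: "T' \<in> \<T>" "p' \<in> verts T'" using that by (auto simp: bfacs_def)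
          then have "x \<in> T'" using ofac_subset True by blast
          then have "T' = T" using ofac_frontier_unique[OF T' T(2) xf S(1)] by blast
          then have "p' \<noteq> p" using that by blast
          then have "0 < lam T p' x" using T(2) S(2) \<open>T' = T\<close> by (auto simp: ofac_def)
          then show ?thesis using True \<open>T' = T\<close> by (simp add: ofac_def)
        qed (simp add: k_def)
        have "(\<Sum>(T, p)\<in>bfacs - {(T, p)}. k T p x * bflux a b T p) = 0"
        proof (rule sum.neutral, rule ballI)
          fix y assume y: "y \<in> bfacs - {(T, p)}"
          show "(case y of (T, p) \<Rightarrow> k T p x * bflux a b T p) = 0"
            using other[of "fst y" "snd y"] y by (simp add: case_prod_unfold)
        qed
        then have "(\<Sum>(T, p)\<in>bfacs. k T p x * bflux a b T p) = k T p x * bflux a b T p"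
          using sum.remove[OF finite_bfacs T(1), of "\<lambda>(T, p). k T p x * bflux a b T p"] by simp
        moreover have "k T p x = w T x" using True T(2) by (simp add: k_def)
        moreover have "boundary_value \<T> P1 q x = w T x"
          unfolding boundary_value_def elem_at_ofac[OF T' T(2) xf] local_poly_P1[OF T'(1) w[OF T'(1)]] ..
        ultimately show ?thesis using True normal_flux_ofac[OF v T] by simp
      next
        case False
        then show ?thesis by (auto simp: k_def intro!: sum.neutral[symmetric])
      qed
    qed
    have cm: "complete_measure (completion borel_surface_measure :: (real^'n) measure)" by unfold_locales
    have i: "integrable surface_measure (\<lambda>x. \<Sum>(T, p)\<in>bfacs. k T p x * bflux a b T p)"
      using ik by (auto intro!: Bochner_Integration.integrable_sum)
    have "(LINT x|surface_on \<Gamma>. boundary_value \<T> P1 q x * normal_flux \<Omega> \<T> v x)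
        = (LINT x|surface_measure. indicator \<Gamma> x *\<^sub>R (boundary_value \<T> P1 q x * normal_flux \<Omega> \<T> v x))"
      using G' by (subst integral_restrict_space) auto
    also have "\<dots> = (LINT x|surface_measure. (\<Sum>(T, p)\<in>bfacs. k T p x * bflux a b T p))"
      by (rule AE_eq_integrable(2)[OF cm i ae])
    also have "\<dots> = (\<Sum>(T, p)\<in>bfacs. (LINT x|surface_measure. k T p x) * bflux a b T p)"
      unfolding case_prod_unfold using ik by (subst Bochner_Integration.integral_sum) auto
    finally show ?thesis .
  qed
  show ?thesis by (rule exI[of _ "\<lambda>T p. LINT x|surface_measure. k T p x"]) (use main in blast)
qed

text \<open>By polarization the bounds on the quadratic form bound the entries, so that the coefficient is
  integrable. Symmetry and the lower bound pass to the mean.\<close>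

lemma const_proj_matrix:
  fixes K :: "real^'n \<Rightarrow> real^'n^'n"
  assumes K_meas: "K \<in> borel_measurable (lebesgue_on \<Omega>)"
    and K_sym: "\<And>x. x \<in> \<Omega> \<Longrightarrow> transpose (K x) = K x"
    and k0: "0 < k0"
    and K_bounds: "\<And>x \<xi>. x \<in> \<Omega> \<Longrightarrow>
      k0 * (norm \<xi>)\<^sup>2 \<le> \<xi> \<bullet> (K x *v \<xi>) \<and> \<xi> \<bullet> (K x *v \<xi>) \<le> k1 * (norm \<xi>)\<^sup>2"
    and T: "T \<in> \<T>"
  shows "transpose (const_proj (lebesgue_on T) K) = const_proj (lebesgue_on T) K"
    and "\<xi> \<noteq> 0 \<Longrightarrow> 0 < \<xi> \<bullet> (const_proj (lebesgue_on T) K *v \<xi>)"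
proof -
  have V: "0 < vol T" by (rule vol_full_simplex_pos[OF simplex[OF T]])
  interpret finite_measure "lebesgue_on T" by (rule finite_lebesgue_on(1)[OF T])
  define K' where "K' x = indicator \<Omega> x *\<^sub>R K x" for x
  have inT: "AE x in lebesgue_on T. x \<in> \<Omega>"
    using AE_elem_at[OF T] by eventually_elim (use interior_element[OF T] in blast)
  have eq: "AE x in lebesgue_on T. K x = K' x" using inT by eventually_elim (simp add: K'_def)
  have "K' \<in> borel_measurable lebesgue"
    using K_meas dom_measurable unfolding K'_def[abs_def] by (subst (asm) borel_measurable_restrict_space_iff) auto
  then have mK': "K' \<in> borel_measurable (lebesgue_on T)" by (rule measurable_restrict_space1)
  have entry: "\<bar>K x $ i $ j\<bar> \<le> 2 * \<bar>k1\<bar>" if x: "x \<in> \<Omega>" for x i j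
  proof -
    let ?e = "\<lambda>i. axis i 1 :: real^'n"
    have e: "?e i \<bullet> (K x *v ?e j) = K x $ i $ j" for i j by (simp add: inner_axis' matrix_vector_mul_component inner_axis row_def)
    have s: "K x $ i $ j = K x $ j $ i" for i j
    proof -
      have "K x $ i $ j = transpose (K x) $ j $ i" by (simp add: transpose_def)
      also have "\<dots> = K x $ j $ i" by (simp only: K_sym[OF x])
      finally show ?thesis .
    qed
    have q: "0 \<le> \<xi> \<bullet> (K x *v \<xi>)" "\<xi> \<bullet> (K x *v \<xi>) \<le> k1 * (norm \<xi>)\<^sup>2" for \<xi>
      using K_bounds[OF x, of \<xi>] k0 by (auto intro: order_trans[rotated])
    have pol: "(?e i + t *\<^sub>R ?e j) \<bullet> (K x *v (?e i + t *\<^sub>R ?e j)) = K x $ i $ i + 2 * t * K x $ i $ j + t\<^sup>2 * K x $ j $ j" for t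
      by (simp add: matrix_vector_right_distrib matrix_vector_mult_scaleR inner_add_left inner_add_right e s[of j i] power2_eq_square algebra_simps)
    have d: "K x $ i $ i \<le> k1" for i using q(2)[of "?e i"] by (simp add: e)
    have d0: "0 \<le> K x $ i $ i" for i using q(1)[of "?e i"] by (simp add: e)
    have "0 \<le> K x $ i $ i + 2 * 1 * K x $ i $ j + 1\<^sup>2 * K x $ j $ j" using q(1) pol[of 1] by metis
    moreover have "0 \<le> K x $ i $ i + 2 * (-1) * K x $ i $ j + (-1)\<^sup>2 * K x $ j $ j" using q(1) pol[of "-1"] by metis
    ultimately show ?thesis using d[of i] d[of j] d0[of i] by simp
  qed
  have nb: "norm (K x) \<le> (\<Sum>i\<in>(UNIV::'n set). \<Sum>j\<in>(UNIV::'n set). 2 * \<bar>k1\<bar>)" if "x \<in> \<Omega>" for x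
  proof -
    have "norm (K x) \<le> (\<Sum>i\<in>UNIV. norm (K x $ i))"
      by (subst norm_vec_def) (rule L2_set_le_sum, simp)
    also have "\<dots> \<le> (\<Sum>i\<in>UNIV. \<Sum>j\<in>UNIV. \<bar>K x $ i $ j\<bar>)" by (intro sum_mono norm_le_l1_cart)
    also have "\<dots> \<le> (\<Sum>i\<in>(UNIV::'n set). \<Sum>j\<in>(UNIV::'n set). 2 * \<bar>k1\<bar>)" by (intro sum_mono entry that)
    finally show ?thesis .
  qed
  have iK': "integrable (lebesgue_on T) K'"
    by (rule integrable_const_bound[OF _ mK', where B = "\<Sum>i\<in>(UNIV::'n set). \<Sum>j\<in>(UNIV::'n set). 2 * \<bar>k1\<bar>"])
      (use inT nb in \<open>auto simp: K'_def elim!: eventually_mono\<close>)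
  note iK = AE_eq_integrable(1)[OF complete_lebesgue_on[OF T] iK' eq]
  have M: "const_proj (lebesgue_on T) K = (LINT x|lebesgue_on T. K x) /\<^sub>R vol T"
    using const_proj_element[OF T _ iK] V by (simp add: finite_lebesgue_on(3)[OF T])
  have bl: "bounded_linear (\<lambda>A :: real^'n^'n. \<xi> \<bullet> (A *v \<eta>))" for \<xi> \<eta> :: "real^'n"
    unfolding linear_conv_bounded_linear[symmetric]
    by (intro linearI) (auto simp: matrix_vector_mult_add_rdistrib inner_add_right scaleR_matrix_vector_assoc[symmetric])
  have form: "\<xi> \<bullet> (const_proj (lebesgue_on T) K *v \<eta>) = (LINT x|lebesgue_on T. \<xi> \<bullet> (K x *v \<eta>)) / vol T" for \<xi> \<eta>
    unfolding M using integral_bounded_linear[OF bl iK, of \<xi> \<eta>]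
    by (simp add: scaleR_matrix_vector_assoc[symmetric] divide_inverse mult.commute)
  have fi: "integrable (lebesgue_on T) (\<lambda>x. \<xi> \<bullet> (K x *v \<eta>))" for \<xi> \<eta>
    by (rule integrable_bounded_linear[OF bl iK])
  show "transpose (const_proj (lebesgue_on T) K) = const_proj (lebesgue_on T) K"
  proof (rule symmetric_matrixI)
    fix \<eta> \<xi>
    have "(LINT x|lebesgue_on T. \<eta> \<bullet> (K x *v \<xi>)) = (LINT x|lebesgue_on T. \<xi> \<bullet> (K x *v \<eta>))"
    proof (rule integral_cong_AE)
      show "AE x in lebesgue_on T. \<eta> \<bullet> (K x *v \<xi>) = \<xi> \<bullet> (K x *v \<eta>)"
        using inT by eventually_elim (metis K_sym symmetric_matrix_inner inner_commute)
    qed (use fi in \<open>auto intro: borel_measurable_integrable\<close>)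
    then have "\<eta> \<bullet> (const_proj (lebesgue_on T) K *v \<xi>) = (const_proj (lebesgue_on T) K *v \<eta>) \<bullet> \<xi>"
      using form inner_commute[of _ \<xi>] by metis
    then show "(transpose (const_proj (lebesgue_on T) K) *v \<eta>) \<bullet> \<xi> = (const_proj (lebesgue_on T) K *v \<eta>) \<bullet> \<xi>"
      unfolding transpose_matrix_vector dot_lmul_matrix .
  qed
  show "0 < \<xi> \<bullet> (const_proj (lebesgue_on T) K *v \<xi>)" if "\<xi> \<noteq> 0"
  proof -
    have "(LINT x|lebesgue_on T. k0 * (norm \<xi>)\<^sup>2) \<le> (LINT x|lebesgue_on T. \<xi> \<bullet> (K x *v \<xi>))"
      by (rule integral_mono_AE) (use fi inT K_bounds in \<open>auto elim!: eventually_mono\<close>)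
    then have "vol T * (k0 * (norm \<xi>)\<^sup>2) \<le> (LINT x|lebesgue_on T. \<xi> \<bullet> (K x *v \<xi>))"
      by (simp add: finite_lebesgue_on(3)[OF T])
    moreover have "0 < vol T * (k0 * (norm \<xi>)\<^sup>2)" using V k0 that by simp
    ultimately show ?thesis unfolding form using V by simp
  qed
qed

end


section \<open>Existence of admissible fields\<close>

context mesh
begin

definition halves :: "((real^'n) set \<times> (real^'n)) set" where
  "halves = {(T, p). T \<in> \<T> \<and> p \<in> verts T}"

lemma finite_halves: "finite halves"
proof -
  have "halves \<subseteq> (SIGMA T:\<T>. verts T)" by (auto simp: halves_def)
  then show ?thesis by (rule finite_subset) (use finite_mesh full_simplex_verts(1)[OF simplex] in auto)
qed

lemma halves_Sigma: "halves = (SIGMA T:\<T>. verts T)"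
  by (auto simp: halves_def)

lemma bfacs_halves: "bfacs \<subseteq> halves"
  by (auto simp: bfacs_def halves_def)

lemma sum_halves: "(\<Sum>(T, p)\<in>halves. g T p) = (\<Sum>T\<in>\<T>. \<Sum>p\<in>verts T. g T p)"
  unfolding halves_Sigma using finite_mesh full_simplex_verts(1)[OF simplex]
  by (subst sum.Sigma) auto

text \<open>\<open>c T p\<close> is the flux out of the element \<open>T\<close> through the facet opposite \<open>p\<close>. For an interior facet,
  balance means that the flux out of one element enters the other one.\<close>

definition balanced :: "((real^'n) set \<Rightarrow> real^'n \<Rightarrow> real) \<Rightarrow> (real^'n) set \<Rightarrow> bool" where
  "balanced c S \<longleftrightarrow> (\<Sum>(T, p)\<in>{x\<in>halves. (case x of (T, p) \<Rightarrow> fac T p) = S}. c T p) = 0"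

lemma balanced_add: "balanced c S \<Longrightarrow> balanced c' S \<Longrightarrow> balanced (\<lambda>T p. c T p + c' T p) S"
  by (simp add: balanced_def case_prod_unfold sum.distrib)

lemma balanced_scale: "balanced c S \<Longrightarrow> balanced (\<lambda>T p. r * c T p) S"
  by (simp add: balanced_def case_prod_unfold sum_distrib_left[symmetric])

lemma balanced_sum: "finite I \<Longrightarrow> (\<And>i. i \<in> I \<Longrightarrow> balanced (c i) S) \<Longrightarrow> balanced (\<lambda>T p. \<Sum>i\<in>I. c i T p) S"
  by (induction I rule: finite_induct) (simp_all add: balanced_add balanced_def[of "\<lambda>T p. 0"])

text \<open>Each step of the path moves the unit through the shared facet. Such a facet is not contained in the
  boundary.\<close>

lemma unit_flow:
  assumes T0: "T0 \<in> \<T>" and path: "(T0, T1) \<in> adjacent\<^sup>*"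
  shows "\<exists>c. (\<forall>S. balanced c S) \<and> (\<forall>T p. (T, p) \<in> bfacs \<longrightarrow> c T p = 0) \<and>
    (\<forall>T\<in>\<T>. (\<Sum>p\<in>verts T. c T p) = (if T = T0 then 1 else 0) - (if T = T1 then 1 else (0::real)))"
  using path
proof induction
  case base
  show ?case by (intro exI[of _ "\<lambda>T p. 0"]) (simp add: balanced_def)
next
  case (step T1 T2)
  then obtain c where c: "\<And>S. balanced c S" "\<And>T p. (T, p) \<in> bfacs \<Longrightarrow> c T p = 0"
    "\<And>T. T \<in> \<T> \<Longrightarrow> (\<Sum>p\<in>verts T. c T p) = (if T = T0 then 1 else 0) - (if T = T1 then 1 else (0::real))" by blast
  obtain p p' where T: "T1 \<in> \<T>" "T2 \<in> \<T>" "T1 \<noteq> T2" "p \<in> verts T1" "p' \<in> verts T2" "fac T1 p = fac T2 p'"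
    using step.hyps(2) by (auto simp: adjacent_def)
  have h: "(T1, p) \<in> halves" "(T2, p') \<in> halves" using T by (auto simp: halves_def)
  define e where "e T q = (if (T, q) = (T1, p) then 1 else 0) - (if (T, q) = (T2, p') then 1 else (0::real))" for T q
  have nb: "(T1, p) \<notin> bfacs" "(T2, p') \<notin> bfacs"
  proof -
    obtain x where x: "x \<in> ofac T1 p" using ofac_nonempty[OF T(1,4)] by blast
    have xf: "x \<in> fac T1 p" using x ofac_subset_fac[OF simplex[OF T(1)] T(4)] by blast
    then have "x \<in> T2" using T(6) fac_eq[OF simplex[OF T(2)] T(5)] by blast
    then have "x \<in> \<Omega>" using ofac_two_elements[OF T(1-4) x] by blast
    then have "x \<notin> frontier \<Omega>" using frontier_dom by blast
    then show "(T1, p) \<notin> bfacs" "(T2, p') \<notin> bfacs" using xf T(6) unfolding bfacs_def by blast+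
  qed
  have be: "balanced e S" for S
  proof -
    let ?H = "{x\<in>halves. (case x of (T, p) \<Rightarrow> fac T p) = S}"
    have "(\<Sum>(T, q)\<in>?H. e T q) = (\<Sum>x\<in>?H. if x = (T1, p) then 1 else 0) - (\<Sum>x\<in>?H. if x = (T2, p') then 1 else 0)"
      by (subst sum_subtractf[symmetric]) (simp add: e_def case_prod_unfold)
    also have "\<dots> = (if fac T1 p = S then 1 else 0) - (if fac T2 p' = S then 1 else 0)"
      using finite_halves h by (simp add: sum.delta)
    finally show ?thesis using T(6) by (simp add: balanced_def)
  qed
  have div: "(\<Sum>q\<in>verts T. e T q) = (if T = T1 then 1 else 0) - (if T = T2 then 1 else 0)" if "T \<in> \<T>" for T
  proof -
    have fin: "finite (verts T)" by (rule full_simplex_verts(1)[OF simplex[OF that]])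
    have "(\<Sum>q\<in>verts T. e T q) = (\<Sum>q\<in>verts T. if q = p then (if T = T1 then 1 else 0) else 0)
        - (\<Sum>q\<in>verts T. if q = p' then (if T = T2 then 1 else 0) else 0)"
      by (subst sum_subtractf[symmetric]) (intro sum.cong, auto simp: e_def)
    then show ?thesis using fin T by (auto simp: sum.delta)
  qed
  show ?case
  proof (intro exI[of _ "\<lambda>T q. c T q + e T q"] conjI allI impI ballI)
    show "balanced (\<lambda>T q. c T q + e T q) S" for S using c(1) be by (rule balanced_add)
    show "c T q + e T q = 0" if "(T, q) \<in> bfacs" for T q
      using c(2)[OF that] nb that by (auto simp: e_def)
    show "(\<Sum>q\<in>verts T. c T q + e T q) = (if T = T0 then 1 else 0) - (if T = T2 then 1 else 0)" if "T \<in> \<T>" for T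
      using c(3)[OF that] div[OF that] by (simp add: sum.distrib)
  qed
qed

text \<open>Send the surplus of each element to one fixed element. The surpluses add up to zero.\<close>

lemma flow_with_boundary_data:
  assumes total: "(\<Sum>(T, p)\<in>bfacs. \<gamma> T p) = (\<Sum>T\<in>\<T>. r T)"
  shows "\<exists>c. (\<forall>S. \<not> S \<subseteq> frontier \<Omega> \<longrightarrow> balanced c S) \<and> (\<forall>T p. (T, p) \<in> bfacs \<longrightarrow> c T p = \<gamma> T p) \<and>
    (\<forall>T\<in>\<T>. (\<Sum>p\<in>verts T. c T p) = (r T :: real))"
proof -
  have "\<T> \<noteq> {}" using Union_mesh nonempty_dom by (metis Union_empty closure_eq_empty)
  then obtain T0 where T0: "T0 \<in> \<T>" by blast
  have "\<forall>T1\<in>\<T>. \<exists>c. (\<forall>S. balanced c S) \<and> (\<forall>T p. (T, p) \<in> bfacs \<longrightarrow> c T p = 0) \<and>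
    (\<forall>T\<in>\<T>. (\<Sum>p\<in>verts T. c T p) = (if T = T0 then 1 else 0) - (if T = T1 then 1 else (0::real)))"
    using unit_flow[OF T0 mesh_facet_connected[OF T0]] by blast
  from bchoice[OF this] obtain C where C: "\<And>T1 S. T1 \<in> \<T> \<Longrightarrow> balanced (C T1) S"
    "\<And>T1 T p. T1 \<in> \<T> \<Longrightarrow> (T, p) \<in> bfacs \<Longrightarrow> C T1 T p = 0"
    "\<And>T1 T. T1 \<in> \<T> \<Longrightarrow> T \<in> \<T> \<Longrightarrow> (\<Sum>p\<in>verts T. C T1 T p) = (if T = T0 then 1 else 0) - (if T = T1 then 1 else 0)"
    by blast
  define g where "g T p = (if (T, p) \<in> bfacs then \<gamma> T p else 0)" for T p
  define s where "s T = (\<Sum>p\<in>verts T. g T p) - r T" for T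
  have "(\<Sum>T\<in>\<T>. \<Sum>p\<in>verts T. g T p) = (\<Sum>(T, p)\<in>halves. g T p)" by (rule sum_halves[symmetric])
  also have "\<dots> = (\<Sum>(T, p)\<in>bfacs. g T p)"
    by (rule sum.mono_neutral_right[OF finite_halves bfacs_halves]) (auto simp: g_def)
  also have "\<dots> = (\<Sum>(T, p)\<in>bfacs. \<gamma> T p)" by (intro sum.cong) (auto simp: g_def)
  finally have s0: "(\<Sum>T\<in>\<T>. s T) = 0" using total by (simp add: s_def sum_subtractf)
  define c where "c T p = g T p + (\<Sum>T1\<in>\<T>. s T1 * C T1 T p)" for T p
  have "balanced c S" if "\<not> S \<subseteq> frontier \<Omega>" for S
    unfolding c_def
  proof (rule balanced_add)
    show "balanced g S" unfolding balanced_def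
      by (rule sum.neutral) (use that in \<open>auto simp: g_def bfacs_def\<close>)
    show "balanced (\<lambda>T p. \<Sum>T1\<in>\<T>. s T1 * C T1 T p) S"
      by (intro balanced_sum balanced_scale finite_mesh C(1))
  qed
  moreover have "c T p = \<gamma> T p" if "(T, p) \<in> bfacs" for T p using that C(2) by (simp add: c_def g_def)
  moreover have "(\<Sum>p\<in>verts T. c T p) = r T" if T: "T \<in> \<T>" for T
  proof -
    have "(\<Sum>p\<in>verts T. c T p) = (\<Sum>p\<in>verts T. g T p) + (\<Sum>T1\<in>\<T>. s T1 * (\<Sum>p\<in>verts T. C T1 T p))"
      unfolding c_def sum.distrib by (subst sum.swap) (simp add: sum_distrib_left)
    also have "(\<Sum>T1\<in>\<T>. s T1 * (\<Sum>p\<in>verts T. C T1 T p)) = (\<Sum>T1\<in>\<T>. s T1 * (if T = T0 then 1 else 0) - (if T = T1 then s T1 else 0))"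
      by (intro sum.cong refl) (simp add: C(3)[OF _ T])
    also have "\<dots> = (\<Sum>T1\<in>\<T>. s T1) * (if T = T0 then 1 else 0) - s T"
      using finite_mesh T by (simp add: sum_subtractf sum_distrib_right)
    also have "\<dots> = - s T" by (simp add: s0)
    finally show ?thesis by (simp add: s_def)
  qed
  ultimately show ?thesis by blast
qed

text \<open>The field of a flow: on each element a combination of the fields \<open>x - p\<close>.\<close>

definition flow_a :: "((real^'n) set \<Rightarrow> real^'n \<Rightarrow> real) \<Rightarrow> (real^'n) set \<Rightarrow> real^'n" where
  "flow_a c T = - (\<Sum>p\<in>verts T. (c T p / (real CARD('n) * vol T)) *\<^sub>R p)"

definition flow_b :: "((real^'n) set \<Rightarrow> real^'n \<Rightarrow> real) \<Rightarrow> (real^'n) set \<Rightarrow> real" where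
  "flow_b c T = (\<Sum>p\<in>verts T. c T p / (real CARD('n) * vol T))"

lemma flow_field: "flow_a c T + flow_b c T *\<^sub>R x = (\<Sum>p\<in>verts T. (c T p / (real CARD('n) * vol T)) *\<^sub>R (x - p))"
  by (simp add: flow_a_def flow_b_def scaleR_diff_right sum_subtractf scaleR_sum_left)

lemma flow_bflux:
  assumes T: "T \<in> \<T>" "p \<in> verts T"
  shows "bflux (flow_a c) (flow_b c) T p = c T p / area (fac T p)"
proof -
  note sT = simplex[OF T(1)]
  let ?n = "- inner_normal T p"
  obtain x where x: "x \<in> fac T p" using ofac_nonempty[OF T] ofac_subset_fac[OF sT T(2)] by blast
  have g: "0 < norm (bgrad T p)" using bgrad_nonzero[OF sT T(2)] by simp
  have V: "0 < vol T" by (rule vol_full_simplex_pos[OF sT])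
  have "bflux (flow_a c) (flow_b c) T p = (flow_a c T + flow_b c T *\<^sub>R x) \<bullet> ?n"
    unfolding bflux_def inner_normal_fac[OF sT T(2) x, symmetric] by (simp add: inner_add_left)
  also have "\<dots> = (\<Sum>q\<in>verts T. (c T q / (real CARD('n) * vol T)) * ((x - q) \<bullet> ?n))"
    unfolding flow_field by (simp add: inner_sum_left sum_negf)
  also have "\<dots> = (\<Sum>q\<in>verts T. if q = p then c T p / (real CARD('n) * vol T) * (1 / norm (bgrad T p)) else 0)"
  proof (intro sum.cong refl)
    fix q assume q: "q \<in> verts T"
    have "(x - q) \<bullet> ?n = (if q = p then 1 / norm (bgrad T p) else 0)"
    proof -
      have "(x - q) \<bullet> ?n = (lam T p q - lam T p x) / norm (bgrad T p)"
        unfolding lam_diff by (simp add: inner_normal_def[OF sT T(2)] inner_diff_left inner_diff_right inner_commute diff_divide_distrib divide_inverse algebra_simps)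
      moreover have "lam T p x = 0" using x fac_eq[OF sT T(2)] by blast
      ultimately show ?thesis using lam_vertex[OF sT q, of p] by simp
    qed
    then show "(c T q / (real CARD('n) * vol T)) * ((x - q) \<bullet> ?n) = (if q = p then c T p / (real CARD('n) * vol T) * (1 / norm (bgrad T p)) else 0)"
      by simp
  qed
  also have "\<dots> = c T p / (real CARD('n) * vol T) * (1 / norm (bgrad T p))"
    using full_simplex_verts(1)[OF sT] T(2) by simp
  also have "\<dots> = c T p / area (fac T p)"
    unfolding volume_height_area[OF sT T(2), symmetric] by simp
  finally show ?thesis .
qed

text \<open>Summation by parts over the facets: at an interior facet the facet means coincide and the fluxes
  cancel; at a boundary facet the test function vanishes.\<close>

lemma flow_weak_div:
  assumes bal: "\<And>S. \<not> S \<subseteq> frontier \<Omega> \<Longrightarrow> balanced c S"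
    and div: "\<And>T. T \<in> \<T> \<Longrightarrow> (\<Sum>p\<in>verts T. c T p) = vol T * r T"
    and \<phi>: "\<phi> \<in> test_functions \<Omega>"
  shows "(\<Sum>T\<in>\<T>. LINT x|lebesgue_on T. (flow_a c T + flow_b c T *\<^sub>R x) \<bullet> grad \<phi> x) = - (\<Sum>T\<in>\<T>. r T * (LINT x|lebesgue_on T. \<phi> x))"
proof -
  note tf = test_function_props[OF \<phi>]
  obtain L where L: "L-lipschitz_on UNIV \<phi>" using tf(2) by blast
  have elem: "(LINT x|lebesgue_on T. (flow_a c T + flow_b c T *\<^sub>R x) \<bullet> grad \<phi> x)
      = (\<Sum>p\<in>verts T. c T p * fmean T p \<phi>) - r T * (LINT x|lebesgue_on T. \<phi> x)" if T: "T \<in> \<T>" for T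
  proof -
    note sT = simplex[OF T]
    have V: "0 < vol T" by (rule vol_full_simplex_pos[OF sT])
    let ?I = "LINT x|lebesgue_on T. \<phi> x"
    have i: "integrable (lebesgue_on T) (\<lambda>x. grad \<phi> x \<bullet> (x - p))" for p
      using compact_full_simplex[OF sT] tf(5) by (intro lint_compact(1) continuous_intros)
    have "(LINT x|lebesgue_on T. (flow_a c T + flow_b c T *\<^sub>R x) \<bullet> grad \<phi> x)
        = (LINT x|lebesgue_on T. (\<Sum>p\<in>verts T. (c T p / (real CARD('n) * vol T)) * (grad \<phi> x \<bullet> (x - p))))"
      unfolding flow_field inner_sum_left inner_scaleR_left inner_commute[of "_ - _"] ..
    also have "\<dots> = (\<Sum>p\<in>verts T. (c T p / (real CARD('n) * vol T)) * (LINT x|lebesgue_on T. grad \<phi> x \<bullet> (x - p)))"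
      using i by (simp add: Bochner_Integration.integral_sum)
    also have "\<dots> = (\<Sum>p\<in>verts T. c T p * fmean T p \<phi> - c T p * (?I / vol T))"
    proof (intro sum.cong refl)
      fix p
      have "(c T p / (real CARD('n) * vol T)) * (real CARD('n) * (vol T * fmean T p \<phi> - ?I)) = c T p * fmean T p \<phi> - c T p * (?I / vol T)"
        using V by (simp add: field_simps)
      then show "(c T p / (real CARD('n) * vol T)) * (LINT x|lebesgue_on T. grad \<phi> x \<bullet> (x - p)) = c T p * fmean T p \<phi> - c T p * (?I / vol T)"
        unfolding lint_position_field[OF sT tf(1) L] .
    qed
    also have "\<dots> = (\<Sum>p\<in>verts T. c T p * fmean T p \<phi>) - (\<Sum>p\<in>verts T. c T p) * (?I / vol T)"
      by (simp only: sum_subtractf sum_distrib_right)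
    also have "(\<Sum>p\<in>verts T. c T p) * (?I / vol T) = r T * ?I" using div[OF T] V by simp
    finally show ?thesis .
  qed
  have "(\<Sum>T\<in>\<T>. \<Sum>p\<in>verts T. c T p * fmean T p \<phi>) = (\<Sum>(T, p)\<in>halves. c T p * fmean T p \<phi>)" by (rule sum_halves[symmetric])
  also have "\<dots> = (\<Sum>S\<in>(\<lambda>(T, p). fac T p) ` halves. \<Sum>(T, p)\<in>{x\<in>halves. (case x of (T, p) \<Rightarrow> fac T p) = S}. c T p * fmean T p \<phi>)"
    by (rule sum.image_gen[OF finite_halves])
  also have "\<dots> = 0"
  proof (rule sum.neutral, rule ballI)
    fix S assume "S \<in> (\<lambda>(T, p). fac T p) ` halves"
    then obtain T0 p0 where h0: "(T0, p0) \<in> halves" "fac T0 p0 = S" by auto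
    let ?H = "{x\<in>halves. (case x of (T, p) \<Rightarrow> fac T p) = S}"
    show "(\<Sum>(T, p)\<in>?H. c T p * fmean T p \<phi>) = 0"
    proof (cases "S \<subseteq> frontier \<Omega>")
      case True
      have "fmean T p \<phi> = 0" if "(T, p) \<in> ?H" for T p
      proof (rule fmean_zero[OF simplex _ tf(1) L])
        show "\<phi> x = 0" if "x \<in> fac T p" for x
          using that \<open>(T, p) \<in> ?H\<close> True frontier_dom by (intro tf(3)) auto
      qed (use that in \<open>auto simp: halves_def\<close>)
      then show ?thesis by (intro sum.neutral) auto
    next
      case False
      have "(\<Sum>(T, p)\<in>?H. c T p * fmean T p \<phi>) = (\<Sum>(T, p)\<in>?H. c T p * fmean T0 p0 \<phi>)"
      proof (intro sum.cong refl)
        fix y assume y: "y \<in> ?H"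
        obtain T p where Tp: "y = (T, p)" by (cases y)
        have "fmean T p \<phi> = fmean T0 p0 \<phi>"
          by (rule fmean_shared_facet[OF simplex _ simplex _ _ tf(1) L]) (use y h0 Tp in \<open>auto simp: halves_def\<close>)
        then show "(case y of (T, p) \<Rightarrow> c T p * fmean T p \<phi>) = (case y of (T, p) \<Rightarrow> c T p * fmean T0 p0 \<phi>)" by (simp add: Tp)
      qed
      also have "\<dots> = (\<Sum>(T, p)\<in>?H. c T p) * fmean T0 p0 \<phi>"
        by (simp add: sum_distrib_right case_prod_unfold)
      also have "\<dots> = 0" using bal[OF False] by (simp add: balanced_def)
      finally show ?thesis .
    qed
  qed
  finally have "(\<Sum>T\<in>\<T>. \<Sum>p\<in>verts T. c T p * fmean T p \<phi>) = 0" .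
  then show ?thesis by (simp add: elem sum_subtractf cong: sum.cong)
qed

lemma admissible_from_boundary_data:
  assumes total: "(\<Sum>(T, p)\<in>bfacs. area (fac T p) * \<gamma> T p) = (\<Sum>T\<in>\<T>. vol T * const_proj (lebesgue_on T) f)"
    and bounds: "\<And>T p. (T, p) \<in> bfacs \<Longrightarrow> fac T p \<subseteq> closure \<Gamma> \<Longrightarrow>
      pi_h \<Gamma> \<alpha> (fac T p) \<le> \<gamma> T p \<and> \<gamma> T p \<le> pi_h \<Gamma> \<beta> (fac T p)"
  shows "K_star \<Omega> \<Gamma> \<T> f \<alpha> \<beta> \<noteq> {}"
proof -
  let ?r = "\<lambda>T. vol T * const_proj (lebesgue_on T) f"
  obtain c where c: "\<forall>S. \<not> S \<subseteq> frontier \<Omega> \<longrightarrow> balanced c S"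
    "\<forall>T p. (T, p) \<in> bfacs \<longrightarrow> c T p = area (fac T p) * \<gamma> T p" "\<forall>T\<in>\<T>. (\<Sum>p\<in>verts T. c T p) = ?r T"
    using flow_with_boundary_data[of "\<lambda>T p. area (fac T p) * \<gamma> T p" ?r, OF total] by blast
  have fl: "bflux (flow_a c) (flow_b c) T p = \<gamma> T p" if "(T, p) \<in> bfacs" for T p
  proof -
    have T: "T \<in> \<T>" "p \<in> verts T" using that by (auto simp: bfacs_def)
    show ?thesis using flow_bflux[OF T, of c] c(2) that area_fac_pos[OF T] by simp
  qed
  have "rt_field (flow_a c) (flow_b c) \<in> K_star \<Omega> \<Gamma> \<T> f \<alpha> \<beta>"
    unfolding K_star_rep[OF rt_rep_field]
  proof (intro conjI ballI allI impI)
    fix \<phi> assume "\<phi> \<in> test_functions \<Omega>"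
    from flow_weak_div[OF _ _ this, of c "\<lambda>T. const_proj (lebesgue_on T) f"] c(1,3)
    show "(\<Sum>T\<in>\<T>. LINT x|lebesgue_on T. (flow_a c T + flow_b c T *\<^sub>R x) \<bullet> grad \<phi> x)
        = - (\<Sum>T\<in>\<T>. const_proj (lebesgue_on T) f * (LINT x|lebesgue_on T. \<phi> x))" by blast
  qed (use fl bounds in auto)
  then show ?thesis by blast
qed

text \<open>Facets have finite area, so square-integrable functions are integrable over them, and the projection
  to the constants is the mean.\<close>

lemma pi_h_mono:
  assumes \<Gamma>: "openin (top_of_set (frontier \<Omega>)) \<Gamma>"
    and \<alpha>: "\<alpha> \<in> L2 (surface_on \<Gamma>)" and \<beta>: "\<beta> \<in> L2 (surface_on \<Gamma>)" and le: "AE x in surface_on \<Gamma>. \<alpha> x \<le> \<beta> x"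
    and T: "T \<in> \<T>" "p \<in> verts T"
  shows "pi_h \<Gamma> \<alpha> (fac T p) \<le> pi_h \<Gamma> \<beta> (fac T p)"
proof -
  let ?S = "fac T p"
  note sT = simplex[OF T(1)]
  obtain U where U: "open U" "\<Gamma> = U \<inter> frontier \<Omega>" using \<Gamma> by (auto simp: openin_open)
  have "\<Gamma> \<in> sets borel" unfolding U(2) using U(1) by (intro sets.Int) auto
  then have G: "\<Gamma> \<in> sets surface_measure" by (auto intro: sets_completionI_sets)
  have S: "?S \<in> sets surface_measure" by (rule fac_measurable[OF T(1)])
  have "emeasure surface_measure ?S < \<infinity>"
    using emeasure_fac[OF sT T(2)] borel_compact[OF compact_fac[OF sT], of p] by simp
  then have fin: "finite_measure (surface_on ?S)"
    using S by (intro finite_measureI) (simp add: space_restrict_space emeasure_restrict_space less_top)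
  have m: "measure (surface_on ?S) (space (surface_on ?S)) = area ?S"
    using S by (simp add: space_restrict_space measure_restrict_space)
  have i: "integrable (surface_on ?S) (\<lambda>x. indicator \<Gamma> x * g x)" if g: "g \<in> L2 (surface_on \<Gamma>)" for g :: "real^'n \<Rightarrow> real"
  proof -
    interpret finite_measure "surface_on ?S" by fact
    have "(\<lambda>x. indicator \<Gamma> x *\<^sub>R g x) \<in> borel_measurable surface_measure"
      using g G by (subst borel_measurable_restrict_space_iff[symmetric]) (auto simp: L2_def)
    then have ms: "(\<lambda>x. indicator \<Gamma> x * g x) \<in> borel_measurable (surface_on ?S)"
      by (intro measurable_restrict_space1) simp
    have "integrable surface_measure (\<lambda>x. indicator \<Gamma> x *\<^sub>R (norm (g x))\<^sup>2)"
      using g G by (subst integrable_restrict_space[symmetric]) (auto simp: L2_def)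
    then have "integrable surface_measure (\<lambda>x. indicator ?S x *\<^sub>R (indicator \<Gamma> x *\<^sub>R (norm (g x))\<^sup>2))"
      by (rule integrable_mult_indicator[OF S])
    then have "integrable (surface_on ?S) (\<lambda>x. indicator \<Gamma> x * (g x)\<^sup>2)"
      using S by (subst integrable_restrict_space) auto
    then have "integrable (surface_on ?S) (\<lambda>x. 1 + indicator \<Gamma> x * (g x)\<^sup>2)" by simp
    then show ?thesis
    proof (rule Bochner_Integration.integrable_bound[OF _ ms])
      have "\<bar>t\<bar> \<le> 1 + t\<^sup>2" for t :: real
        using zero_le_power2[of "\<bar>t\<bar> - 1"] by (simp add: power2_diff)
      then show "AE x in surface_on ?S. norm (indicator \<Gamma> x * g x) \<le> norm (1 + indicator \<Gamma> x * (g x)\<^sup>2)"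
        by (intro AE_I2) (auto simp: indicator_def)
    qed
  qed
  have pos: "0 < area ?S" by (rule area_fac_pos[OF T])
  have pi: "pi_h \<Gamma> g ?S = (LINT x|surface_on ?S. indicator \<Gamma> x * g x) /\<^sub>R area ?S" if "g \<in> L2 (surface_on \<Gamma>)" for g
    unfolding pi_h_def using const_proj_eq_mean[OF fin _ i[OF that]] pos unfolding m by simp
  have "AE x in surface_measure. x \<in> \<Gamma> \<longrightarrow> \<alpha> x \<le> \<beta> x"
    using le G by (subst (asm) AE_restrict_space_iff) auto
  then have "AE x in surface_measure. x \<in> ?S \<longrightarrow> indicator \<Gamma> x * \<alpha> x \<le> indicator \<Gamma> x * \<beta> x"
    by eventually_elim (auto simp: indicator_def)
  then have "AE x in surface_on ?S. indicator \<Gamma> x * \<alpha> x \<le> indicator \<Gamma> x * \<beta> x"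
    using S by (subst AE_restrict_space_iff) auto
  then have "(LINT x|surface_on ?S. indicator \<Gamma> x * \<alpha> x) \<le> (LINT x|surface_on ?S. indicator \<Gamma> x * \<beta> x)"
    by (rule integral_mono_AE[OF i[OF \<alpha>] i[OF \<beta>]])
  then show ?thesis unfolding pi[OF \<alpha>] pi[OF \<beta>] using pos by (intro scaleR_left_mono) auto
qed

text \<open>A boundary facet without constraint absorbs the difference between the sources and the fluxes
  prescribed on the other facets. If there is no such facet, a convex combination of the lower and
  the upper bounds has the required total flux.\<close>

lemma K_star_nonempty:
  assumes le: "\<And>T p. (T, p) \<in> bfacs \<Longrightarrow> pi_h \<Gamma> \<alpha> (fac T p) \<le> pi_h \<Gamma> \<beta> (fac T p)"
    and compat: "(\<exists>(T, p)\<in>bfacs. \<not> fac T p \<subseteq> closure \<Gamma>) \<or>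
      (\<Sum>(T, p)\<in>bfacs. area (fac T p) * pi_h \<Gamma> \<alpha> (fac T p)) \<le> (\<Sum>T\<in>\<T>. vol T * const_proj (lebesgue_on T) f) \<and>
      (\<Sum>T\<in>\<T>. vol T * const_proj (lebesgue_on T) f) \<le> (\<Sum>(T, p)\<in>bfacs. area (fac T p) * pi_h \<Gamma> \<beta> (fac T p))"
  shows "K_star \<Omega> \<Gamma> \<T> f \<alpha> \<beta> \<noteq> {}"
  using compat
proof
  let ?F = "\<Sum>T\<in>\<T>. vol T * const_proj (lebesgue_on T) f"
  assume "\<exists>(T, p)\<in>bfacs. \<not> fac T p \<subseteq> closure \<Gamma>"
  then obtain T0 p0 where T0: "(T0, p0) \<in> bfacs" "\<not> fac T0 p0 \<subseteq> closure \<Gamma>" by auto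
  have A: "0 < area (fac T0 p0)" using T0(1) area_fac_pos by (auto simp: bfacs_def)
  define R where "R = (?F - (\<Sum>(T, p)\<in>bfacs - {(T0, p0)}. area (fac T p) * pi_h \<Gamma> \<alpha> (fac T p))) / area (fac T0 p0)"
  define \<gamma> where "\<gamma> T p = (if (T, p) = (T0, p0) then R else pi_h \<Gamma> \<alpha> (fac T p))" for T p
  show ?thesis
  proof (rule admissible_from_boundary_data)
    have "(\<Sum>(T, p)\<in>bfacs. area (fac T p) * \<gamma> T p) = area (fac T0 p0) * \<gamma> T0 p0 + (\<Sum>(T, p)\<in>bfacs - {(T0, p0)}. area (fac T p) * \<gamma> T p)"
      using sum.remove[OF finite_bfacs T0(1), of "\<lambda>(T, p). area (fac T p) * \<gamma> T p"] by simp
    also have "(\<Sum>(T, p)\<in>bfacs - {(T0, p0)}. area (fac T p) * \<gamma> T p) = (\<Sum>(T, p)\<in>bfacs - {(T0, p0)}. area (fac T p) * pi_h \<Gamma> \<alpha> (fac T p))"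
    proof (intro sum.cong refl)
      fix y assume "y \<in> bfacs - {(T0, p0)}"
      then have "(fst y, snd y) \<noteq> (T0, p0)" by auto
      then have "\<gamma> (fst y) (snd y) = pi_h \<Gamma> \<alpha> (fac (fst y) (snd y))" unfolding \<gamma>_def by (rule if_not_P)
      then show "(case y of (T, p) \<Rightarrow> area (fac T p) * \<gamma> T p) = (case y of (T, p) \<Rightarrow> area (fac T p) * pi_h \<Gamma> \<alpha> (fac T p))"
        by (simp add: case_prod_unfold)
    qed
    also have "area (fac T0 p0) * \<gamma> T0 p0 = ?F - (\<Sum>(T, p)\<in>bfacs - {(T0, p0)}. area (fac T p) * pi_h \<Gamma> \<alpha> (fac T p))"
      using A by (simp add: \<gamma>_def R_def)
    finally show "(\<Sum>(T, p)\<in>bfacs. area (fac T p) * \<gamma> T p) = ?F" by simp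
    show "pi_h \<Gamma> \<alpha> (fac T p) \<le> \<gamma> T p \<and> \<gamma> T p \<le> pi_h \<Gamma> \<beta> (fac T p)"
      if "(T, p) \<in> bfacs" "fac T p \<subseteq> closure \<Gamma>" for T p
      using le[OF that(1)] that(2) T0(2) by (auto simp: \<gamma>_def)
  qed
next
  let ?F = "\<Sum>T\<in>\<T>. vol T * const_proj (lebesgue_on T) f"
  let ?S = "\<lambda>g. \<Sum>(T, p)\<in>bfacs. area (fac T p) * pi_h \<Gamma> g (fac T p)"
  assume F: "?S \<alpha> \<le> ?F \<and> ?F \<le> ?S \<beta>"
  obtain t where t: "0 \<le> t" "t \<le> 1" "(1 - t) * ?S \<alpha> + t * ?S \<beta> = ?F"
  proof (cases "?S \<alpha> = ?S \<beta>")
    case True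
    then show thesis using F that[of 0] by simp
  next
    case False
    then have "0 < ?S \<beta> - ?S \<alpha>" using F by linarith
    moreover define t where "t = (?F - ?S \<alpha>) / (?S \<beta> - ?S \<alpha>)"
    ultimately have "0 \<le> t" "t \<le> 1" "t * (?S \<beta> - ?S \<alpha>) = ?F - ?S \<alpha>" using F by (auto simp: divide_le_eq_1)
    then show thesis using that[of t] by (simp add: algebra_simps)
  qed
  define \<gamma> where "\<gamma> T p = (1 - t) * pi_h \<Gamma> \<alpha> (fac T p) + t * pi_h \<Gamma> \<beta> (fac T p)" for T p
  show ?thesis
  proof (rule admissible_from_boundary_data)
    have "(\<Sum>(T, p)\<in>bfacs. area (fac T p) * \<gamma> T p) = (1 - t) * ?S \<alpha> + t * ?S \<beta>"
      by (simp add: \<gamma>_def case_prod_unfold sum_distrib_left sum.distrib[symmetric] algebra_simps)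
    then show "(\<Sum>(T, p)\<in>bfacs. area (fac T p) * \<gamma> T p) = ?F" using t(3) by simp
    show "pi_h \<Gamma> \<alpha> (fac T p) \<le> \<gamma> T p \<and> \<gamma> T p \<le> pi_h \<Gamma> \<beta> (fac T p)" if "(T, p) \<in> bfacs" for T p
    proof -
      let ?d = "pi_h \<Gamma> \<beta> (fac T p) - pi_h \<Gamma> \<alpha> (fac T p)"
      have d: "0 \<le> ?d" using le[OF that] by simp
      have "\<gamma> T p = pi_h \<Gamma> \<alpha> (fac T p) + t * ?d" by (simp add: \<gamma>_def algebra_simps)
      moreover have "0 \<le> t * ?d" by (rule mult_nonneg_nonneg[OF t(1) d])
      moreover have "t * ?d \<le> ?d" using mult_right_mono[OF t(2) d] by simp
      ultimately show ?thesis by (intro conjI) linarith+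
    qed
  qed
qed

end


section \<open>Minimisation of strongly convex functionals\<close>

text \<open>By strong convexity a minimising sequence is a Cauchy sequence in each of the finitely many
  coordinates.\<close>

lemma strongly_convex_minimiser:
  fixes X :: "('i \<Rightarrow> 'a::banach) set" and J :: "('i \<Rightarrow> 'a) \<Rightarrow> real"
  assumes I: "finite I" and ne: "X \<noteq> {}" and k: "0 < k" and below: "\<And>a. a \<in> X \<Longrightarrow> m \<le> J a"
    and mid: "\<And>a b. a \<in> X \<Longrightarrow> b \<in> X \<Longrightarrow> (\<lambda>i. (1/2) *\<^sub>R (a i + b i)) \<in> X"
    and strong: "\<And>a b. a \<in> X \<Longrightarrow> b \<in> X \<Longrightarrow>
      J (\<lambda>i. (1/2) *\<^sub>R (a i + b i)) \<le> (J a + J b) / 2 - k * (\<Sum>i\<in>I. (norm (a i - b i))\<^sup>2)"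
    and closed: "\<And>s a. (\<And>n::nat. s n \<in> X) \<Longrightarrow> (\<And>i. i \<in> I \<Longrightarrow> (\<lambda>n. s n i) \<longlonglongrightarrow> a i) \<Longrightarrow> a \<in> X"
    and cont: "\<And>s a. (\<And>n::nat. s n \<in> X) \<Longrightarrow> (\<And>i. i \<in> I \<Longrightarrow> (\<lambda>n. s n i) \<longlonglongrightarrow> a i) \<Longrightarrow> (\<lambda>n. J (s n)) \<longlonglongrightarrow> J a"
  shows "\<exists>a\<in>X. (\<forall>b\<in>X. J a \<le> J b) \<and> (\<forall>b\<in>X. J b = J a \<longrightarrow> (\<forall>i\<in>I. b i = a i))"
proof -
  define M where "M = Inf (J ` X)"
  have bdd: "bdd_below (J ` X)" using below by (auto simp: bdd_below_def)
  have M_le: "M \<le> J a" if "a \<in> X" for a unfolding M_def using bdd that by (intro cInf_lower) auto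
  have "\<exists>a\<in>X. J a < M + 1 / real (Suc n)" for n
    using cInf_lessD[of "J ` X" "M + 1 / real (Suc n)"] ne by (auto simp: M_def)
  then obtain s where s: "\<And>n. s n \<in> X" "\<And>n. J (s n) < M + 1 / real (Suc n)" by metis
  have est: "k * (norm (a i - b i))\<^sup>2 \<le> (J a + J b) / 2 - M" if "a \<in> X" "b \<in> X" "i \<in> I" for a b i
  proof -
    have "(norm (a i - b i))\<^sup>2 \<le> (\<Sum>i\<in>I. (norm (a i - b i))\<^sup>2)" using I that(3) by (intro member_le_sum) auto
    then have "k * (norm (a i - b i))\<^sup>2 \<le> k * (\<Sum>i\<in>I. (norm (a i - b i))\<^sup>2)" using k by simp
    also have "\<dots> \<le> (J a + J b) / 2 - J (\<lambda>i. (1/2) *\<^sub>R (a i + b i))" using strong[OF that(1,2)] by simp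
    also have "\<dots> \<le> (J a + J b) / 2 - M" using M_le[OF mid[OF that(1,2)]] by simp
    finally show ?thesis .
  qed
  have "Cauchy (\<lambda>n. s n i)" if i: "i \<in> I" for i
  proof (rule CauchyI)
    fix e :: real assume e: "0 < e"
    define r where "r n = 1 / real (Suc n)" for n
    have sr: "J (s n) < M + r n" for n using s(2)[of n] unfolding r_def .
    have "0 < k * e\<^sup>2" using e k by simp
    then obtain N where "1 / real (Suc N) < k * e\<^sup>2" by (rule nat_approx_posE)
    then have N: "r N < k * e\<^sup>2" unfolding r_def .
    have "norm (s p i - s q i) < e" if "N \<le> p" "N \<le> q" for p q
    proof -
      have mono: "r p \<le> r N" "r q \<le> r N"
        using that unfolding r_def by (auto intro!: divide_left_mono)
      have "k * (norm (s p i - s q i))\<^sup>2 \<le> (J (s p) + J (s q)) / 2 - M" using est[OF s(1) s(1) i] .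
      also have "\<dots> < k * e\<^sup>2"
      proof -
        have "J (s p) < M + r N" using sr[of p] mono(1) by simp
        moreover have "J (s q) < M + r N" using sr[of q] mono(2) by simp
        ultimately have "J (s p) + J (s q) < (M + r N) + (M + r N)" by (rule add_strict_mono)
        then have "(J (s p) + J (s q)) / 2 - M < r N" by (simp add: field_simps)
        also have "r N < k * e\<^sup>2" by (rule N)
        finally show ?thesis .
      qed
      finally have "(norm (s p i - s q i))\<^sup>2 < e\<^sup>2" using k by simp
      then show ?thesis using e by (simp add: power2_less_imp_less)
    qed
    then show "\<exists>N. \<forall>p\<ge>N. \<forall>q\<ge>N. norm (s p i - s q i) < e" by blast
  qed
  then have conv: "\<exists>l. (\<lambda>n. s n i) \<longlonglongrightarrow> l" if "i \<in> I" for i using that Cauchy_convergent_iff convergent_def by blast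
  define a where "a i = (SOME l. (\<lambda>n. s n i) \<longlonglongrightarrow> l)" for i
  have a: "(\<lambda>n. s n i) \<longlonglongrightarrow> a i" if "i \<in> I" for i unfolding a_def using someI_ex[OF conv[OF that]] .
  have aX: "a \<in> X" by (rule closed[OF s(1) a])
  have Ja: "(\<lambda>n. J (s n)) \<longlonglongrightarrow> J a" by (rule cont[OF s(1) a])
  have "(\<lambda>n. M + 1 / real (Suc n)) \<longlonglongrightarrow> M + 0" by (intro tendsto_add tendsto_const LIMSEQ_Suc[OF lim_1_over_n])
  then have "J a \<le> M + 0" using s(2) by (intro LIMSEQ_le[OF Ja]) (auto intro: less_imp_le)
  then have JM: "J a = M" using M_le[OF aX] by simp
  have "b i = a i" if "b \<in> X" "J b = J a" "i \<in> I" for b i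
  proof -
    have "k * (norm (b i - a i))\<^sup>2 \<le> 0" using est[OF that(1) aX that(3)] that(2) JM by simp
    then show ?thesis using k by (simp add: mult_le_0_iff)
  qed
  then show ?thesis using aX M_le JM by (intro bexI[of _ a]) auto
qed

section \<open>The discrete dual problem\<close>

context mesh
begin

text \<open>The negative of the dual functional at the piecewise field with coefficients \<open>a\<close> and \<open>b\<close>. The weights
  \<open>\<kappa>\<close> stand for the Dirichlet data.\<close>

definition energy :: "((real^'n) set \<Rightarrow> real^'n^'n) \<Rightarrow> ((real^'n) set \<Rightarrow> real^'n \<Rightarrow> real) \<Rightarrow>
    ((real^'n) set \<Rightarrow> real) \<Rightarrow> ((real^'n) set \<Rightarrow> real^'n) \<Rightarrow> real" where
  "energy B \<kappa> b a = (1/2) * (\<Sum>T\<in>\<T>. vol T * (norm (B T *v (a T + b T *\<^sub>R centroid T)))\<^sup>2)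
     + (\<Sum>(T, p)\<in>bfacs. \<kappa> T p * bflux a b T p)"

lemma parallelogram_midpoint:
  fixes x y :: "'a::real_inner"
  shows "(norm ((1/2) *\<^sub>R (x + y)))\<^sup>2 = ((norm x)\<^sup>2 + (norm y)\<^sup>2) / 2 - (norm (x - y))\<^sup>2 / 4"
  unfolding power2_norm_eq_inner
  by (simp add: inner_add_left inner_add_right inner_diff_left inner_diff_right inner_commute field_simps)

text \<open>An injective linear map is bounded below, and there are finitely many elements.\<close>

lemma injective_matrix_bounds:
  assumes inj: "\<And>T x. T \<in> \<T> \<Longrightarrow> B T *v x = 0 \<Longrightarrow> x = (0::real^'n)"
  obtains k where "0 < k" "\<And>T x. T \<in> \<T> \<Longrightarrow> k * (norm x)\<^sup>2 \<le> vol T * (norm (B T *v x))\<^sup>2"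
proof -
  have "\<exists>k>0. \<forall>x. k * (norm x)\<^sup>2 \<le> vol T * (norm (B T *v x))\<^sup>2" if T: "T \<in> \<T>" for T
  proof -
    have "inj ((*v) (B T))" using inj[OF T] by (subst linear_injective_0[OF matrix_vector_mul_linear]) auto
    then obtain c where c: "0 < c" "\<And>x. c * norm x \<le> norm (B T *v x)"
      using linear_inj_bounded_below_pos[OF matrix_vector_mul_linear] by blast
    have V: "0 < vol T" by (rule vol_full_simplex_pos[OF simplex[OF T]])
    have "(vol T * c\<^sup>2) * (norm x)\<^sup>2 \<le> vol T * (norm (B T *v x))\<^sup>2" for x
    proof -
      have "(c * norm x)\<^sup>2 \<le> (norm (B T *v x))\<^sup>2" using c by (intro power_mono) auto
      then show ?thesis using V by (simp add: power_mult_distrib mult.assoc)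
    qed
    then show ?thesis using V c(1) by (intro exI[of _ "vol T * c\<^sup>2"]) auto
  qed
  then obtain k where k: "\<And>T. T \<in> \<T> \<Longrightarrow> 0 < k T" "\<And>T x. T \<in> \<T> \<Longrightarrow> k T * (norm x)\<^sup>2 \<le> vol T * (norm (B T *v x))\<^sup>2" by metis
  define K where "K = Min (insert 1 (k ` \<T>))"
  have "0 < K" unfolding K_def using finite_mesh k(1) by (subst Min_gr_iff) auto
  moreover have "K * (norm x)\<^sup>2 \<le> vol T * (norm (B T *v x))\<^sup>2" if "T \<in> \<T>" for T x
  proof -
    have "K \<le> k T" unfolding K_def using finite_mesh that by (intro Min_le) auto
    then show ?thesis using k(2)[OF that, of x] by (meson mult_right_mono order_trans zero_le_power2)
  qed
  ultimately show thesis by (rule that)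
qed

lemma bflux_midpoint: "bflux (\<lambda>T. (1/2) *\<^sub>R (a T + a' T)) b T p = (bflux a b T p + bflux a' b T p) / 2"
  by (simp add: bflux_def inner_add_left inner_diff_left field_simps)

text \<open>The quadratic part satisfies the parallelogram identity, and the fluxes are affine in \<open>a\<close>.\<close>

lemma energy_strongly_convex:
  assumes k: "\<And>T x. T \<in> \<T> \<Longrightarrow> k * (norm x)\<^sup>2 \<le> vol T * (norm (B T *v x))\<^sup>2"
  shows "energy B \<kappa> b (\<lambda>T. (1/2) *\<^sub>R (a T + a' T)) \<le> (energy B \<kappa> b a + energy B \<kappa> b a') / 2 - (k / 8) * (\<Sum>T\<in>\<T>. (norm (a T - a' T))\<^sup>2)"
proof -
  let ?q = "\<lambda>a T. vol T * (norm (B T *v (a T + b T *\<^sub>R centroid T)))\<^sup>2"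
  have quad: "?q (\<lambda>T. (1/2) *\<^sub>R (a T + a' T)) T \<le> (?q a T + ?q a' T) / 2 - (k / 4) * (norm (a T - a' T))\<^sup>2" if T: "T \<in> \<T>" for T
  proof -
    let ?x = "B T *v (a T + b T *\<^sub>R centroid T)" and ?y = "B T *v (a' T + b T *\<^sub>R centroid T)"
    have "(1/2) *\<^sub>R (a T + a' T) + b T *\<^sub>R centroid T = (1/2) *\<^sub>R ((a T + b T *\<^sub>R centroid T) + (a' T + b T *\<^sub>R centroid T))"
    proof -
      have "(1/2) *\<^sub>R ((a T + b T *\<^sub>R centroid T) + (a' T + b T *\<^sub>R centroid T))
          = (1/2) *\<^sub>R (a T + a' T) + (1/2) *\<^sub>R (b T *\<^sub>R centroid T + b T *\<^sub>R centroid T)"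
        by (simp only: scaleR_add_right add_ac)
      then show ?thesis by (simp only: scaleR_half_double)
    qed
    then have m: "B T *v ((1/2) *\<^sub>R (a T + a' T) + b T *\<^sub>R centroid T) = (1/2) *\<^sub>R (?x + ?y)"
      by (simp only: matrix_vector_mult_scaleR matrix_vector_right_distrib)
    have d: "?x - ?y = B T *v (a T - a' T)" by (simp flip: matrix_vector_mult_diff_distrib)
    have "?q (\<lambda>T. (1/2) *\<^sub>R (a T + a' T)) T = (?q a T + ?q a' T) / 2 - (vol T * (norm (B T *v (a T - a' T)))\<^sup>2) / 4"
      unfolding m parallelogram_midpoint d by (simp add: algebra_simps add_divide_distrib)
    then show ?thesis using k[OF T, of "a T - a' T"] by simp
  qed
  have "(\<Sum>T\<in>\<T>. ?q (\<lambda>T. (1/2) *\<^sub>R (a T + a' T)) T) \<le> (\<Sum>T\<in>\<T>. (?q a T + ?q a' T) / 2 - (k / 4) * (norm (a T - a' T))\<^sup>2)"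
    by (intro sum_mono quad)
  also have "\<dots> = ((\<Sum>T\<in>\<T>. ?q a T) + (\<Sum>T\<in>\<T>. ?q a' T)) / 2 - (k / 4) * (\<Sum>T\<in>\<T>. (norm (a T - a' T))\<^sup>2)"
    by (simp add: sum_subtractf sum.distrib sum_distrib_left sum_divide_distrib add_divide_distrib)
  finally have 1: "(\<Sum>T\<in>\<T>. ?q (\<lambda>T. (1/2) *\<^sub>R (a T + a' T)) T) \<le> \<dots>" .
  have 2: "(\<Sum>(T, p)\<in>bfacs. \<kappa> T p * bflux (\<lambda>T. (1/2) *\<^sub>R (a T + a' T)) b T p)
      = ((\<Sum>(T, p)\<in>bfacs. \<kappa> T p * bflux a b T p) + (\<Sum>(T, p)\<in>bfacs. \<kappa> T p * bflux a' b T p)) / 2"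
    unfolding bflux_midpoint case_prod_unfold
    by (simp add: sum.distrib[symmetric] sum_divide_distrib algebra_simps)
  show ?thesis unfolding energy_def 2 using 1 by (simp add: field_simps)
qed

text \<open>The fluxes grow at most linearly in \<open>a\<close> and are dominated by the quadratic part.\<close>

lemma energy_bounded_below:
  assumes k: "\<And>T x. T \<in> \<T> \<Longrightarrow> k * (norm x)\<^sup>2 \<le> vol T * (norm (B T *v x))\<^sup>2" and k0: "0 < k"
  shows "\<exists>m. \<forall>a. m \<le> energy B \<kappa> b a"
proof -
  define z where "z a T = norm (a T + b T *\<^sub>R centroid T)" for a T
  define L where "L = (\<Sum>(T, p)\<in>bfacs. \<bar>\<kappa> T p\<bar>)"
  define C where "C = (\<Sum>(T, p)\<in>bfacs. \<bar>\<kappa> T p\<bar> * (norm (b T *\<^sub>R centroid T) + \<bar>b T * facet_offset T p\<bar>))"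
  have flux: "\<kappa> T p * bflux a b T p \<ge> - (\<bar>\<kappa> T p\<bar> * (\<Sum>T\<in>\<T>. z a T)) - \<bar>\<kappa> T p\<bar> * (norm (b T *\<^sub>R centroid T) + \<bar>b T * facet_offset T p\<bar>)"
    if "(T, p) \<in> bfacs" for T p a
  proof -
    have T: "T \<in> \<T>" "p \<in> verts T" using that by (auto simp: bfacs_def)
    have "\<bar>a T \<bullet> (- inner_normal T p)\<bar> \<le> norm (a T)"
      using Cauchy_Schwarz_ineq2[of "a T" "- inner_normal T p"] norm_inner_normal[OF simplex[OF T(1)] T(2)] by simp
    also have "\<dots> \<le> z a T + norm (b T *\<^sub>R centroid T)"
      using norm_triangle_ineq4[of "a T + b T *\<^sub>R centroid T" "b T *\<^sub>R centroid T"] by (simp add: z_def)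
    also have "z a T \<le> (\<Sum>T\<in>\<T>. z a T)" using finite_mesh T(1) by (intro member_le_sum) (auto simp: z_def)
    finally have "\<bar>bflux a b T p\<bar> \<le> (\<Sum>T\<in>\<T>. z a T) + (norm (b T *\<^sub>R centroid T) + \<bar>b T * facet_offset T p\<bar>)"
      unfolding bflux_def by linarith
    then have "\<bar>\<kappa> T p\<bar> * \<bar>bflux a b T p\<bar> \<le> \<bar>\<kappa> T p\<bar> * ((\<Sum>T\<in>\<T>. z a T) + (norm (b T *\<^sub>R centroid T) + \<bar>b T * facet_offset T p\<bar>))"
      by (intro mult_left_mono) auto
    moreover have "- (\<bar>\<kappa> T p\<bar> * \<bar>bflux a b T p\<bar>) \<le> \<kappa> T p * bflux a b T p"
      using abs_ge_minus_self[of "\<kappa> T p * bflux a b T p"] by (simp add: abs_mult)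
    ultimately show ?thesis by (simp add: distrib_left)
  qed
  have "- real (card \<T>) * (L\<^sup>2 / (2 * k)) - C \<le> energy B \<kappa> b a" for a
  proof -
    have "(\<Sum>(T, p)\<in>bfacs. - (\<bar>\<kappa> T p\<bar> * (\<Sum>T\<in>\<T>. z a T)) - \<bar>\<kappa> T p\<bar> * (norm (b T *\<^sub>R centroid T) + \<bar>b T * facet_offset T p\<bar>))
        \<le> (\<Sum>(T, p)\<in>bfacs. \<kappa> T p * bflux a b T p)"
      by (intro sum_mono) (use flux in auto)
    moreover have "(\<Sum>(T, p)\<in>bfacs. - (\<bar>\<kappa> T p\<bar> * (\<Sum>T\<in>\<T>. z a T)) - \<bar>\<kappa> T p\<bar> * (norm (b T *\<^sub>R centroid T) + \<bar>b T * facet_offset T p\<bar>))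
        = - (L * (\<Sum>T\<in>\<T>. z a T)) - C"
      unfolding L_def C_def case_prod_unfold by (simp add: sum_subtractf sum_negf sum_distrib_right)
    ultimately have 1: "- (L * (\<Sum>T\<in>\<T>. z a T)) - C \<le> (\<Sum>(T, p)\<in>bfacs. \<kappa> T p * bflux a b T p)" by simp
    have pt: "- (L\<^sup>2 / (2 * k)) \<le> (1/2) * (vol T * (norm (B T *v (a T + b T *\<^sub>R centroid T)))\<^sup>2) - L * z a T" if "T \<in> \<T>" for T
    proof -
      have "0 \<le> (k * z a T - L)\<^sup>2 / (2 * k)" using k0 by simp
      also have "\<dots> = (1/2) * (k * (z a T)\<^sup>2) - L * z a T + L\<^sup>2 / (2 * k)"
        using k0 by (simp add: power2_eq_square field_simps)
      finally show ?thesis using k[OF that, of "a T + b T *\<^sub>R centroid T"] by (simp add: z_def)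
    qed
    have "(\<Sum>T\<in>\<T>. - (L\<^sup>2 / (2 * k))) \<le> (\<Sum>T\<in>\<T>. (1/2) * (vol T * (norm (B T *v (a T + b T *\<^sub>R centroid T)))\<^sup>2) - L * z a T)"
      by (intro sum_mono pt)
    also have "\<dots> = (1/2) * (\<Sum>T\<in>\<T>. vol T * (norm (B T *v (a T + b T *\<^sub>R centroid T)))\<^sup>2) - L * (\<Sum>T\<in>\<T>. z a T)"
      by (simp add: sum_subtractf sum_distrib_left)
    finally show ?thesis using 1 by (simp add: energy_def)
  qed
  then show ?thesis by blast
qed

lemma tendsto_bflux: "(\<lambda>n. s n T) \<longlonglongrightarrow> a T \<Longrightarrow> (\<lambda>n::nat. bflux (s n) b T p) \<longlonglongrightarrow> bflux a b T p"
  unfolding bflux_def by (intro tendsto_intros)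

lemma tendsto_energy:
  assumes "\<And>T. T \<in> \<T> \<Longrightarrow> (\<lambda>n::nat. s n T) \<longlonglongrightarrow> a T"
  shows "(\<lambda>n. energy B \<kappa> b (s n)) \<longlonglongrightarrow> energy B \<kappa> b a"
proof -
  have "(\<lambda>n. \<Sum>T\<in>\<T>. vol T * (norm (B T *v (s n T + b T *\<^sub>R centroid T)))\<^sup>2) \<longlonglongrightarrow> (\<Sum>T\<in>\<T>. vol T * (norm (B T *v (a T + b T *\<^sub>R centroid T)))\<^sup>2)"
  proof (intro tendsto_sum tendsto_mult tendsto_power tendsto_norm tendsto_const)
    fix T assume "T \<in> \<T>"
    have "bounded_linear ((*v) (B T))" by (simp add: linear_conv_bounded_linear[symmetric])
    from bounded_linear.tendsto[OF this tendsto_add[OF assms[OF \<open>T \<in> \<T>\<close>] tendsto_const]]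
    show "(\<lambda>n. B T *v (s n T + b T *\<^sub>R centroid T)) \<longlonglongrightarrow> B T *v (a T + b T *\<^sub>R centroid T)" .
  qed
  moreover have "(\<lambda>n. \<Sum>(T, p)\<in>bfacs. \<kappa> T p * bflux (s n) b T p) \<longlonglongrightarrow> (\<Sum>(T, p)\<in>bfacs. \<kappa> T p * bflux a b T p)"
    unfolding case_prod_unfold
    by (intro tendsto_sum tendsto_mult tendsto_const tendsto_bflux assms) (auto simp: bfacs_def)
  ultimately show ?thesis unfolding energy_def by (intro tendsto_add tendsto_mult tendsto_const)
qed

text \<open>The conditions that define the admissible coefficients are affine and closed.\<close>

lemma admissible_midpoint:
  assumes "rt_field a b \<in> K_star \<Omega> \<Gamma> \<T> f \<alpha> \<beta>" "rt_field a' b \<in> K_star \<Omega> \<Gamma> \<T> f \<alpha> \<beta>"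
  shows "rt_field (\<lambda>T. (1/2) *\<^sub>R (a T + a' T)) b \<in> K_star \<Omega> \<Gamma> \<T> f \<alpha> \<beta>"
proof -
  let ?m = "\<lambda>T. (1/2) *\<^sub>R (a T + a' T)"
  note A = assms[unfolded K_star_rep[OF rt_rep_field]]
  show ?thesis unfolding K_star_rep[OF rt_rep_field]
  proof (intro conjI ballI allI impI)
    fix \<phi> assume \<phi>: "\<phi> \<in> test_functions \<Omega>"
    let ?I = "\<lambda>a T. LINT x|lebesgue_on T. (a T + b T *\<^sub>R x) \<bullet> grad \<phi> x"
    have "?I ?m T = (?I a T + ?I a' T) / 2" if T: "T \<in> \<T>" for T
    proof -
      have i: "integrable (lebesgue_on T) (\<lambda>x. (c + b T *\<^sub>R x) \<bullet> grad \<phi> x)" for c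
        using compact_full_simplex[OF simplex[OF T]] test_function_props(5)[OF \<phi>] by (intro lint_compact(1) continuous_intros)
      have "?I ?m T = (LINT x|lebesgue_on T. ((a T + b T *\<^sub>R x) \<bullet> grad \<phi> x + (a' T + b T *\<^sub>R x) \<bullet> grad \<phi> x) / 2)"
        by (intro Bochner_Integration.integral_cong refl) (simp add: inner_add_left field_simps)
      then show ?thesis using i by simp
    qed
    then have "(\<Sum>T\<in>\<T>. ?I ?m T) = ((\<Sum>T\<in>\<T>. ?I a T) + (\<Sum>T\<in>\<T>. ?I a' T)) / 2"
      by (simp add: sum.distrib sum_divide_distrib add_divide_distrib)
    then show "(\<Sum>T\<in>\<T>. ?I ?m T) = - (\<Sum>T\<in>\<T>. const_proj (lebesgue_on T) f * (LINT x|lebesgue_on T. \<phi> x))"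
      using A \<phi> by simp
  next
    fix T p assume "(T, p) \<in> bfacs" "fac T p \<subseteq> closure \<Gamma>"
    then have "pi_h \<Gamma> \<alpha> (fac T p) \<le> bflux a b T p \<and> bflux a b T p \<le> pi_h \<Gamma> \<beta> (fac T p)"
      "pi_h \<Gamma> \<alpha> (fac T p) \<le> bflux a' b T p \<and> bflux a' b T p \<le> pi_h \<Gamma> \<beta> (fac T p)" using A by blast+
    then show "pi_h \<Gamma> \<alpha> (fac T p) \<le> bflux ?m b T p" "bflux ?m b T p \<le> pi_h \<Gamma> \<beta> (fac T p)"
      unfolding bflux_midpoint by auto
  qed
qed

lemma admissible_limit:
  assumes s: "\<And>n::nat. rt_field (s n) b \<in> K_star \<Omega> \<Gamma> \<T> f \<alpha> \<beta>" and lim: "\<And>T. T \<in> \<T> \<Longrightarrow> (\<lambda>n. s n T) \<longlonglongrightarrow> a T"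
  shows "rt_field a b \<in> K_star \<Omega> \<Gamma> \<T> f \<alpha> \<beta>"
proof -
  note A = s[unfolded K_star_rep[OF rt_rep_field]]
  show ?thesis unfolding K_star_rep[OF rt_rep_field]
  proof (intro conjI ballI allI impI)
    fix \<phi> assume \<phi>: "\<phi> \<in> test_functions \<Omega>"
    let ?I = "\<lambda>a T. LINT x|lebesgue_on T. (a T + b T *\<^sub>R x) \<bullet> grad \<phi> x"
    let ?R = "- (\<Sum>T\<in>\<T>. const_proj (lebesgue_on T) f * (LINT x|lebesgue_on T. \<phi> x))"
    have "(\<lambda>n. ?I (s n) T) \<longlonglongrightarrow> ?I a T" if T: "T \<in> \<T>" for T
    proof -
      have i: "integrable (lebesgue_on T) (grad \<phi>)" "integrable (lebesgue_on T) (\<lambda>x. (b T *\<^sub>R x) \<bullet> grad \<phi> x)"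
        using compact_full_simplex[OF simplex[OF T]] test_function_props(5)[OF \<phi>] by (auto intro!: lint_compact(1) continuous_intros)
      have eq: "(LINT x|lebesgue_on T. (c + b T *\<^sub>R x) \<bullet> grad \<phi> x) = c \<bullet> (LINT x|lebesgue_on T. grad \<phi> x) + (LINT x|lebesgue_on T. (b T *\<^sub>R x) \<bullet> grad \<phi> x)" for c
        using i by (simp add: inner_add_left)
      show ?thesis unfolding eq by (intro tendsto_intros lim[OF T])
    qed
    then have "(\<lambda>n. \<Sum>T\<in>\<T>. ?I (s n) T) \<longlonglongrightarrow> (\<Sum>T\<in>\<T>. ?I a T)" by (intro tendsto_sum)
    moreover have "(\<Sum>T\<in>\<T>. ?I (s n) T) = ?R" for n using A \<phi> by blast
    ultimately show "(\<Sum>T\<in>\<T>. ?I a T) = ?R" by (simp add: LIMSEQ_const_iff)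
  next
    fix T p assume *: "(T, p) \<in> bfacs" "fac T p \<subseteq> closure \<Gamma>"
    then have "T \<in> \<T>" by (auto simp: bfacs_def)
    from tendsto_bflux[where s = s and a = a and T = T and b = b and p = p, OF lim[OF this]]
    have l: "(\<lambda>n. bflux (s n) b T p) \<longlonglongrightarrow> bflux a b T p" .
    show "pi_h \<Gamma> \<alpha> (fac T p) \<le> bflux a b T p" by (rule LIMSEQ_le_const[OF l]) (use A * in blast)
    show "bflux a b T p \<le> pi_h \<Gamma> \<beta> (fac T p)" by (rule LIMSEQ_le_const2[OF l]) (use A * in blast)
  qed
qed

lemma rt_rep_cong: "rt_rep v a b \<Longrightarrow> (\<And>T. T \<in> \<T> \<Longrightarrow> b T = b' T) \<Longrightarrow> rt_rep v a b'"
  by (simp add: rt_rep_def)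

text \<open>All admissible fields share the coefficient \<open>b\<close>, so the functional depends on \<open>a\<close> only.\<close>

lemma unique_minimiser:
  fixes D :: "(real^'n \<Rightarrow> real^'n) \<Rightarrow> real"
  assumes ne: "K_star \<Omega> \<Gamma> \<T> f \<alpha> \<beta> \<noteq> {}"
    and inj: "\<And>T x. T \<in> \<T> \<Longrightarrow> B T *v x = 0 \<Longrightarrow> x = (0::real^'n)"
    and D: "\<And>v a b. rt_rep v a b \<Longrightarrow> D v = - energy B \<kappa> b a"
  shows "\<exists>u\<in>K_star \<Omega> \<Gamma> \<T> f \<alpha> \<beta>. (\<forall>v\<in>K_star \<Omega> \<Gamma> \<T> f \<alpha> \<beta>. D v \<le> D u) \<and>
    (\<forall>v\<in>K_star \<Omega> \<Gamma> \<T> f \<alpha> \<beta>. D v = D u \<longrightarrow> (AE x in lebesgue_on \<Omega>. v x = u x))"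
proof -
  let ?K = "K_star \<Omega> \<Gamma> \<T> f \<alpha> \<beta>"
  define b where "b T = const_proj (lebesgue_on T) f / real CARD('n)" for T
  have rep: "\<exists>a. rt_rep v a b \<and> rt_field a b \<in> ?K" if v: "v \<in> ?K" for v
  proof -
    obtain a b' where r: "rt_rep v a b'" by (rule RT0_rep[of v]) (use v in \<open>auto simp: K_star_def\<close>)
    have r': "rt_rep v a b" by (rule rt_rep_cong[OF r]) (simp add: b_def K_star_coefficient[OF v r])
    have "rt_field a b \<in> ?K" using v unfolding K_star_rep[OF r'] K_star_rep[OF rt_rep_field] .
    then show ?thesis using r' by blast
  qed
  obtain k where k: "0 < k" "\<And>T x. T \<in> \<T> \<Longrightarrow> k * (norm x)\<^sup>2 \<le> vol T * (norm (B T *v x))\<^sup>2"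
    by (rule injective_matrix_bounds[OF inj]) (assumption | rule that)+
  obtain m where m: "\<And>a. m \<le> energy B \<kappa> b a" using energy_bounded_below[OF k(2,1)] by blast
  define X where "X = {a. rt_field a b \<in> ?K}"
  have "\<exists>a\<in>X. (\<forall>a'\<in>X. energy B \<kappa> b a \<le> energy B \<kappa> b a') \<and> (\<forall>a'\<in>X. energy B \<kappa> b a' = energy B \<kappa> b a \<longrightarrow> (\<forall>T\<in>\<T>. a' T = a T))"
  proof (rule strongly_convex_minimiser[where k = "k / 8" and m = m])
    show "finite \<T>" by (rule finite_mesh)
    show "X \<noteq> {}" using ne rep unfolding X_def by blast
    show "0 < k / 8" using k by simp
    show "m \<le> energy B \<kappa> b a" for a by (rule m)
    show "(\<lambda>T. (1/2) *\<^sub>R (a T + a' T)) \<in> X" if "a \<in> X" "a' \<in> X" for a a'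
      using that admissible_midpoint unfolding X_def by blast
    show "energy B \<kappa> b (\<lambda>T. (1/2) *\<^sub>R (a T + a' T)) \<le> (energy B \<kappa> b a + energy B \<kappa> b a') / 2 - k / 8 * (\<Sum>T\<in>\<T>. (norm (a T - a' T))\<^sup>2)" for a a'
      by (rule energy_strongly_convex[OF k(2)])
    show "a \<in> X" if "\<And>n::nat. s n \<in> X" "\<And>T. T \<in> \<T> \<Longrightarrow> (\<lambda>n. s n T) \<longlonglongrightarrow> a T" for s a
      using that admissible_limit[of s b] unfolding X_def by blast
    show "(\<lambda>n. energy B \<kappa> b (s n)) \<longlonglongrightarrow> energy B \<kappa> b a" if "\<And>T. T \<in> \<T> \<Longrightarrow> (\<lambda>n::nat. s n T) \<longlonglongrightarrow> a T" for s a
      by (rule tendsto_energy[OF that])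
  qed
  then obtain a where a: "rt_field a b \<in> ?K" "\<And>a'. rt_field a' b \<in> ?K \<Longrightarrow> energy B \<kappa> b a \<le> energy B \<kappa> b a'"
    "\<And>a' T. rt_field a' b \<in> ?K \<Longrightarrow> energy B \<kappa> b a' = energy B \<kappa> b a \<Longrightarrow> T \<in> \<T> \<Longrightarrow> a' T = a T"
    unfolding X_def by blast
  have Du: "D (rt_field a b) = - energy B \<kappa> b a" by (rule D[OF rt_rep_field])
  show ?thesis
  proof (intro bexI[OF _ a(1)] conjI ballI impI)
    fix v assume "v \<in> ?K"
    then obtain a' where a': "rt_rep v a' b" "rt_field a' b \<in> ?K" using rep by blast
    show "D v \<le> D (rt_field a b)" using a(2)[OF a'(2)] D[OF a'(1)] Du by simp
    assume "D v = D (rt_field a b)"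
    then have "energy B \<kappa> b a' = energy B \<kappa> b a" using D[OF a'(1)] Du by simp
    then have eq: "a' T = a T" if "T \<in> \<T>" for T using a(3)[OF a'(2)] that by blast
    show "AE x in lebesgue_on \<Omega>. v x = rt_field a b x"
      unfolding AE_dom_iff
    proof
      fix T assume T: "T \<in> \<T>"
      have "AE x in lebesgue_on T. v x = a' T + b T *\<^sub>R x" "AE x in lebesgue_on T. rt_field a b x = a T + b T *\<^sub>R x"
        using a'(1) rt_rep_field[of a b] T by (auto simp: rt_rep_def)
      then show "AE x in lebesgue_on T. v x = rt_field a b x" by eventually_elim (simp add: eq[OF T])
    qed
  qed
qed

end


theorem theorem5p2:
  fixes \<Omega> \<Gamma>D \<Gamma>C :: "(real^'n) set"
    and \<T> :: "(real^'n) set set"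
    and f pD phat \<alpha> \<beta> :: "real^'n \<Rightarrow> real"
    and K :: "real^'n \<Rightarrow> real^'n^'n"
    and k0 k1 :: real
  assumes dim: "CARD('n) = 2 \<or> CARD('n) = 3"
    and dom: "polyhedral_lipschitz_domain \<Omega>"
    and bdry: "openin (top_of_set (frontier \<Omega>)) \<Gamma>D"
      "openin (top_of_set (frontier \<Omega>)) \<Gamma>C"
      "\<Gamma>D \<inter> \<Gamma>C = {}"
      "frontier \<Omega> = closure \<Gamma>D \<union> closure \<Gamma>C"
    and f: "f \<in> L2 (lebesgue_on \<Omega>)"
    and pD: "pD \<in> H_half \<Omega> \<Gamma>D"
    and K_meas: "K \<in> borel_measurable (lebesgue_on \<Omega>)"
    and K_sym: "\<And>x. x \<in> \<Omega> \<Longrightarrow> transpose (K x) = K x"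
    and k01: "0 < k0" "k0 < k1"
    and K_bounds: "\<And>x \<xi>. x \<in> \<Omega> \<Longrightarrow>
      k0 * (norm \<xi>)\<^sup>2 \<le> \<xi> \<bullet> (K x *v \<xi>) \<and> \<xi> \<bullet> (K x *v \<xi>) \<le> k1 * (norm \<xi>)\<^sup>2"
    and \<alpha>\<beta>: "\<alpha> \<in> L2 (surface_on \<Gamma>C)" "\<beta> \<in> L2 (surface_on \<Gamma>C)"
      "AE x in surface_on \<Gamma>C. \<alpha> x \<le> \<beta> x"
    and mesh: "conforming_triangulation \<Omega> \<T>"
      "\<And>S. S \<in> boundary_facets \<Omega> \<T> \<Longrightarrow>
        (S \<subseteq> closure \<Gamma>D \<and> \<not> S \<subseteq> closure \<Gamma>C) \<or> (S \<subseteq> closure \<Gamma>C \<and> \<not> S \<subseteq> closure \<Gamma>D)"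
    and phat: "phat \<in> H1 \<Omega>" "has_trace \<Omega> phat \<Gamma>D pD"
    and cases: "\<Gamma>D \<noteq> {} \<or>
      (\<Gamma>D = {} \<and>
       (\<Sum>S\<in>facets_on \<Omega> \<T> \<Gamma>C. area S * pi_h \<Gamma>C \<alpha> S)
         \<le> (\<Sum>T\<in>\<T>. vol T * const_proj (lebesgue_on T) f) \<and>
       (\<Sum>T\<in>\<T>. vol T * const_proj (lebesgue_on T) f)
         \<le> (\<Sum>S\<in>facets_on \<Omega> \<T> \<Gamma>C. area S * pi_h \<Gamma>C \<beta> S))"
  shows "\<exists>u \<in> K_star \<Omega> \<Gamma>C \<T> f \<alpha> \<beta>.
      ereal (D_rt \<Omega> \<Gamma>D \<T> K (Pi_cr \<Omega> \<T> phat) u)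
        = (SUP v \<in> K_star \<Omega> \<Gamma>C \<T> f \<alpha> \<beta>. ereal (D_rt \<Omega> \<Gamma>D \<T> K (Pi_cr \<Omega> \<T> phat) v)) \<and>
      (\<forall>w \<in> K_star \<Omega> \<Gamma>C \<T> f \<alpha> \<beta>.
        ereal (D_rt \<Omega> \<Gamma>D \<T> K (Pi_cr \<Omega> \<T> phat) w)
          = (SUP v \<in> K_star \<Omega> \<Gamma>C \<T> f \<alpha> \<beta>. ereal (D_rt \<Omega> \<Gamma>D \<T> K (Pi_cr \<Omega> \<T> phat) v))
        \<longrightarrow> (AE x in lebesgue_on \<Omega>. w x = u x))"
proof -
  interpret mesh \<Omega> \<T>
    using dim dom mesh(1) by unfold_locales (auto simp: polyhedral_lipschitz_domain_def)
  let ?K = "K_star \<Omega> \<Gamma>C \<T> f \<alpha> \<beta>"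
  let ?D = "D_rt \<Omega> \<Gamma>D \<T> K (Pi_cr \<Omega> \<T> phat)"
  define B where "B T = inv_sqrt (const_proj (lebesgue_on T) K)" for T
  have inj: "x = 0" if T: "T \<in> \<T>" and x: "B T *v x = 0" for T x
    by (rule inv_sqrt_injective[OF const_proj_matrix[OF K_meas K_sym k01(1) K_bounds T] x[unfolded B_def]])
  obtain \<kappa> where \<kappa>: "\<And>v a b. rt_rep v a b \<Longrightarrow>
      (LINT x|surface_on \<Gamma>D. boundary_value \<T> P1 (Pi_cr \<Omega> \<T> phat) x * normal_flux \<Omega> \<T> v x) = (\<Sum>(T, p)\<in>bfacs. \<kappa> T p * bflux a b T p)"
    using boundary_functional_rep[OF bdry(1) Pi_cr_piecewise_P1] by blast
  have D: "?D v = - energy B \<kappa> b a" if "rt_rep v a b" for v a b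
    unfolding D_rt_def energy_def energy_rep[OF that] \<kappa>[OF that] B_def by simp
  have le: "pi_h \<Gamma>C \<alpha> (fac T p) \<le> pi_h \<Gamma>C \<beta> (fac T p)" if "(T, p) \<in> bfacs" for T p
    using that pi_h_mono[OF bdry(2) \<alpha>\<beta>, of T p] by (simp add: bfacs_def)
  \<comment> \<open>If \<open>\<Gamma>D\<close> is not empty, then it contains a point in the relative interior of a facet. This point is not
    in the closure of \<open>\<Gamma>C\<close>, so the facet carries no obstacle.\<close>
  have "(\<exists>(T, p)\<in>bfacs. \<not> fac T p \<subseteq> closure \<Gamma>C) \<or>
      (\<Sum>(T, p)\<in>bfacs. area (fac T p) * pi_h \<Gamma>C \<alpha> (fac T p)) \<le> (\<Sum>T\<in>\<T>. vol T * const_proj (lebesgue_on T) f) \<and>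
      (\<Sum>T\<in>\<T>. vol T * const_proj (lebesgue_on T) f) \<le> (\<Sum>(T, p)\<in>bfacs. area (fac T p) * pi_h \<Gamma>C \<beta> (fac T p))"
  proof (cases "\<Gamma>D = {}")
    case False
    obtain T p x where x: "(T, p) \<in> bfacs" "x \<in> ofac T p" "x \<in> \<Gamma>D"
      by (rule relatively_open_meets_ofac[OF bdry(1) False])
    obtain U where U: "open U" "\<Gamma>D = frontier \<Omega> \<inter> U" using bdry(1) unfolding openin_open by blast
    have "\<Gamma>C \<subseteq> frontier \<Omega>" using openin_subset[OF bdry(2)] by simp
    then have "U \<inter> \<Gamma>C = {}" using U(2) bdry(3) by blast
    then have "U \<inter> closure \<Gamma>C = {}" using open_Int_closure_eq_empty[OF U(1)] by blast
    then have "x \<notin> closure \<Gamma>C" using x(3) U(2) by blast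
    moreover have "x \<in> fac T p" using x(1,2) ofac_subset_fac[OF simplex] by (auto simp: bfacs_def)
    ultimately show ?thesis using x(1) by blast
  next
    case True
    have all: "fac T p \<subseteq> closure \<Gamma>C" if "(T, p) \<in> bfacs" for T p
    proof -
      have T: "T \<in> \<T>" "p \<in> verts T" using that by (auto simp: bfacs_def)
      have "fac T p \<in> boundary_facets \<Omega> \<T>"
        using that facet_of_simplex[OF simplex[OF T(1)]] by (auto simp: bfacs_def boundary_facets_def facets_def)
      moreover have "fac T p \<noteq> {}" using ofac_nonempty[OF T] ofac_subset_fac[OF simplex[OF T(1)] T(2)] by blast
      ultimately show ?thesis using mesh(2) True by auto
    qed
    have "{(T, p) \<in> bfacs. fac T p \<subseteq> closure \<Gamma>C} = bfacs" using all by blast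
    then have "facets_on \<Omega> \<T> \<Gamma>C = (\<lambda>(T, p). fac T p) ` bfacs" unfolding facets_on_eq by (rule arg_cong)
    then have "(\<Sum>S\<in>facets_on \<Omega> \<T> \<Gamma>C. area S * pi_h \<Gamma>C g S) = (\<Sum>(T, p)\<in>bfacs. area (fac T p) * pi_h \<Gamma>C g (fac T p))" for g
      using sum.reindex[OF fac_inj_boundary, of "\<lambda>S. area S * pi_h \<Gamma>C g S"] by (simp add: o_def case_prod_unfold)
    then show ?thesis using cases True by simp
  qed
  from K_star_nonempty[OF le this] have "?K \<noteq> {}" .
  have "\<exists>u\<in>?K. (\<forall>v\<in>?K. ?D v \<le> ?D u) \<and> (\<forall>v\<in>?K. ?D v = ?D u \<longrightarrow> (AE x in lebesgue_on \<Omega>. v x = u x))"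
    by (rule unique_minimiser[OF \<open>?K \<noteq> {}\<close>]) (fact inj, fact D)
  then obtain u where u: "u \<in> ?K" "\<forall>v\<in>?K. ?D v \<le> ?D u"
    "\<forall>v\<in>?K. ?D v = ?D u \<longrightarrow> (AE x in lebesgue_on \<Omega>. v x = u x)" by (elim bexE conjE) (rule that)
  have sup: "ereal (?D u) = (SUP v \<in> ?K. ereal (?D v))"
    using u(1,2) by (intro antisym SUP_upper SUP_least) auto
  show ?thesis
    unfolding sup[symmetric] using u(1,3) by auto
qed

end
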